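(* Let $d\geq1$. (a) Suppose that, for some fixed $t_0\in\mathbb R$, $1\leq r\leq\infty$, $C>0$, $$\|e^{it_0\Delta}u_0\|_{W(\mathcal FL^{r'},L^r)}\leq C\|u_0\|_{W(\mathcal FL^r,L^{r'})}\quad\text{for all }u_0\in\mathcal S(\mathbb R^d).$$ Then $r\geq2$. (b) Suppose that, for some $\alpha\in\mathbb R$, $C>0$, $\delta>0$, $1\leq r\leq\infty$, the estimate $$\|e^{it\Delta}u_0\|_{W(\mathcal FL^{r'},L^r)}\leq C\,t^\alpha\|u_0\|_{W(\mathcal FL^r,L^{r'})}\quad\text{for all }u_0\in\mathcal S(\mathbb R^d)$$ holds for every $t\in(0,\delta)$. Then $$\alpha\leq-2d\left(\frac12-\frac1r\right).$$ (c) Let $1\le r\le\infty$ and $u_0(x)=e^{-\pi|x|^2}$. Then, for some constant $c>0$ (independent of $t$), $$\|e^{it\Delta}u_0\|_{W(\mathcal FL^{r'},L^r)}\sim c\,t^{-d\left(\frac12-\frac1r\right)}\quad\text{as }t\to+\infty,$$ where $\sim$ means that the ratio of the two sides tends to $1$.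
   Context: $p'$ denotes the conjugate exponent of $p$, and $1/\infty=0$. $e^{it\Delta}$ is the Schr\"odinger propagator on $\mathbb R^d$ (solution operator of $i\partial_tu+\Delta u=0$), i.e. the Fourier multiplier with symbol $e^{-4\pi^2it|\xi|^2}$, where $\hat f(\xi)=\int f(x)e^{-2\pi ix\xi}dx$. $\mathcal FL^p$ is the space of tempered distributions $f$ with $\hat f\in L^p$, normed by $\|f\|_{\mathcal FL^p}=\|\hat f\|_{L^p}$. Fix a window $g\in C_0^\infty(\mathbb R^d)$ with $\|g\|_{L^2}=1$ (for $W(\mathcal FL^p,L^q)$ a Gaussian window is also admissible), and let $T_xg(y)=g(y-x)$. The Wiener amalgam space $W(\mathcal FL^p,L^q)$ consists of the $f$ locally in $\mathcal FL^p$ with $\|f\|_{W(\mathcal FL^p,L^q)}=\big\|x\mapsto\|f\,T_xg\|_{\mathcal FL^p}\big\|_{L^q}<\infty$. Different windows give equivalent norms (so $c$ in (c) may depend on the window). *)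

theory Defs
  imports "HOL-Probability.Probability"
begin

text \<open>Exponents in \<open>[1, \<infinity>]\<close> are extended nonnegative reals, and norms take values in \<^typ>\<open>ennreal\<close>,
  so that a norm may be infinite. In \<^typ>\<open>ennreal\<close> we have \<open>1 / \<infinity> = 0\<close> and \<open>1 / 0 = \<infinity>\<close>.\<close>

definition conj_exponent :: "ennreal \<Rightarrow> ennreal" where
  "conj_exponent p = 1 / (1 - 1 / p)"

definition ennreal_powr :: "ennreal \<Rightarrow> real \<Rightarrow> ennreal" where
  "ennreal_powr a s = (if a = \<infinity> then \<infinity> else ennreal (enn2real a powr s))"

text \<open>The \<open>L\<^sup>p\<close> norm is taken of functions with values in \<open>[0, \<infinity>]\<close>, because the outer norm of a
  Wiener amalgam space is applied to a function that is itself given by norms.\<close>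

definition Lp_norm :: "ennreal \<Rightarrow> ('a::euclidean_space \<Rightarrow> ennreal) \<Rightarrow> ennreal" where
  "Lp_norm p F =
    (if p = \<infinity> then esssup lborel F
     else ennreal_powr (\<integral>\<^sup>+x. ennreal_powr (F x) (enn2real p) \<partial>lborel) (1 / enn2real p))"

primrec partial_derivs :: "'a::euclidean_space list \<Rightarrow> ('a \<Rightarrow> complex) \<Rightarrow> 'a \<Rightarrow> complex" where
  "partial_derivs [] f = f"
| "partial_derivs (b # bs) f = (\<lambda>x. frechet_derivative (partial_derivs bs f) (at x) b)"

text \<open>\<open>C\<^sup>\<infinity>\<close>: all iterated partial derivatives exist and are (totally) differentiable everywhere.\<close>

definition smooth :: "('a::euclidean_space \<Rightarrow> complex) \<Rightarrow> bool" where
  "smooth f \<longleftrightarrow> (\<forall>bs \<in> lists Basis. \<forall>x. partial_derivs bs f differentiable (at x))"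

definition schwartz :: "('a::euclidean_space \<Rightarrow> complex) set" where
  "schwartz = {f. smooth f \<and>
     (\<forall>k. \<forall>bs \<in> lists Basis. bounded (range (\<lambda>x. norm x ^ k * norm (partial_derivs bs f x))))}"

definition test_functions :: "('a::euclidean_space \<Rightarrow> complex) set" where
  "test_functions = {f. smooth f \<and> compact (closure {x. f x \<noteq> 0})}"

definition gaussians :: "('a::euclidean_space \<Rightarrow> complex) set" where
  "gaussians = {\<lambda>x. A * of_real (exp (- a * (norm x)\<^sup>2)) | A a. a > 0}"

definition admissible_window :: "('a::euclidean_space \<Rightarrow> complex) \<Rightarrow> bool" where
  "admissible_window g \<longleftrightarrow>
     g \<in> test_functions \<union> gaussians \<and> Lp_norm 2 (\<lambda>x. ennreal (norm (g x))) = 1"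

text \<open>The Fourier transform is the classical integral. It is only ever applied to Schwartz
  functions here; for those it agrees with the transform of tempered distributions.\<close>

definition fourier :: "('a::euclidean_space \<Rightarrow> complex) \<Rightarrow> 'a \<Rightarrow> complex" where
  "fourier f \<xi> = (\<integral>x. f x * cis (- 2 * pi * (x \<bullet> \<xi>)) \<partial>lborel)"

definition inverse_fourier :: "('a::euclidean_space \<Rightarrow> complex) \<Rightarrow> 'a \<Rightarrow> complex" where
  "inverse_fourier h x = (\<integral>\<xi>. h \<xi> * cis (2 * pi * (x \<bullet> \<xi>)) \<partial>lborel)"

definition schrodinger :: "real \<Rightarrow> ('a::euclidean_space \<Rightarrow> complex) \<Rightarrow> 'a \<Rightarrow> complex" where
  "schrodinger t u = inverse_fourier (\<lambda>\<xi>. cis (- 4 * pi\<^sup>2 * t * (norm \<xi>)\<^sup>2) * fourier u \<xi>)"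

definition FL_norm :: "ennreal \<Rightarrow> ('a::euclidean_space \<Rightarrow> complex) \<Rightarrow> ennreal" where
  "FL_norm p f = Lp_norm p (\<lambda>\<xi>. ennreal (norm (fourier f \<xi>)))"

text \<open>The norm of \<open>W(\<F>L\<^sup>p, L\<^sup>q)\<close> computed with the window \<open>g\<close>.\<close>

definition amalgam_norm ::
  "('a::euclidean_space \<Rightarrow> complex) \<Rightarrow> ennreal \<Rightarrow> ennreal \<Rightarrow> ('a \<Rightarrow> complex) \<Rightarrow> ennreal" where
  "amalgam_norm g p q f = Lp_norm q (\<lambda>x. FL_norm p (\<lambda>y. f y * g (y - x)))"

end

theory Submission
  imports Defs
begin

text \<open>
All three parts are decided by Gaussians. The Schroedinger flow maps \<open>exp (- \<pi> l |x|\<^sup>2)\<close> to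
\<open>\<kappa> exp (- \<pi> z |x|\<^sup>2)\<close> with \<open>1 / z = 1 / l + 4 \<pi> i t\<close> and \<open>|\<kappa>| = |z / l|\<^sup>d\<^sup>/\<^sup>2\<close>, so what is needed is the size of
\<open>exp (- \<pi> z |x|\<^sup>2)\<close> in \<open>W(\<F>L\<^sup>p, L\<^sup>q)\<close>, for two kinds of parameters.

If \<open>z\<close> tends to \<open>0\<close> in the right half-plane, the Gaussian is flat on the scale of the window \<open>g\<close>, so that its product
with the window at \<open>x\<close> resembles \<open>exp (- \<pi> Re z |x|\<^sup>2) T\<^sub>x g\<close> up to phases and shifts in frequency, and the norm is
asymptotic to \<open>(Re z)\<^sup>-\<^sup>d\<^sup>/\<^sup>(\<^sup>2\<^sup>q\<^sup>)\<close> times \<open>\<parallel>exp (- \<pi> |x|\<^sup>2)\<parallel>\<^sub>q\<close> times the \<open>L\<^sup>p\<close> norm of the transform of \<open>g\<close>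
(\<open>amalgam_norm_gaussian_asymp\<close>). For fixed \<open>t\<close> and \<open>l \<rightarrow> 0\<close> both sides of the estimate in the first part are of this kind,
with outer exponents \<open>r\<close> and \<open>r'\<close>, and comparing powers of \<open>l\<close> gives \<open>1 / r \<le> 1 / r'\<close> (\<open>fixed_time_exponent\<close>). For
\<open>l = 1\<close> and \<open>t \<rightarrow> \<infinity>\<close> the same asymptotics is the third part (\<open>gaussian_large_time\<close>). The point is
uniformity: after the window has been moved to the origin one needs a bound for the transform of
\<open>g(w) exp (- \<pi> z |w|\<^sup>2 - 2 \<pi> v \<bullet> w)\<close> that is integrable in frequency and grows at most like \<open>exp (c |v|\<^sup>2)\<close>. It comes from
two integrations by parts in each coordinate (\<open>fourier_window_decay\<close>), which work in the same way for
compactly supported and for Gaussian windows, because all derivatives of both have Gaussian decay.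

For the second part take \<open>l = t\<^sup>-\<^sup>2\<close> and \<open>t \<rightarrow> 0\<close>. The initial datum has width \<open>t\<close>, while the solution at time \<open>t\<close> has width
of order one and frequencies of order \<open>1 / t\<close>. Large parameters are treated by convolution: the transform
of a product with \<open>exp (- \<pi> z |x|\<^sup>2)\<close> is a convolution with an explicit Gaussian, of which the supremum and the \<open>L\<^sup>1\<close>
norm are known (\<open>fourier_mult_gauss_factor_bounds\<close>). Interpolation between the two bounds the norm of the datum by
\<open>t\<^sup>d\<^sup>/\<^sup>r\<^sup>'\<close>. The supremum bound together with Plancherel's theorem bounds the norm of the solution from below by \<open>t\<^sup>d\<^sup>/\<^sup>r\<close>,
since \<open>r' \<le> 2\<close> by the first part (\<open>amalgam_norm_chirp_ge\<close>). Hence \<open>\<alpha> + d / r' \<le> d / r\<close>.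
\<close>

section \<open>Exponents and Lebesgue norms\<close>

lemma ennreal_powr_ennreal: "0 \<le> x \<Longrightarrow> ennreal_powr (ennreal x) s = ennreal (x powr s)"
  by (simp add: ennreal_powr_def)

lemma ennreal_powr_mono: "a \<le> b \<Longrightarrow> 0 \<le> s \<Longrightarrow> ennreal_powr a s \<le> ennreal_powr b s"
  by (cases a; cases b)
    (auto simp: ennreal_powr_def top_unique intro!: ennreal_leI powr_mono2)

lemma ennreal_powr_cmult:
  assumes "0 < c" shows "ennreal_powr (ennreal c * a) s = ennreal (c powr s) * ennreal_powr a s"
  using assms by (cases a) (auto simp: ennreal_powr_def ennreal_mult_eq_top_iff ennreal_mult'[symmetric]
      ennreal_mult_top powr_mult)

lemma measurable_ennreal_powr [measurable]:
  assumes [measurable]: "F \<in> borel_measurable M"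
  shows "(\<lambda>x. ennreal_powr (F x) s) \<in> borel_measurable M"
  unfolding ennreal_powr_def by measurable

text \<open>Exponents only enter through \<open>1 / p\<close> as a real number, which is \<open>0\<close> for \<open>p = \<infinity>\<close>.\<close>

lemma recip_exponent:
  assumes "1 \<le> p" "p \<noteq> \<infinity>"
  shows "1 \<le> enn2real p" "enn2real (1 / p) = 1 / enn2real p"
proof -
  obtain s where s: "p = ennreal s" "0 \<le> s" using assms(2) by (cases p) auto
  then have "1 \<le> s" using assms(1) by (metis ennreal_1 ennreal_le_iff)
  then show "1 \<le> enn2real p" "enn2real (1 / p) = 1 / enn2real p"
    using s by (auto simp: divide_ennreal simp flip: ennreal_1)
qed

lemma recip_exponent_bounds:
  assumes "1 \<le> p" shows "0 \<le> enn2real (1 / p)" "enn2real (1 / p) \<le> 1"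
  using recip_exponent[OF assms] by (cases "p = \<infinity>"; simp)+

lemma ennreal_recip: assumes "1 \<le> p" shows "1 / p = ennreal (enn2real (1 / p))"
proof (cases "p = \<infinity>")
  case False
  then obtain s where s: "p = ennreal s" "0 \<le> s" by (cases p) auto
  with recip_exponent[OF assms False] show ?thesis by (auto simp: divide_ennreal simp flip: ennreal_1)
qed auto

lemma conj_exponent_recip:
  assumes "1 \<le> r" shows "1 \<le> conj_exponent r" "enn2real (1 / conj_exponent r) = 1 - enn2real (1 / r)"
proof -
  define u where "u = enn2real (1 / r)"
  have u: "0 \<le> u" "u \<le> 1" using recip_exponent_bounds[OF assms] by (auto simp: u_def)
  have c: "conj_exponent r = 1 / ennreal (1 - u)"
    unfolding conj_exponent_def using u
    by (subst ennreal_recip[OF assms]) (simp add: ennreal_minus u_def flip: ennreal_1)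
  show "1 \<le> conj_exponent r"
    using u by (cases "u = 1") (auto simp: c divide_ennreal field_simps simp flip: ennreal_1)
  show "enn2real (1 / conj_exponent r) = 1 - enn2real (1 / r)"
    unfolding u_def[symmetric] c
    using u by (cases "u = 1") (auto simp: divide_ennreal simp flip: ennreal_1)
qed

lemma two_le_exponent_iff:
  assumes "1 \<le> r" shows "2 \<le> r \<longleftrightarrow> enn2real (1 / r) \<le> 1 / 2"
proof (cases "r = \<infinity>")
  case False
  then obtain s where s: "r = ennreal s" "0 \<le> s" by (cases r) auto
  have "ennreal 2 \<le> ennreal s \<longleftrightarrow> 2 \<le> s" using s by (intro ennreal_le_iff) auto
  moreover have "1 \<le> s" "enn2real (1 / r) = 1 / s" using recip_exponent[OF assms False] s by auto
  ultimately show ?thesis using s by (auto simp: divide_le_eq)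
qed auto

lemma nn_integral_lborel_affine:
  fixes F :: "'a::euclidean_space \<Rightarrow> ennreal"
  assumes [measurable]: "F \<in> borel_measurable borel" and c: "c \<noteq> 0"
  shows "(\<integral>\<^sup>+x. F (t + c *\<^sub>R x) \<partial>lborel) = ennreal (\<bar>c\<bar> powr - real DIM('a)) * (\<integral>\<^sup>+x. F x \<partial>lborel)"
proof -
  have "(\<integral>\<^sup>+x. F x \<partial>lborel) = ennreal (\<bar>c\<bar> ^ DIM('a)) * (\<integral>\<^sup>+x. F (t + c *\<^sub>R x) \<partial>lborel)"
    by (subst lborel_affine[OF c, of t]) (simp add: nn_integral_density nn_integral_distr nn_integral_cmult)
  then show ?thesis using c
    by (simp add: mult.assoc[symmetric] ennreal_mult'[symmetric] powr_minus powr_realpow)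
qed

lemma AE_lborel_affine:
  fixes t :: "'a::euclidean_space"
  assumes c: "c \<noteq> 0" and [measurable]: "Measurable.pred borel P"
  shows "(AE x in lborel. P (t + c *\<^sub>R x)) \<longleftrightarrow> (AE x in lborel. P x)"
  by (subst (2) lborel_affine[OF c, of t]) (use c in \<open>simp add: AE_density AE_distr_iff\<close>)

lemma Lp_norm_affine:
  fixes F :: "'a::euclidean_space \<Rightarrow> ennreal"
  assumes [measurable]: "F \<in> borel_measurable borel" and c: "0 < c" and p: "1 \<le> p"
  shows "Lp_norm p (\<lambda>x. F (t + c *\<^sub>R x)) = ennreal (c powr - (real DIM('a) * enn2real (1 / p))) * Lp_norm p F"
proof (cases "p = \<infinity>")
  case True
  have "esssup lborel (\<lambda>x. F (t + c *\<^sub>R x)) = esssup lborel F"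
    using c by (simp add: esssup_eq_AE AE_lborel_affine[where P = "\<lambda>x. F x \<le> z" for z])
  with True c show ?thesis by (simp add: Lp_norm_def)
next
  case False
  note pf = recip_exponent[OF p False]
  show ?thesis using False c pf
    by (simp add: Lp_norm_def nn_integral_lborel_affine[where F = "\<lambda>x. ennreal_powr (F x) s" for s]
        ennreal_powr_cmult powr_powr)
qed

lemma Lp_norm_cmult:
  assumes c: "0 < c" and [measurable]: "F \<in> borel_measurable borel" and p: "1 \<le> p"
  shows "Lp_norm p (\<lambda>x. ennreal c * F x) = ennreal c * Lp_norm p F"
proof (cases "p = \<infinity>")
  case True
  have "esssup lborel (\<lambda>x. ennreal c * F x) \<le> ennreal c * esssup lborel F"
    by (rule esssup_I) (use esssup_AE[of F lborel] in \<open>auto elim!: eventually_mono intro!: mult_left_mono\<close>)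
  moreover have "esssup lborel F \<le> ennreal (1/c) * esssup lborel (\<lambda>x. ennreal c * F x)"
  proof (rule esssup_I)
    show "AE x in lborel. F x \<le> ennreal (1/c) * esssup lborel (\<lambda>x. ennreal c * F x)"
      using esssup_AE[of "\<lambda>x. ennreal c * F x" lborel]
    proof eventually_elim
      case (elim x)
      have "F x = ennreal (1/c) * (ennreal c * F x)"
        using c by (simp add: mult.assoc[symmetric] ennreal_mult'[symmetric])
      then show ?case using elim by (metis mult_left_mono zero_le)
    qed
  qed simp
  then have "ennreal c * esssup lborel F \<le> ennreal c * (ennreal (1/c) * esssup lborel (\<lambda>x. ennreal c * F x))"
    by (intro mult_left_mono) auto
  then have "ennreal c * esssup lborel F \<le> esssup lborel (\<lambda>x. ennreal c * F x)"
    using c by (simp add: mult.assoc[symmetric] ennreal_mult'[symmetric])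
  ultimately show ?thesis using True by (simp add: Lp_norm_def)
next
  case False
  note pf = recip_exponent[OF p False]
  show ?thesis using False c pf
    by (simp add: Lp_norm_def ennreal_powr_cmult nn_integral_cmult powr_powr)
qed

lemma Lp_norm_finite_eq:
  fixes F :: "'a::euclidean_space \<Rightarrow> real"
  assumes p: "1 \<le> p" "p \<noteq> \<infinity>" and F: "\<And>x. 0 \<le> F x" "integrable lborel (\<lambda>x. F x powr enn2real p)"
  shows "Lp_norm p (\<lambda>x. ennreal (F x)) = ennreal ((\<integral>x. F x powr enn2real p \<partial>lborel) powr enn2real (1 / p))"
  using p F recip_exponent[OF p]
  by (simp add: Lp_norm_def ennreal_powr_ennreal nn_integral_eq_integral)

lemma integrable_powr_bounded:
  fixes F G :: "'a::euclidean_space \<Rightarrow> real"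
  assumes [measurable]: "F \<in> borel_measurable borel" and G: "integrable lborel G" "\<And>x. G x \<le> M"
    and FG: "\<And>x. 0 \<le> F x" "\<And>x. F x \<le> G x" and s: "1 \<le> s"
  shows "F x powr s \<le> M powr (s - 1) * G x" "integrable lborel (\<lambda>x. F x powr s)"
proof -
  have *: "F x powr s \<le> M powr (s - 1) * G x" for x
  proof -
    have "F x powr s = F x powr (s - 1) * F x" using FG(1)[of x]
      by (cases "F x = 0") (auto simp: powr_mult_base powr_minus_divide powr_diff)
    also have "\<dots> \<le> M powr (s - 1) * G x"
      using FG[of x] G(2)[of x] s by (intro mult_mono powr_mono2) auto
    finally show ?thesis .
  qed
  then show "F x powr s \<le> M powr (s - 1) * G x" .
  show "integrable lborel (\<lambda>x. F x powr s)"
    by (rule Bochner_Integration.integrable_bound[of _ "\<lambda>x. M powr (s - 1) * G x"])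
      (use G * in \<open>auto intro: order_trans[OF _ abs_ge_self]\<close>)
qed

text \<open>Uniform convergence settles \<open>p = \<infinity>\<close>, domination by a bounded integrable function settles
  \<open>p < \<infinity>\<close>; asking for both allows all exponents to be treated at once.\<close>

lemma Lp_norm_tendsto:
  fixes F :: "nat \<Rightarrow> 'a::euclidean_space \<Rightarrow> real"
  assumes p: "1 \<le> p"
    and meas [measurable]: "\<And>k. F k \<in> borel_measurable borel" "F0 \<in> borel_measurable borel"
    and G: "integrable lborel G" "\<And>x. G x \<le> M"
    and FG: "\<And>k x. 0 \<le> F k x" "\<And>k x. F k x \<le> G x" "\<And>x. 0 \<le> F0 x" "\<And>x. F0 x \<le> G x"
    and unif: "\<And>e. 0 < e \<Longrightarrow> eventually (\<lambda>k. \<forall>x. \<bar>F k x - F0 x\<bar> \<le> e) sequentially"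
  shows "(\<lambda>k. enn2real (Lp_norm p (\<lambda>x. ennreal (F k x)))) \<longlonglongrightarrow> enn2real (Lp_norm p (\<lambda>x. ennreal (F0 x)))"
proof (cases "p = \<infinity>")
  case True
  have M: "0 \<le> M" using FG(3)[of 0] FG(4)[of 0] G(2)[of 0] by simp
  have le: "esssup lborel (\<lambda>x. ennreal (H x)) \<le> esssup lborel (\<lambda>x. ennreal (H' x)) + ennreal e"
    if [measurable]: "H \<in> borel_measurable borel" "H' \<in> borel_measurable borel"
      and e: "0 \<le> e" "\<And>x. 0 \<le> H' x" "\<And>x. H x \<le> H' x + e" for H H' :: "'a \<Rightarrow> real" and e
  proof (rule esssup_I)
    show "AE x in lborel. ennreal (H x) \<le> esssup lborel (\<lambda>x. ennreal (H' x)) + ennreal e"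
      using esssup_AE[of "\<lambda>x. ennreal (H' x)" lborel]
    proof eventually_elim
      case (elim x)
      have "ennreal (H x) \<le> ennreal (H' x) + ennreal e"
        using e by (simp add: ennreal_leI ennreal_plus[symmetric] del: ennreal_plus)
      with elim show ?case by (meson add_mono order_refl order_trans)
    qed
  qed simp
  have fin: "esssup lborel (\<lambda>x. ennreal (H x)) < \<infinity>"
    if [measurable]: "H \<in> borel_measurable borel" and "\<And>x. H x \<le> M" for H :: "'a \<Rightarrow> real"
  proof -
    have "esssup lborel (\<lambda>x. ennreal (H x)) \<le> ennreal M"
      by (rule esssup_I) (use that in \<open>auto intro!: ennreal_leI\<close>)
    then show ?thesis by (simp add: le_less_trans)
  qed
  let ?n = "\<lambda>H. enn2real (esssup lborel (\<lambda>x. ennreal (H x)))"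
  have real_le: "?n H \<le> ?n H' + e"
    if "H \<in> borel_measurable borel" "H' \<in> borel_measurable borel"
      and "0 \<le> e" "\<And>x. 0 \<le> H' x" "\<And>x. H x \<le> H' x + e" "\<And>x. H x \<le> M" "\<And>x. H' x \<le> M"
    for H H' :: "'a \<Rightarrow> real" and e
  proof -
    have "enn2real (esssup lborel (\<lambda>x. ennreal (H x))) \<le> enn2real (esssup lborel (\<lambda>x. ennreal (H' x)) + ennreal e)"
      using le[of H H' e] that fin[of H'] by (intro enn2real_mono) auto
    also have "\<dots> = ?n H' + e" using that fin[of H'] by (subst enn2real_plus) auto
    finally show ?thesis .
  qed
  have b: "F k x \<le> M" "F0 x \<le> M" for k x using FG G(2) order_trans by blast+
  show ?thesis
  proof (rule LIMSEQ_I)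
    fix e :: real assume e: "0 < e"
    then have "eventually (\<lambda>k. \<forall>x. \<bar>F k x - F0 x\<bar> \<le> e/2) sequentially" by (intro unif) auto
    then have "eventually (\<lambda>k. norm (?n (F k) - ?n F0) < e) sequentially"
    proof eventually_elim
      case (elim k)
      have 1: "F k x \<le> F0 x + e/2" "F0 x \<le> F k x + e/2" for x
        using elim[rule_format, of x] by linarith+
      have "?n (F k) \<le> ?n F0 + e/2" by (rule real_le) (use 1 b FG e in auto)
      moreover have "?n F0 \<le> ?n (F k) + e/2" by (rule real_le) (use 1 b FG e in auto)
      ultimately show ?case using e by (auto simp: abs_less_iff)
    qed
    then show "\<exists>no. \<forall>k\<ge>no. norm (enn2real (Lp_norm p (\<lambda>x. ennreal (F k x))) - enn2real (Lp_norm p (\<lambda>x. ennreal (F0 x)))) < e"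
      using True by (simp add: Lp_norm_def eventually_sequentially)
  qed
next
  case False
  note pf = recip_exponent[OF p False]
  let ?s = "enn2real p"
  have i: "integrable lborel (\<lambda>x. F k x powr ?s)" "integrable lborel (\<lambda>x. F0 x powr ?s)" for k
    by (rule integrable_powr_bounded(2)[OF _ G]; use FG pf in auto)+
  have pt: "(\<lambda>k. F k x) \<longlonglongrightarrow> F0 x" for x
  proof (rule LIMSEQ_I)
    fix e :: real assume e: "0 < e"
    then have "eventually (\<lambda>k. \<forall>x. \<bar>F k x - F0 x\<bar> \<le> e/2) sequentially" by (intro unif) auto
    then have "eventually (\<lambda>k. norm (F k x - F0 x) < e) sequentially"
    proof eventually_elim
      case (elim k) then show ?case using e elim[rule_format, of x] unfolding real_norm_def by linarith
    qed
    then show "\<exists>no. \<forall>k\<ge>no. norm (F k x - F0 x) < e" by (simp add: eventually_sequentially)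
  qed
  have "(\<lambda>k. \<integral>x. F k x powr ?s \<partial>lborel) \<longlonglongrightarrow> (\<integral>x. F0 x powr ?s \<partial>lborel)"
  proof (rule integral_dominated_convergence[where w = "\<lambda>x. M powr (?s - 1) * G x"])
    show "integrable lborel (\<lambda>x. M powr (?s - 1) * G x)" using G by auto
    show "AE x in lborel. (\<lambda>k. F k x powr ?s) \<longlonglongrightarrow> F0 x powr ?s"
      using pt FG pf by (auto intro!: tendsto_powr')
    show "AE x in lborel. norm (F k x powr ?s) \<le> M powr (?s - 1) * G x" for k
      using integrable_powr_bounded(1)[OF meas(1) G FG(1,2) pf(1), of k] by auto
  qed auto
  then have "(\<lambda>k. (\<integral>x. F k x powr ?s \<partial>lborel) powr enn2real (1 / p))
      \<longlonglongrightarrow> (\<integral>x. F0 x powr ?s \<partial>lborel) powr enn2real (1 / p)"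
    using pf by (intro tendsto_powr') (auto intro!: always_eventually integral_nonneg_AE)
  then show ?thesis
    using i FG by (simp add: Lp_norm_finite_eq[OF p False])
qed

lemma Lp_norm_finite:
  fixes F G :: "'a::euclidean_space \<Rightarrow> real"
  assumes p: "1 \<le> p" and [measurable]: "F \<in> borel_measurable borel"
    and G: "integrable lborel G" "\<And>x. G x \<le> M"
    and FG: "\<And>x. 0 \<le> F x" "\<And>x. F x \<le> G x"
  shows "Lp_norm p (\<lambda>x. ennreal (F x)) < \<infinity>"
proof (cases "p = \<infinity>")
  case True
  have "F x \<le> M" for x using FG(2)[of x] G(2)[of x] by simp
  then have "esssup lborel (\<lambda>x. ennreal (F x)) \<le> ennreal M"
    by (intro esssup_I) (auto intro!: ennreal_leI)
  then show ?thesis using True by (simp add: Lp_norm_def le_less_trans)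
next
  case False
  then show ?thesis
    using integrable_powr_bounded(2)[of F G M "enn2real p"] assms recip_exponent[OF p False]
    by (simp add: Lp_norm_finite_eq)
qed

lemma Lp_norm_pos:
  assumes p: "1 \<le> p" and [measurable]: "F \<in> borel_measurable borel"
    and F: "\<not> (AE x in lborel. F x = 0)"
  shows "0 < Lp_norm p F"
proof (cases "p = \<infinity>")
  case True
  have "esssup lborel F \<noteq> 0" using esssup_AE[of F lborel] F by auto
  then show ?thesis using True by (simp add: Lp_norm_def zero_less_iff_neq_zero)
next
  case False
  note pf = recip_exponent[OF p False]
  have z: "ennreal_powr a s = 0 \<longleftrightarrow> a = 0" for a s by (cases a) (auto simp: ennreal_powr_def)
  have "(\<integral>\<^sup>+x. ennreal_powr (F x) (enn2real p) \<partial>lborel) \<noteq> 0"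
    using F by (simp add: nn_integral_0_iff_AE z)
  then show ?thesis using False z by (simp add: Lp_norm_def zero_less_iff_neq_zero)
qed

lemma Lp_norm_mono:
  assumes p: "1 \<le> p" and "F \<in> borel_measurable borel" and FG: "\<And>x. F x \<le> G x"
  shows "Lp_norm p F \<le> Lp_norm p G"
proof (cases "p = \<infinity>")
  case True then show ?thesis using assms by (auto simp: Lp_norm_def intro!: esssup_mono)
next
  case False
  note pf = recip_exponent[OF p False]
  show ?thesis using False pf FG
    by (auto simp: Lp_norm_def intro!: ennreal_powr_mono nn_integral_mono)
qed

lemma Lp_norm_mono_finite:
  assumes p: "1 \<le> p" "p \<noteq> \<infinity>" and FG: "\<And>x. F x \<le> G x"
  shows "Lp_norm p F \<le> Lp_norm p G"
  using p recip_exponent[OF p] FG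
  by (auto simp: Lp_norm_def intro!: ennreal_powr_mono nn_integral_mono)

lemma Lp_norm_1: "Lp_norm 1 F = (\<integral>\<^sup>+x. F x \<partial>lborel)"
proof -
  have "ennreal_powr a 1 = a" for a by (cases a) (auto simp: ennreal_powr_def)
  then show ?thesis by (simp add: Lp_norm_def)
qed

text \<open>The elementary case of log-convexity: \<open>F\<^sup>p \<le> S\<^sup>p\<^sup>-\<^sup>1 F\<close> pointwise.\<close>

lemma Lp_norm_interpolate:
  fixes F :: "'a::euclidean_space \<Rightarrow> real"
  assumes p: "1 \<le> p" and [measurable]: "F \<in> borel_measurable borel"
    and F: "\<And>x. 0 \<le> F x" "\<And>x. F x \<le> S" and L: "(\<integral>\<^sup>+x. ennreal (F x) \<partial>lborel) \<le> ennreal L" "0 \<le> L"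
  shows "Lp_norm p (\<lambda>x. ennreal (F x)) \<le> ennreal (S powr (1 - enn2real (1 / p)) * L powr enn2real (1 / p))"
proof (cases "p = \<infinity>")
  case True
  have S: "0 \<le> S" using F order_trans by blast
  have 1: "esssup lborel (\<lambda>x. ennreal (F x)) \<le> ennreal S"
    by (rule esssup_I) (use F in \<open>auto intro!: ennreal_leI\<close>)
  show ?thesis
  proof (cases "L = 0")
    case False
    then show ?thesis using True S 1 by (simp add: Lp_norm_def)
  next
    case True': True
    then have "(\<integral>\<^sup>+x. ennreal (F x) \<partial>lborel) = 0" using L(1) by simp
    then have "AE x in lborel. ennreal (F x) = 0" by (subst (asm) nn_integral_0_iff_AE) auto
    then have "AE x in lborel. ennreal (F x) \<le> 0" by eventually_elim auto
    then have "esssup lborel (\<lambda>x. ennreal (F x)) \<le> 0" by (intro esssup_I) auto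
    then show ?thesis using True by (simp add: Lp_norm_def)
  qed
next
  case False
  note pf = recip_exponent[OF p False]
  let ?s = "enn2real p"
  have S: "0 \<le> S" using F order_trans by blast
  have "(\<integral>\<^sup>+x. ennreal (F x powr ?s) \<partial>lborel) \<le> (\<integral>\<^sup>+x. ennreal (S powr (?s - 1)) * ennreal (F x) \<partial>lborel)"
  proof (rule nn_integral_mono)
    fix x
    have "F x powr ?s = F x powr (?s - 1) * F x" using F(1)[of x]
      by (cases "F x = 0") (auto simp: powr_mult_base powr_minus_divide powr_diff)
    also have "\<dots> \<le> S powr (?s - 1) * F x"
      using F pf by (intro mult_right_mono powr_mono2) auto
    finally show "ennreal (F x powr ?s) \<le> ennreal (S powr (?s - 1)) * ennreal (F x)"
      using F by (simp add: ennreal_mult'[symmetric] ennreal_leI)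
  qed
  also have "\<dots> \<le> ennreal (S powr (?s - 1)) * ennreal L"
    using L by (simp add: nn_integral_cmult mult_left_mono)
  also have "\<dots> = ennreal (S powr (?s - 1) * L)" using L by (simp add: ennreal_mult')
  finally have "ennreal_powr (\<integral>\<^sup>+x. ennreal (F x powr ?s) \<partial>lborel) (1 / ?s) \<le> ennreal_powr (ennreal (S powr (?s - 1) * L)) (1 / ?s)"
    using pf by (intro ennreal_powr_mono) auto
  also have "\<dots> = ennreal (S powr ((?s - 1) * (1 / ?s)) * L powr (1 / ?s))"
    using L S by (simp add: ennreal_powr_ennreal powr_mult powr_powr)
  also have "(?s - 1) * (1 / ?s) = 1 - 1 / ?s" using pf(1) by (simp add: diff_divide_distrib)
  finally show ?thesis using False pf F by (simp add: Lp_norm_def ennreal_powr_ennreal)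
qed

text \<open>For \<open>p \<le> 2\<close>, boundedness turns a lower bound in \<open>L\<^sup>2\<close> into one in \<open>L\<^sup>p\<close>, since
  \<open>F\<^sup>2 \<le> S\<^sup>2\<^sup>-\<^sup>p F\<^sup>p\<close> pointwise.\<close>

lemma Lp_norm_ge_L2:
  fixes F :: "'a::euclidean_space \<Rightarrow> real"
  assumes p: "1 \<le> p" "p \<le> 2" and [measurable]: "F \<in> borel_measurable borel"
    and F: "\<And>x. 0 \<le> F x" "\<And>x. F x \<le> S" and S: "0 < S"
    and K: "ennreal K \<le> (\<integral>\<^sup>+x. ennreal ((F x)\<^sup>2) \<partial>lborel)" "0 \<le> K"
  shows "ennreal (K powr enn2real (1 / p) * S powr (1 - 2 * enn2real (1 / p))) \<le> Lp_norm p (\<lambda>x. ennreal (F x))"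
proof -
  have pinf: "p \<noteq> \<infinity>" using p(2) by (auto simp: top_unique)
  note pf = recip_exponent[OF p(1) pinf]
  let ?s = "enn2real p"
  have s2: "?s \<le> 2" using p(2) pinf by (cases p) (auto simp: ennreal_le_iff simp flip: ennreal_numeral)
  have "ennreal K \<le> (\<integral>\<^sup>+x. ennreal (S powr (2 - ?s)) * ennreal (F x powr ?s) \<partial>lborel)"
  proof (rule order_trans[OF K(1)], rule nn_integral_mono)
    fix x
    have "(F x)\<^sup>2 = F x powr (2 - ?s) * F x powr ?s"
      using F(1)[of x] powr_add[of "F x" "2 - ?s" ?s] by (cases "F x = 0") auto
    also have "\<dots> \<le> S powr (2 - ?s) * F x powr ?s"
      using F s2 by (intro mult_right_mono powr_mono2) auto
    finally show "ennreal ((F x)\<^sup>2) \<le> ennreal (S powr (2 - ?s)) * ennreal (F x powr ?s)"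
      by (simp add: ennreal_mult'[symmetric] ennreal_leI)
  qed
  also have "\<dots> = ennreal (S powr (2 - ?s)) * (\<integral>\<^sup>+x. ennreal (F x powr ?s) \<partial>lborel)"
    by (simp add: nn_integral_cmult)
  finally have "ennreal (S powr (?s - 2)) * ennreal K \<le> ennreal (S powr (?s - 2)) * (ennreal (S powr (2 - ?s)) * (\<integral>\<^sup>+x. ennreal (F x powr ?s) \<partial>lborel))"
    by (intro mult_left_mono) auto
  also have "\<dots> = (\<integral>\<^sup>+x. ennreal (F x powr ?s) \<partial>lborel)"
    using S powr_add[of S "?s - 2" "2 - ?s"] by (simp add: mult.assoc[symmetric] ennreal_mult'[symmetric])
  finally have le: "ennreal_powr (ennreal (K * S powr (?s - 2))) (1 / ?s) \<le> ennreal_powr (\<integral>\<^sup>+x. ennreal (F x powr ?s) \<partial>lborel) (1 / ?s)"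
    using pf(1) K by (intro ennreal_powr_mono) (auto simp: ennreal_mult' mult.commute)
  have "(K * S powr (?s - 2)) powr (1 / ?s) = K powr (1 / ?s) * S powr ((?s - 2) * (1 / ?s))"
    by (simp only: powr_mult powr_powr)
  moreover have "(?s - 2) * (1 / ?s) = 1 - 2 * enn2real (1 / p)"
    unfolding pf(2) using pf(1) by (simp add: diff_divide_distrib)
  ultimately have eq: "(K * S powr (?s - 2)) powr (1 / ?s) = K powr enn2real (1 / p) * S powr (1 - 2 * enn2real (1 / p))"
    unfolding pf(2) by presburger
  have "Lp_norm p (\<lambda>x. ennreal (F x)) = ennreal_powr (\<integral>\<^sup>+x. ennreal (F x powr ?s) \<partial>lborel) (1 / ?s)"
    using pinf F by (simp add: Lp_norm_def ennreal_powr_ennreal)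
  moreover have "0 \<le> K * S powr (?s - 2)" using K by simp
  ultimately show ?thesis using le eq by (simp only: ennreal_powr_ennreal)
qed

lemma Lp_norm_ge_cball:
  fixes F :: "'a::euclidean_space \<Rightarrow> ennreal"
  assumes q: "1 \<le> q" and c: "0 < c" and F: "\<And>x. norm x \<le> 1 \<Longrightarrow> ennreal c \<le> F x"
  shows "ennreal (c * (measure lborel (cball 0 1 :: 'a set)) powr enn2real (1 / q)) \<le> Lp_norm q F"
proof (cases "q = \<infinity>")
  case True
  have "ennreal c \<le> esssup lborel F"
  proof (rule ccontr)
    assume n: "\<not> ?thesis"
    have "AE x in lborel. x \<notin> (cball 0 1 :: 'a set)"
      using esssup_AE[of F lborel]
    proof eventually_elim
      case (elim x)
      then show ?case using F[of x] n by (auto intro: order_trans)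
    qed
    then have "emeasure lborel (cball 0 1 :: 'a set) = 0"
      by (subst (asm) AE_iff_measurable[OF _ refl]) (auto simp: cball_def)
    moreover have "emeasure lborel (cball 0 1 :: 'a set) \<noteq> 0"
      by (simp add: emeasure_cball ennreal_eq_0_iff not_le)
    ultimately show False by simp
  qed
  moreover have "measure lborel (cball 0 1 :: 'a set) > 0" by (simp add: content_cball)
  ultimately show ?thesis using True c by (simp add: Lp_norm_def)
next
  case False
  note qf = recip_exponent[OF q False]
  let ?s = "enn2real q" let ?m = "measure lborel (cball 0 1 :: 'a set)"
  have m: "emeasure lborel (cball 0 1 :: 'a set) = ennreal ?m"
    by (intro emeasure_eq_ennreal_measure) (simp add: emeasure_cball)
  have "ennreal (c powr ?s * ?m) = (\<integral>\<^sup>+x. ennreal (c powr ?s) * indicator (cball 0 1 :: 'a set) x \<partial>lborel)"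
    by (simp add: nn_integral_cmult_indicator m ennreal_mult')
  also have "\<dots> \<le> (\<integral>\<^sup>+x. ennreal_powr (F x) ?s \<partial>lborel)"
  proof (rule nn_integral_mono)
    fix x :: 'a
    show "ennreal (c powr ?s) * indicator (cball 0 1 :: 'a set) x \<le> ennreal_powr (F x) ?s"
      using ennreal_powr_mono[OF F[of x], of ?s] c qf
      by (cases "x \<in> cball 0 1") (auto simp: ennreal_powr_ennreal)
  qed
  finally have "ennreal_powr (ennreal (c powr ?s * ?m)) (1 / ?s) \<le> Lp_norm q F"
    using False qf by (simp add: Lp_norm_def ennreal_powr_mono)
  then show ?thesis using c qf by (simp add: ennreal_powr_ennreal powr_mult powr_powr)
qed

section \<open>Smooth functions with Gaussian decay\<close>

abbreviation pderiv_in :: "'a::euclidean_space \<Rightarrow> ('a \<Rightarrow> complex) \<Rightarrow> 'a \<Rightarrow> complex" where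
  "pderiv_in b f \<equiv> (\<lambda>x. frechet_derivative f (at x) b)"

lemma partial_derivs_snoc: "partial_derivs (bs @ [b]) f = partial_derivs bs (pderiv_in b f)"
  by (induction bs) auto

text \<open>Smoothness and decay of all derivatives will be shown by exhibiting a set of functions that is closed under
  differentiation, as in a proof by coinduction.\<close>

lemma partial_derivs_coinduct:
  assumes "f \<in> S" "\<And>f b. f \<in> S \<Longrightarrow> b \<in> Basis \<Longrightarrow> pderiv_in b f \<in> S" "bs \<in> lists Basis"
  shows "partial_derivs bs f \<in> S"
  using assms(3,1) by (induction bs arbitrary: f rule: rev_induct) (auto simp: partial_derivs_snoc assms(2))

lemma pderiv_in_mult:
  assumes "f differentiable at x" "g differentiable at x"
  shows "pderiv_in b (\<lambda>x. f x * g x) x = f x * pderiv_in b g x + pderiv_in b f x * g x"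
proof -
  have "((\<lambda>x. f x * g x) has_derivative
      (\<lambda>h. f x * frechet_derivative g (at x) h + frechet_derivative f (at x) h * g x)) (at x)"
    using assms by (intro has_derivative_mult) (auto simp: frechet_derivative_works)
  from frechet_derivative_at[OF this, symmetric] show ?thesis by simp
qed

lemma pderiv_in_add:
  assumes "f differentiable at x" "g differentiable at x"
  shows "pderiv_in b (\<lambda>x. f x + g x) x = pderiv_in b f x + pderiv_in b g x"
proof -
  have "((\<lambda>x. f x + g x) has_derivative
      (\<lambda>h. frechet_derivative f (at x) h + frechet_derivative g (at x) h)) (at x)"
    using assms by (intro has_derivative_add) (auto simp: frechet_derivative_works)
  from frechet_derivative_at[OF this, symmetric] show ?thesis by simp
qed

lemma pderiv_in_eqI: "(f has_derivative f') (at x) \<Longrightarrow> pderiv_in b f x = f' b"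
  using frechet_derivative_at by metis

lemma pderiv_in_const_eq: "pderiv_in b (\<lambda>_. c) x = 0"
  by (rule pderiv_in_eqI) (rule has_derivative_const)

lemma pderiv_in_cmult:
  assumes "f differentiable at x"
  shows "pderiv_in b (\<lambda>x. c * f x) x = c * pderiv_in b f x"
  by (subst pderiv_in_mult) (auto simp: assms pderiv_in_const_eq)

text \<open>A common home for both kinds of windows: the decay of all derivatives at one Gaussian rate \<open>e\<close>
  outweighs the exponential growth of \<open>exp (- 2 \<pi> v \<bullet> w)\<close>. For \<open>e = 0\<close> derivatives are merely bounded.\<close>

definition gauss_smooth :: "real \<Rightarrow> ('a::euclidean_space \<Rightarrow> complex) set" where
  "gauss_smooth e = {f. smooth f \<and>
     (\<forall>bs\<in>lists Basis. \<exists>C\<ge>0. \<forall>x. norm (partial_derivs bs f x) \<le> C * exp (- e * (norm x)\<^sup>2))}"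

lemma gauss_smoothD:
  assumes "f \<in> gauss_smooth e" "bs \<in> lists Basis"
  shows "partial_derivs bs f differentiable at x"
    "\<exists>C\<ge>0. \<forall>x. norm (partial_derivs bs f x) \<le> C * exp (- e * (norm x)\<^sup>2)"
  using assms by (auto simp: gauss_smooth_def smooth_def)

lemma gauss_smooth_coinduct:
  assumes "f \<in> S" "\<And>f b. f \<in> S \<Longrightarrow> b \<in> Basis \<Longrightarrow> pderiv_in b f \<in> S"
    "\<And>f x. f \<in> S \<Longrightarrow> f differentiable at x"
    "\<And>f. f \<in> S \<Longrightarrow> \<exists>C\<ge>0. \<forall>x. norm (f x) \<le> C * exp (- e * (norm x)\<^sup>2)"
  shows "f \<in> gauss_smooth e"
  using partial_derivs_coinduct[OF assms(1,2)] assms(3,4)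
  unfolding gauss_smooth_def smooth_def by blast

lemma gauss_smooth_pderiv: "f \<in> gauss_smooth e \<Longrightarrow> b \<in> Basis \<Longrightarrow> pderiv_in b f \<in> gauss_smooth e"
  by (force simp: gauss_smooth_def smooth_def simp flip: partial_derivs_snoc)

lemma gauss_smooth_differentiable: "f \<in> gauss_smooth e \<Longrightarrow> f differentiable at x"
  using gauss_smoothD(1)[of f e "[]"] by auto

lemma gauss_smooth_continuous: "f \<in> gauss_smooth e \<Longrightarrow> continuous_on UNIV f"
  using gauss_smooth_differentiable differentiable_imp_continuous_within
  by (metis continuous_at_imp_continuous_on)

lemma gauss_smooth_measurable: "f \<in> gauss_smooth e \<Longrightarrow> f \<in> borel_measurable borel"
  by (intro borel_measurable_continuous_onI gauss_smooth_continuous)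

lemma gauss_smooth_bound:
  assumes "f \<in> gauss_smooth e"
  obtains C where "0 \<le> C" "\<And>x. norm (f x) \<le> C * exp (- e * (norm x)\<^sup>2)"
  using gauss_smoothD(2)[of f e "[]"] assms by auto

lemma gauss_smooth_isCont: "f \<in> gauss_smooth e \<Longrightarrow> isCont f x"
  using gauss_smooth_continuous[of f e] by (auto simp: continuous_on_eq_continuous_at)

lemma gauss_smooth_bounded:
  assumes f: "f \<in> gauss_smooth e" and e: "0 < e"
  shows "\<exists>M\<ge>0. \<forall>x. norm (f x) \<le> M"
proof -
  obtain M where M: "0 \<le> M" "\<And>x. norm (f x) \<le> M * exp (- e * (norm x)\<^sup>2)"
    using gauss_smooth_bound[OF f] by blast
  have "norm (f x) \<le> M" for x
  proof -
    have "M * exp (- e * (norm x)\<^sup>2) \<le> M * 1" using M(1) e by (intro mult_left_mono) auto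
    then show ?thesis using M(2)[of x] by simp
  qed
  with M(1) show ?thesis by blast
qed

lemma pow_le_exp_square:
  assumes "0 < (d::real)" shows "\<exists>C\<ge>0. \<forall>s\<ge>0. (1 + s) ^ n \<le> C * exp (d * s\<^sup>2)"
proof (intro exI conjI allI impI)
  fix s :: real assume s: "0 \<le> s"
  have "(1 + s) ^ n \<le> exp s ^ n" using s by (intro power_mono) auto
  also have "\<dots> = exp (real n * s)" by (simp add: exp_of_nat_mult)
  also have "real n * s \<le> (real n)\<^sup>2 / (4 * d) + d * s\<^sup>2"
  proof -
    have "0 \<le> (2 * d * s - n)\<^sup>2 / (4 * d)" using assms by simp
    also have "\<dots> = (real n)\<^sup>2 / (4 * d) + d * s\<^sup>2 - n * s"
      using assms by (simp add: field_simps power2_eq_square)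
    finally show ?thesis by simp
  qed
  finally show "(1 + s) ^ n \<le> exp ((real n)\<^sup>2 / (4 * d)) * exp (d * s\<^sup>2)" by (simp add: exp_add)
qed simp

lemma gauss_smooth_schwartz:
  assumes f: "f \<in> gauss_smooth e" and e: "0 < e" shows "f \<in> schwartz"
  unfolding schwartz_def
proof (intro CollectI conjI allI ballI)
  show "smooth f" using f by (simp add: gauss_smooth_def)
  fix k and bs :: "'a list" assume "bs \<in> lists Basis"
  then obtain C where C: "0 \<le> C" "\<And>x. norm (partial_derivs bs f x) \<le> C * exp (- e * (norm x)\<^sup>2)"
    using f unfolding gauss_smooth_def by blast
  obtain D where D: "0 \<le> D" "\<And>s. 0 \<le> s \<Longrightarrow> (1 + s) ^ k \<le> D * exp (e * s\<^sup>2)"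
    using pow_le_exp_square[OF e, of k] by blast
  have "norm x ^ k * norm (partial_derivs bs f x) \<le> D * C" for x
  proof -
    have "norm x ^ k \<le> (1 + norm x) ^ k" by (intro power_mono) auto
    also have "\<dots> \<le> D * exp (e * (norm x)\<^sup>2)" by (intro D) auto
    finally have "norm x ^ k * norm (partial_derivs bs f x)
      \<le> (D * exp (e * (norm x)\<^sup>2)) * (C * exp (- e * (norm x)\<^sup>2))"
      using C D by (intro mult_mono) auto
    also have "\<dots> = D * C" by (simp add: exp_minus field_simps)
    finally show ?thesis .
  qed
  then show "bounded (range (\<lambda>x. norm x ^ k * norm (partial_derivs bs f x)))"
    by (intro boundedI[of _ "D * C"]) auto
qed

lemma test_functions_gauss_smooth:
  assumes f: "f \<in> test_functions" shows "f \<in> gauss_smooth 1"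
proof -
  let ?K = "closure {x. f x \<noteq> 0}"
  have K: "compact ?K" and sm: "smooth f" using f by (auto simp: test_functions_def)
  have z: "partial_derivs bs f x = 0" if "x \<notin> ?K" for bs x
    using that
  proof (induction bs arbitrary: x)
    case Nil
    have "x \<notin> {x. f x \<noteq> 0}" by (rule contra_subsetD[OF closure_subset Nil])
    then show ?case by simp
  next
    case (Cons b bs)
    have "(partial_derivs bs f has_derivative (\<lambda>_. 0)) (at x)"
      by (rule has_derivative_transform_within_open[of "\<lambda>_. 0" _ _ _ "- ?K"])
        (use Cons in auto)
    then show ?case by (simp add: pderiv_in_eqI)
  qed
  have "\<exists>C\<ge>0. \<forall>x. norm (partial_derivs bs f x) \<le> C * exp (- 1 * (norm x)\<^sup>2)" if bs: "bs \<in> lists Basis" for bs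
  proof -
    have "continuous_on ?K (\<lambda>x. norm (partial_derivs bs f x) * exp ((norm x)\<^sup>2))"
      using sm bs unfolding smooth_def
      by (intro continuous_intros differentiable_imp_continuous_on)
        (auto simp: differentiable_on_def intro: differentiable_at_withinI)
    then have "bounded ((\<lambda>x. norm (partial_derivs bs f x) * exp ((norm x)\<^sup>2)) ` ?K)"
      using K by (intro compact_imp_bounded compact_continuous_image)
    then obtain C where C: "0 < C" "\<And>x. x \<in> ?K \<Longrightarrow> norm (partial_derivs bs f x) * exp ((norm x)\<^sup>2) \<le> C"
      unfolding bounded_pos by auto
    have "norm (partial_derivs bs f x) \<le> C * exp (- 1 * (norm x)\<^sup>2)" for x
      using C(2)[of x] C(1) z[of x] by (cases "x \<in> ?K") (auto simp: exp_minus field_simps)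
    with C(1) show ?thesis by (intro exI[of _ C]) auto
  qed
  with sm show ?thesis by (auto simp: gauss_smooth_def)
qed

text \<open>The factors \<open>exp (- \<pi> z |w|\<^sup>2 - 2 \<pi> v \<bullet> w)\<close> arise when a translated window is multiplied by a
  Gaussian with complex parameter \<open>z\<close>.\<close>

definition gauss_factor :: "complex \<times> 'a::euclidean_space \<Rightarrow> 'a \<Rightarrow> complex" where
  "gauss_factor p w = exp (- of_real pi * fst p * of_real ((norm w)\<^sup>2) - of_real (2 * pi * (snd p \<bullet> w)))"

text \<open>Families of functions, indexed by the parameter \<open>p = (z, v)\<close> of the Gaussian factor, which
  multiplied by that factor are closed under differentiation: the coefficients are polynomials in
  \<open>z\<close>, \<open>v\<close>, \<open>w\<close> times derivatives of the fixed function \<open>g\<close>.\<close>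

inductive_set poly_families :: "('a::euclidean_space \<Rightarrow> complex) \<Rightarrow> (complex \<times> 'a \<Rightarrow> 'a \<Rightarrow> complex) set"
  for g where
  base: "bs \<in> lists Basis \<Longrightarrow> (\<lambda>p. partial_derivs bs g) \<in> poly_families g"
| const: "\<Phi> \<in> poly_families g \<Longrightarrow> (\<lambda>p w. c * \<Phi> p w) \<in> poly_families g"
| mult_z: "\<Phi> \<in> poly_families g \<Longrightarrow> (\<lambda>p w. fst p * \<Phi> p w) \<in> poly_families g"
| mult_v: "\<Phi> \<in> poly_families g \<Longrightarrow> b \<in> Basis \<Longrightarrow> (\<lambda>p w. of_real (snd p \<bullet> b) * \<Phi> p w) \<in> poly_families g"
| mult_w: "\<Phi> \<in> poly_families g \<Longrightarrow> b \<in> Basis \<Longrightarrow> (\<lambda>p w. of_real (w \<bullet> b) * \<Phi> p w) \<in> poly_families g"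
| add: "\<Phi> \<in> poly_families g \<Longrightarrow> \<Psi> \<in> poly_families g \<Longrightarrow> (\<lambda>p w. \<Phi> p w + \<Psi> p w) \<in> poly_families g"

lemma differentiable_of_real_inner:
  "(\<lambda>w::'a::euclidean_space. of_real (w \<bullet> b) :: complex) differentiable at x"
  unfolding differentiable_def by (rule exI) (auto intro!: derivative_eq_intros)

lemma pderiv_in_of_real_inner:
  "pderiv_in b' (\<lambda>w::'a::euclidean_space. of_real (w \<bullet> b) :: complex) x = of_real (b' \<bullet> b)"
  by (rule pderiv_in_eqI) (auto intro!: derivative_eq_intros)

lemma poly_families_deriv:
  assumes g: "g \<in> gauss_smooth e" and "\<Phi> \<in> poly_families g"
  shows "(\<forall>p x. \<Phi> p differentiable at x) \<and>
    (\<forall>b\<in>Basis. \<exists>\<Phi>'\<in>poly_families g. \<forall>p x. pderiv_in b (\<Phi> p) x = \<Phi>' p x)"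
    (is "?P \<Phi>")
proof -
  have scalar: "?P (\<lambda>p w. s p * \<Phi> p w)"
    if "?P \<Phi>" "\<And>\<Phi>. \<Phi> \<in> poly_families g \<Longrightarrow> (\<lambda>p w. s p * \<Phi> p w) \<in> poly_families g"
    for \<Phi> :: "complex \<times> 'a \<Rightarrow> 'a \<Rightarrow> complex" and s
  proof (intro conjI ballI allI)
    show "(\<lambda>w. s p * \<Phi> p w) differentiable at x" for p x
      using that(1) by (intro differentiable_mult differentiable_const) blast
    fix b :: 'a assume b: "b \<in> Basis"
    from that(1)[THEN conjunct2, rule_format, OF b] obtain \<Phi>'
      where "\<Phi>' \<in> poly_families g" "\<forall>p x. pderiv_in b (\<Phi> p) x = \<Phi>' p x" by (rule bexE)
    then show "\<exists>\<Phi>'\<in>poly_families g. \<forall>p x. pderiv_in b (\<lambda>w. s p * \<Phi> p w) x = \<Phi>' p x"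
      using that by (intro bexI[of _ "\<lambda>p w. s p * \<Phi>' p w"]) (auto simp: pderiv_in_cmult)
  qed
  show "?P \<Phi>" using assms(2)
  proof induction
  case (base bs)
  then show ?case
  proof (intro conjI ballI allI)
    fix b :: 'a assume b: "b \<in> Basis"
    then have "b # bs \<in> lists Basis" using base by auto
    from poly_families.base[OF this]
    show "\<exists>\<Phi>'\<in>poly_families g. \<forall>p x. pderiv_in b (partial_derivs bs g) x = \<Phi>' p x"
      by (intro bexI) auto
  qed (use gauss_smoothD(1)[OF g] base in auto)
next
  case (const \<Phi> c)
  then show ?case by (intro scalar[of \<Phi> "\<lambda>_. c"]) (auto intro: poly_families.intros)
next
  case (mult_z \<Phi>)
  then show ?case by (intro scalar[of \<Phi> fst]) (auto intro: poly_families.intros)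
next
  case (mult_v \<Phi> b)
  then show ?case by (intro scalar[of \<Phi> "\<lambda>p. of_real (snd p \<bullet> b)"]) (auto intro: poly_families.intros)
next
  case (mult_w \<Phi> b)
  show ?case
  proof (intro conjI ballI allI)
    show "(\<lambda>w. of_real (w \<bullet> b) * \<Phi> p w) differentiable at x" for p x
      using mult_w.IH[THEN conjunct1] by (intro differentiable_mult differentiable_of_real_inner) blast
    fix b' :: 'a assume b': "b' \<in> Basis"
    from mult_w.IH[THEN conjunct2, rule_format, OF this] obtain \<Phi>'
      where \<Phi>': "\<Phi>' \<in> poly_families g" "\<forall>p x. pderiv_in b' (\<Phi> p) x = \<Phi>' p x" by (rule bexE)
    show "\<exists>\<Phi>'\<in>poly_families g. \<forall>p x. pderiv_in b' (\<lambda>w. of_real (w \<bullet> b) * \<Phi> p w) x = \<Phi>' p x"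
      by (rule bexI[of _ "\<lambda>p w. of_real (w \<bullet> b) * \<Phi>' p w + of_real (b' \<bullet> b) * \<Phi> p w"])
        (use mult_w.hyps mult_w.IH[THEN conjunct1, rule_format] \<Phi>' in \<open>auto simp: pderiv_in_mult differentiable_of_real_inner pderiv_in_of_real_inner
          intro!: poly_families.intros\<close>)
  qed
next
  case (add \<Phi> \<Psi>)
  show ?case
  proof (intro conjI ballI allI)
    show "(\<lambda>w. \<Phi> p w + \<Psi> p w) differentiable at x" for p x
      using add.IH[THEN conjunct1] by (intro differentiable_add) blast+
    fix b :: 'a assume b: "b \<in> Basis"
    from add.IH(1)[THEN conjunct2, rule_format, OF b] obtain \<Phi>'
      where \<Phi>': "\<Phi>' \<in> poly_families g" "\<forall>p x. pderiv_in b (\<Phi> p) x = \<Phi>' p x" by (rule bexE)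
    from add.IH(2)[THEN conjunct2, rule_format, OF b] obtain \<Psi>'
      where \<Psi>': "\<Psi>' \<in> poly_families g" "\<forall>p x. pderiv_in b (\<Psi> p) x = \<Psi>' p x" by (rule bexE)
    show "\<exists>\<Phi>'\<in>poly_families g. \<forall>p x. pderiv_in b (\<lambda>w. \<Phi> p w + \<Psi> p w) x = \<Phi>' p x"
      using add.IH[THEN conjunct1, rule_format] \<Phi>' \<Psi>' by (intro bexI[of _ "\<lambda>p w. \<Phi>' p w + \<Psi>' p w"]) (auto simp: pderiv_in_add intro!: poly_families.intros)
  qed
qed
qed

lemma poly_families_bound:
  assumes g: "g \<in> gauss_smooth e" and "\<Phi> \<in> poly_families g"
  shows "\<exists>C\<ge>0. \<exists>n. \<forall>p w. norm (\<Phi> p w)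
    \<le> C * (1 + norm (fst p)) ^ n * (1 + norm (snd p)) ^ n * (1 + norm w) ^ n * exp (- e * (norm w)\<^sup>2)"
    (is "?P \<Phi>")
proof -
  define B where "B = (\<lambda>(p::complex \<times> 'a) (w::'a). (1 + norm (fst p)) * (1 + norm (snd p)) * (1 + norm w))"
  have B1: "1 \<le> B p w" for p w
    unfolding B_def using mult_mono[of 1 "(1 + norm (fst p)) * (1 + norm (snd p))" 1 "1 + norm w"]
      mult_mono[of 1 "1 + norm (fst p)" 1 "1 + norm (snd p)"] by simp
  have facs: "norm (fst p) \<le> B p w" "norm (snd p) \<le> B p w" "norm w \<le> B p w" for p w
  proof -
    have "(1 + norm (fst p)) * 1 * 1 \<le> B p w" unfolding B_def by (intro mult_mono) auto
    then show "norm (fst p) \<le> B p w" by simp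
    have "1 * (1 + norm (snd p)) * 1 \<le> B p w" unfolding B_def by (intro mult_mono) auto
    then show "norm (snd p) \<le> B p w" by simp
    have "1 * 1 * (1 + norm w) \<le> B p w" unfolding B_def by (intro mult_mono) auto
    then show "norm w \<le> B p w" by simp
  qed
  have in_B: "\<bar>v \<bullet> b\<bar> \<le> norm v" if "b \<in> Basis" for v b :: 'a
    using Basis_le_norm[OF that] .
  have step: "\<exists>C\<ge>0. \<exists>n. \<forall>p w. norm (s p w * \<Phi> p w) \<le> C * B p w ^ n * exp (- e * (norm w)\<^sup>2)"
    if "\<exists>C\<ge>0. \<exists>n. \<forall>p w. norm (\<Phi> p w) \<le> C * B p w ^ n * exp (- e * (norm w)\<^sup>2)" "\<And>p w. norm (s p w) \<le> B p w"
    for s \<Phi> :: "complex \<times> 'a \<Rightarrow> 'a \<Rightarrow> complex"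
  proof -
    from that(1) obtain C n where C0: "0 \<le> C" and "\<forall>p w. norm (\<Phi> p w) \<le> C * B p w ^ n * exp (- e * (norm w)\<^sup>2)"
      by (elim exE conjE) (rule that)
    note C = C0 this(2)[rule_format]
    have "norm (s p w * \<Phi> p w) \<le> C * B p w ^ Suc n * exp (- e * (norm w)\<^sup>2)" for p w
    proof -
      have "norm (s p w * \<Phi> p w) \<le> B p w * (C * B p w ^ n * exp (- e * (norm w)\<^sup>2))"
        unfolding norm_mult using that(2)[of p w] C(2)[of p w] B1[of p w] by (intro mult_mono) auto
      also have "\<dots> = C * B p w ^ Suc n * exp (- e * (norm w)\<^sup>2)" by (simp only: power_Suc mult_ac)
      finally show ?thesis .
    qed
    with C(1) show ?thesis by (intro exI[of _ C] conjI exI[of _ "Suc n"]) auto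
  qed
  have "\<exists>C\<ge>0. \<exists>n. \<forall>p w. norm (\<Phi> p w) \<le> C * B p w ^ n * exp (- e * (norm w)\<^sup>2)"
    using assms(2)
  proof induction
    case (base bs)
    from gauss_smoothD(2)[OF g base] obtain C where
      "0 \<le> C" "\<And>x. norm (partial_derivs bs g x) \<le> C * exp (- e * (norm x)\<^sup>2)" by blast
    then show ?case by (intro exI[of _ C] conjI exI[of _ 0]) auto
  next
    case (const \<Phi> c)
    from const.IH obtain C n where C0: "0 \<le> C" and "\<forall>p w. norm (\<Phi> p w) \<le> C * B p w ^ n * exp (- e * (norm w)\<^sup>2)"
      by (elim exE conjE) (rule that)
    note C = C0 this(2)[rule_format]
    have "norm (c * \<Phi> p w) \<le> (norm c * C) * B p w ^ n * exp (- e * (norm w)\<^sup>2)" for p w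
      using mult_left_mono[OF C(2)[of p w], of "norm c"] unfolding norm_mult by (simp only: mult_ac norm_ge_zero)
    with C(1) show ?case by (intro exI[of _ "norm c * C"]) auto
  next
    case (mult_z \<Phi>)
    then show ?case by (intro step) (auto simp: facs)
  next
    case (mult_v \<Phi> b)
    then show ?case
      by (intro step) (auto intro: order_trans[OF in_B facs(2)])
  next
    case (mult_w \<Phi> b)
    then show ?case
      by (intro step) (auto intro: order_trans[OF in_B facs(3)])
  next
    case (add \<Phi> \<Psi>)
    from add.IH(1) obtain C n where C0: "0 \<le> C" and "\<forall>p w. norm (\<Phi> p w) \<le> C * B p w ^ n * exp (- e * (norm w)\<^sup>2)"
      by (elim exE conjE) (rule that)
    note C = C0 this(2)[rule_format]
    from add.IH(2) obtain D m where D0: "0 \<le> D" and "\<forall>p w. norm (\<Psi> p w) \<le> D * B p w ^ m * exp (- e * (norm w)\<^sup>2)"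
      by (elim exE conjE) (rule that)
    note D = D0 this(2)[rule_format]
    have "norm (\<Phi> p w + \<Psi> p w) \<le> (C + D) * B p w ^ (n + m) * exp (- e * (norm w)\<^sup>2)" for p w
    proof -
      have "C * B p w ^ n * exp (- e * (norm w)\<^sup>2) \<le> C * B p w ^ (n + m) * exp (- e * (norm w)\<^sup>2)"
        "D * B p w ^ m * exp (- e * (norm w)\<^sup>2) \<le> D * B p w ^ (n + m) * exp (- e * (norm w)\<^sup>2)"
        using C D B1[of p w] by (intro mult_right_mono mult_left_mono power_increasing; simp)+
      with C(2)[of p w] D(2)[of p w] norm_triangle_ineq[of "\<Phi> p w" "\<Psi> p w"] show ?thesis
        by (simp add: algebra_simps)
    qed
    with C D show ?case by (intro exI[of _ "C + D"]) auto
  qed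
  then show ?thesis by (simp add: B_def power_mult_distrib mult_ac)
qed

lemma gauss_factor_deriv:
  "(gauss_factor p has_derivative (\<lambda>h. (- of_real (2 * pi) * fst p * of_real (x \<bullet> h) - of_real (2 * pi * (snd p \<bullet> h)))
     * gauss_factor p x)) (at x)"
proof -
  have n: "((\<lambda>w. complex_of_real ((norm w)\<^sup>2)) has_derivative (\<lambda>h. of_real (2 * (x \<bullet> h)))) (at x)"
    unfolding power2_norm_eq_inner
    by (auto intro!: derivative_eq_intros simp: inner_commute)
  let ?E = "\<lambda>w. - of_real pi * fst p * of_real ((norm w)\<^sup>2) - of_real (2 * pi * (snd p \<bullet> w))"
  have "((\<lambda>w. complex_of_real (2 * pi * (snd p \<bullet> w))) has_derivative (\<lambda>h. of_real (2 * pi * (snd p \<bullet> h)))) (at x)"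
    by (auto intro!: derivative_eq_intros)
  from has_derivative_diff[OF has_derivative_mult_right[OF n, of "- of_real pi * fst p"] this]
  have E: "(?E has_derivative (\<lambda>h. - of_real pi * fst p * of_real (2 * (x \<bullet> h)) - of_real (2 * pi * (snd p \<bullet> h)))) (at x)" .
  have "(exp has_derivative (*) (exp (?E x))) (at (?E x))"
    using DERIV_exp[of "?E x"] by (simp add: has_field_derivative_def)
  from has_derivative_compose[OF E this] show ?thesis
    unfolding gauss_factor_def by (simp add: algebra_simps)
qed

lemma gauss_factor_differentiable: "gauss_factor p differentiable at x"
  using gauss_factor_deriv differentiable_def by blast

lemma norm_gauss_factor: "norm (gauss_factor p w) = exp (- pi * Re (fst p) * (norm w)\<^sup>2 - 2 * pi * (snd p \<bullet> w))"
  by (simp add: gauss_factor_def norm_exp_eq_Re)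

lemma poly_families_gauss_factor_deriv:
  assumes g: "g \<in> gauss_smooth e" and \<Phi>: "\<Phi> \<in> poly_families g" and b: "b \<in> Basis"
  shows "\<exists>\<Phi>'\<in>poly_families g. \<forall>p. pderiv_in b (\<lambda>w. \<Phi> p w * gauss_factor p w) = (\<lambda>w. \<Phi>' p w * gauss_factor p w)"
proof -
  obtain \<Phi>' where \<Phi>': "\<Phi>' \<in> poly_families g" "\<And>p x. pderiv_in b (\<Phi> p) x = \<Phi>' p x"
    and d: "\<And>p x. \<Phi> p differentiable at x"
    using poly_families_deriv[OF g \<Phi>] b by blast
  let ?c = "- of_real (2 * pi) :: complex"
  let ?T = "\<lambda>p w. \<Phi>' p w + (?c * (fst p * (of_real (w \<bullet> b) * \<Phi> p w)) + ?c * (of_real (snd p \<bullet> b) * \<Phi> p w))"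
  have "?T \<in> poly_families g"
    using \<Phi> \<Phi>' b by (intro poly_families.intros)
  moreover have "pderiv_in b (\<lambda>w. \<Phi> p w * gauss_factor p w) x = ?T p x * gauss_factor p x" for p x
  proof -
    show ?thesis
      by (simp add: pderiv_in_mult d \<Phi>' gauss_factor_differentiable pderiv_in_eqI[OF gauss_factor_deriv] algebra_simps)
  qed
  ultimately show ?thesis by (intro bexI[of _ ?T]) auto
qed

lemma norm_gauss_factor_le:
  assumes e: "0 < e" and z: "0 \<le> Re (fst p)"
  shows "norm (gauss_factor p w) \<le> exp (4 * pi\<^sup>2 / e * (norm (snd p))\<^sup>2) * exp (e / 4 * (norm w)\<^sup>2)"
proof -
  have "- (2 * pi * (snd p \<bullet> w)) \<le> 2 * pi * (norm (snd p) * norm w)"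
  proof -
    have "- (snd p \<bullet> w) \<le> norm (snd p) * norm w"
      using norm_cauchy_schwarz[of "- snd p" w] by simp
    then have "2 * pi * - (snd p \<bullet> w) \<le> 2 * pi * (norm (snd p) * norm w)"
      by (rule mult_left_mono) simp
    then show ?thesis by (simp only: mult_minus_right)
  qed
  also have "\<dots> \<le> 4 * pi\<^sup>2 / e * (norm (snd p))\<^sup>2 + e / 4 * (norm w)\<^sup>2"
  proof -
    have "0 \<le> (4 * pi * norm (snd p) - e * norm w)\<^sup>2 / (4 * e)" using e by simp
    also have "\<dots> = 4 * pi\<^sup>2 / e * (norm (snd p))\<^sup>2 + e / 4 * (norm w)\<^sup>2 - 2 * pi * (norm (snd p) * norm w)"
      using e by (simp add: field_simps power2_eq_square)
    finally show ?thesis by simp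
  qed
  finally have "- pi * Re (fst p) * (norm w)\<^sup>2 - 2 * pi * (snd p \<bullet> w)
      \<le> 4 * pi\<^sup>2 / e * (norm (snd p))\<^sup>2 + e / 4 * (norm w)\<^sup>2"
    using mult_nonneg_nonneg[OF mult_nonneg_nonneg[OF pi_ge_zero z] zero_le_power2[of "norm w"]] by simp
  then show ?thesis by (simp add: norm_gauss_factor exp_add[symmetric])
qed

text \<open>The rate of growth in \<open>v\<close> is the same for all members of the class; this is what makes
  the bounds survive repeated integration by parts.\<close>

lemma poly_families_gauss_factor_bound:
  assumes e: "0 < e" and g: "g \<in> gauss_smooth e" and \<Phi>: "\<Phi> \<in> poly_families g"
  shows "\<exists>C\<ge>0. \<forall>z v w. 0 \<le> Re z \<longrightarrow> norm z \<le> 1 \<longrightarrow> norm (\<Phi> (z, v) w * gauss_factor (z, v) w)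
    \<le> C * exp ((4 * pi\<^sup>2 / e + 1) * (norm v)\<^sup>2) * exp (- (e / 2) * (norm w)\<^sup>2)"
proof -
  obtain C n where C: "0 \<le> C" "\<And>p w. norm (\<Phi> p w)
    \<le> C * (1 + norm (fst p)) ^ n * (1 + norm (snd p)) ^ n * (1 + norm w) ^ n * exp (- e * (norm w)\<^sup>2)"
    using poly_families_bound[OF g \<Phi>] by blast
  obtain D1 :: real where D1: "0 \<le> D1" "\<And>s. 0 \<le> s \<Longrightarrow> (1 + s) ^ n \<le> D1 * exp (1 * s\<^sup>2)"
    using pow_le_exp_square[OF zero_less_one, of n] by blast
  have e4: "0 < e / 4" using e by simp
  obtain D2 where D2: "0 \<le> D2" "\<And>s. 0 \<le> s \<Longrightarrow> (1 + s) ^ n \<le> D2 * exp (e / 4 * s\<^sup>2)"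
    using pow_le_exp_square[OF e4, of n] by blast
  show ?thesis
  proof (intro exI[of _ "C * 2 ^ n * D1 * D2"] conjI allI impI)
    show "0 \<le> C * 2 ^ n * D1 * D2" using C D1 D2 by simp
    fix z :: complex and v w :: 'a assume z: "0 \<le> Re z" "norm z \<le> 1"
    have "norm (\<Phi> (z, v) w) \<le> C * (1 + norm z) ^ n * (1 + norm v) ^ n * (1 + norm w) ^ n * exp (- e * (norm w)\<^sup>2)"
      using C(2)[of "(z, v)" w] by simp
    also have "\<dots> \<le> C * 2 ^ n * (D1 * exp (1 * (norm v)\<^sup>2)) * (D2 * exp (e / 4 * (norm w)\<^sup>2)) * exp (- e * (norm w)\<^sup>2)"
      using z C D1 D2 by (intro mult_mono power_mono) auto
    finally have "norm (\<Phi> (z, v) w * gauss_factor (z, v) w) \<le>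
      (C * 2 ^ n * (D1 * exp (1 * (norm v)\<^sup>2)) * (D2 * exp (e / 4 * (norm w)\<^sup>2)) * exp (- e * (norm w)\<^sup>2))
      * (exp (4 * pi\<^sup>2 / e * (norm v)\<^sup>2) * exp (e / 4 * (norm w)\<^sup>2))"
      unfolding norm_mult using norm_gauss_factor_le[OF e, of "(z, v)" w] z C D1 D2
      by (intro mult_mono) auto
    also have "\<dots> = C * 2 ^ n * D1 * D2 * (exp (1 * (norm v)\<^sup>2) * exp (4 * pi\<^sup>2 / e * (norm v)\<^sup>2))
       * (exp (e / 4 * (norm w)\<^sup>2) * exp (- e * (norm w)\<^sup>2) * exp (e / 4 * (norm w)\<^sup>2))"
      by (simp only: mult_ac)
    also have "\<dots> = C * 2 ^ n * D1 * D2 * exp ((4 * pi\<^sup>2 / e + 1) * (norm v)\<^sup>2) * exp (- (e / 2) * (norm w)\<^sup>2)"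
      by (simp add: exp_add[symmetric] algebra_simps)
    finally show "norm (\<Phi> (z, v) w * gauss_factor (z, v) w)
      \<le> C * 2 ^ n * D1 * D2 * exp ((4 * pi\<^sup>2 / e + 1) * (norm v)\<^sup>2) * exp (- (e / 2) * (norm w)\<^sup>2)" .
  qed
qed

lemma poly_families_gauss_smooth:
  assumes e: "0 < e" and g: "g \<in> gauss_smooth e" and \<Phi>: "\<Phi> \<in> poly_families g"
    and z: "0 \<le> Re z" "norm z \<le> 1"
  shows "(\<lambda>w. \<Phi> (z, v) w * gauss_factor (z, v) w) \<in> gauss_smooth (e / 2)"
proof (rule gauss_smooth_coinduct[where S = "{\<lambda>w. \<Phi> (z, v) w * gauss_factor (z, v) w |\<Phi>. \<Phi> \<in> poly_families g}"])
  show "\<exists>C\<ge>0. \<forall>x. norm (f x) \<le> C * exp (- (e / 2) * (norm x)\<^sup>2)"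
    if "f \<in> {\<lambda>w. \<Phi> (z, v) w * gauss_factor (z, v) w |\<Phi>. \<Phi> \<in> poly_families g}" for f
  proof -
    from that obtain \<Phi> where f: "f = (\<lambda>w. \<Phi> (z, v) w * gauss_factor (z, v) w)" "\<Phi> \<in> poly_families g" by blast
    from poly_families_gauss_factor_bound[OF e g f(2)] obtain C where C: "0 \<le> C"
      "\<forall>z v w. 0 \<le> Re z \<longrightarrow> norm z \<le> 1 \<longrightarrow> norm (\<Phi> (z, v) w * gauss_factor (z, v) w)
        \<le> C * exp ((4 * pi\<^sup>2 / e + 1) * (norm v)\<^sup>2) * exp (- (e / 2) * (norm w)\<^sup>2)"
      by (elim exE conjE) (rule that)
    show ?thesis
      unfolding f(1) using C(1) C(2)[rule_format, OF z]
      by (intro exI[of _ "C * exp ((4 * pi\<^sup>2 / e + 1) * (norm v)\<^sup>2)"] conjI allI) simp_all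
  qed
  show "f differentiable at x"
    if "f \<in> {\<lambda>w. \<Phi> (z, v) w * gauss_factor (z, v) w |\<Phi>. \<Phi> \<in> poly_families g}" for f x
    using that poly_families_deriv[OF g] gauss_factor_differentiable by (auto intro!: differentiable_mult)
  show "pderiv_in b f \<in> {\<lambda>w. \<Phi> (z, v) w * gauss_factor (z, v) w |\<Phi>. \<Phi> \<in> poly_families g}"
    if f: "f \<in> {\<lambda>w. \<Phi> (z, v) w * gauss_factor (z, v) w |\<Phi>. \<Phi> \<in> poly_families g}" and b: "b \<in> Basis" for f b
  proof -
    from f obtain \<Phi> where f: "f = (\<lambda>w. \<Phi> (z, v) w * gauss_factor (z, v) w)" and \<Phi>: "\<Phi> \<in> poly_families g" by blast
    from poly_families_gauss_factor_deriv[OF g \<Phi> b] show ?thesis unfolding f by blast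
  qed
qed (use \<Phi> in blast)

text \<open>The derivatives of a Gaussian are polynomials times the Gaussian, that is, members of the families over the
  constant function \<open>1\<close>. Half of the rate pays for the polynomial.\<close>

lemma complex_gaussian_gauss_smooth:
  assumes z: "0 < Re z"
  shows "(\<lambda>x::'a::euclidean_space. A * gauss_factor (z, 0) x) \<in> gauss_smooth (pi * Re z / 2)"
proof -
  let ?one = "\<lambda>_::'a. 1 :: complex" and ?p = "(z, 0) :: complex \<times> 'a"
  have one: "?one \<in> gauss_smooth 0"
    by (rule gauss_smooth_coinduct[where S = "range (\<lambda>c _. c)"])
      (auto simp: pderiv_in_const_eq intro: norm_ge_zero)
  have gf: "norm (gauss_factor ?p w) = exp (- (pi * Re z) * (norm w)\<^sup>2)" for w
    by (simp add: norm_gauss_factor)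
  let ?S = "{\<lambda>w. \<Phi> ?p w * gauss_factor ?p w |\<Phi>. \<Phi> \<in> poly_families ?one}"
  show ?thesis
  proof (rule gauss_smooth_coinduct[where S = ?S])
    have "(\<lambda>p w. A * partial_derivs [] ?one w) \<in> poly_families ?one"
      by (intro poly_families.intros) auto
    then show "(\<lambda>x. A * gauss_factor ?p x) \<in> ?S" by fastforce
    show "pderiv_in b f \<in> ?S" if f: "f \<in> ?S" and b: "b \<in> Basis" for f b
    proof -
      from f obtain \<Phi> where f: "f = (\<lambda>w. \<Phi> ?p w * gauss_factor ?p w)" and \<Phi>: "\<Phi> \<in> poly_families ?one" by blast
      from poly_families_gauss_factor_deriv[OF one \<Phi> b] show ?thesis unfolding f by blast
    qed
    show "f differentiable at x" if "f \<in> ?S" for f x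
      using that poly_families_deriv[OF one] gauss_factor_differentiable by (auto intro!: differentiable_mult)
    show "\<exists>C\<ge>0. \<forall>x. norm (f x) \<le> C * exp (- (pi * Re z / 2) * (norm x)\<^sup>2)" if fS: "f \<in> ?S" for f
    proof -
      from fS obtain \<Phi> where f: "f = (\<lambda>w. \<Phi> ?p w * gauss_factor ?p w)" "\<Phi> \<in> poly_families ?one" by blast
      obtain C n where C: "0 \<le> C" "\<And>w. norm (\<Phi> ?p w) \<le> C * (1 + norm (fst ?p)) ^ n * (1 + norm (snd ?p)) ^ n * (1 + norm w) ^ n * exp (- 0 * (norm w)\<^sup>2)"
        using poly_families_bound[OF one f(2)] by blast
      have a: "0 < pi * Re z / 2" using z by simp
      obtain D where D: "0 \<le> D" "\<And>s. 0 \<le> s \<Longrightarrow> (1 + s) ^ n \<le> D * exp (pi * Re z / 2 * s\<^sup>2)"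
        using pow_le_exp_square[OF a, of n] by blast
      let ?C = "C * (1 + norm (fst ?p)) ^ n"
      have "norm (f w) \<le> ?C * D * exp (- (pi * Re z / 2) * (norm w)\<^sup>2)" for w
      proof -
        have "norm (f w) = norm (\<Phi> ?p w) * exp (- (pi * Re z) * (norm w)\<^sup>2)"
          unfolding f norm_mult gf by simp
        also have "\<dots> \<le> (?C * (D * exp (pi * Re z / 2 * (norm w)\<^sup>2))) * exp (- (pi * Re z) * (norm w)\<^sup>2)"
          using C D(2)[of "norm w"] by (intro mult_right_mono order_trans[OF C(2)]) (auto intro!: mult_left_mono)
        also have "\<dots> = ?C * D * (exp (pi * Re z / 2 * (norm w)\<^sup>2) * exp (- (pi * Re z) * (norm w)\<^sup>2))" by (simp only: mult_ac)
        also have "exp (pi * Re z / 2 * (norm w)\<^sup>2) * exp (- (pi * Re z) * (norm w)\<^sup>2) = exp (- (pi * Re z / 2) * (norm w)\<^sup>2)"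
          by (simp add: exp_add[symmetric] field_simps)
        finally show ?thesis .
      qed
      with C D show ?thesis by (intro exI[of _ "?C * D"]) auto
    qed
  qed
qed

lemma gauss_factor_of_real:
  "gauss_factor (of_real a, 0) x = of_real (exp (- pi * a * (norm x)\<^sup>2))"
  by (simp add: gauss_factor_def exp_of_real[symmetric])

lemma gaussian_gauss_smooth:
  assumes a: "0 < a"
  shows "(\<lambda>x::'a::euclidean_space. A * of_real (exp (- a * (norm x)\<^sup>2))) \<in> gauss_smooth (a / 2)"
  using complex_gaussian_gauss_smooth[of "of_real (a / pi)" A] a
  unfolding gauss_factor_of_real by simp

lemma admissible_window_gauss_smooth:
  assumes "admissible_window g" obtains e where "0 < e" "g \<in> gauss_smooth e"
proof (cases "g \<in> test_functions")
  case True
  then have "g \<in> gauss_smooth 1" by (rule test_functions_gauss_smooth)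
  then show ?thesis by (intro that[of 1]) auto
next
  case False
  then obtain A a where "g = (\<lambda>x. A * of_real (exp (- a * (norm x)\<^sup>2)))" "0 < a"
    using assms unfolding admissible_window_def gaussians_def by blast
  then show ?thesis using that[of "a / 2"] gaussian_gauss_smooth[of a A] by simp
qed

section \<open>Fourier transforms and integration by parts\<close>

lemma exp_norm_square_prod:
  "exp (c * (norm (x::'a::euclidean_space))\<^sup>2) = (\<Prod>b\<in>Basis. exp (c * (x \<bullet> b)\<^sup>2))"
proof -
  have "(norm x)\<^sup>2 = (\<Sum>b\<in>Basis. (x \<bullet> b)\<^sup>2)"
    unfolding power2_norm_eq_inner by (subst euclidean_inner) (simp add: power2_eq_square)
  then show ?thesis by (simp add: sum_distrib_left exp_sum)
qed

lemma nn_integral_gaussian: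
  "(\<integral>\<^sup>+x. ennreal (exp (- pi * (norm x)\<^sup>2)) \<partial>(lborel :: 'a::euclidean_space measure)) = 1"
proof -
  have eq: "normal_density 0 (1 / sqrt (2 * pi)) x = exp (- pi * x\<^sup>2)" for x
    by (simp add: normal_density_def power_divide)
  have "integrable lborel (normal_density 0 (1 / sqrt (2 * pi)))" "integral\<^sup>L lborel (normal_density 0 (1 / sqrt (2 * pi))) = 1"
    by (intro integrable_normal_density integral_normal_density; simp)+
  then have "integrable lborel (\<lambda>x. exp (- pi * x\<^sup>2))" "(\<integral>x. exp (- pi * x\<^sup>2) \<partial>lborel) = 1"
    unfolding eq[abs_def] by auto
  then have 1: "(\<integral>\<^sup>+x. ennreal (exp (- pi * x\<^sup>2)) \<partial>lborel) = 1"
    by (subst nn_integral_eq_integral) auto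
  have "(\<integral>\<^sup>+x. (\<Prod>b\<in>Basis. ennreal (exp (- pi * (x \<bullet> b)\<^sup>2))) \<partial>(lborel :: 'a measure))
      = (\<Prod>b\<in>(Basis::'a set). \<integral>\<^sup>+x. ennreal (exp (- pi * x\<^sup>2)) \<partial>lborel)"
    by (rule nn_integral_lborel_prod) auto
  then show ?thesis unfolding 1 exp_norm_square_prod by (simp add: prod_ennreal)
qed

lemma nn_integral_gaussian_scaled:
  assumes "0 < e"
  shows "(\<integral>\<^sup>+x. ennreal (exp (- e * (norm x)\<^sup>2)) \<partial>(lborel :: 'a::euclidean_space measure))
    = ennreal (sqrt (e / pi) powr - real DIM('a))"
proof -
  let ?c = "sqrt (e / pi)"
  have c: "0 < ?c" using assms by simp
  have "(\<integral>\<^sup>+x. ennreal (exp (- pi * (norm (0 + ?c *\<^sub>R x))\<^sup>2)) \<partial>(lborel :: 'a measure))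
     = ennreal (\<bar>?c\<bar> powr - real DIM('a)) * (\<integral>\<^sup>+x. ennreal (exp (- pi * (norm x)\<^sup>2)) \<partial>(lborel :: 'a measure))"
    by (rule nn_integral_lborel_affine) (use c in auto)
  moreover have "- pi * (norm (0 + ?c *\<^sub>R x))\<^sup>2 = - e * (norm x)\<^sup>2" for x :: 'a
    using assms by (simp add: power_mult_distrib)
  ultimately show ?thesis using c unfolding nn_integral_gaussian by simp
qed

lemma gaussian_integrable:
  assumes "0 < e" shows "integrable lborel (\<lambda>x::'a::euclidean_space. exp (- e * (norm x)\<^sup>2))"
  using nn_integral_gaussian_scaled[OF assms, where 'a = 'a]
  by (intro integrableI_nn_integral_finite[where x = "sqrt (e / pi) powr - real DIM('a)"]) auto

lemma gauss_smooth_integrable: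
  assumes f: "f \<in> gauss_smooth e" and e: "0 < e" shows "integrable lborel f"
proof -
  obtain C where C: "0 \<le> C" "\<And>x. norm (f x) \<le> C * exp (- e * (norm x)\<^sup>2)"
    using gauss_smooth_bound[OF f] by blast
  show ?thesis
    by (rule Bochner_Integration.integrable_bound[of _ "\<lambda>x. C * exp (- e * (norm x)\<^sup>2)"])
      (use gaussian_integrable[OF e] gauss_smooth_measurable[OF f] C in auto)
qed

lemma lborel_integral_affine:
  fixes F :: "'a::euclidean_space \<Rightarrow> 'b::{banach, second_countable_topology}"
  assumes c: "c \<noteq> 0" and [measurable]: "F \<in> borel_measurable borel"
  shows "(\<integral>x. F x \<partial>lborel) = (\<bar>c\<bar> ^ DIM('a)) *\<^sub>R (\<integral>x. F (t + c *\<^sub>R x) \<partial>lborel)"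
  by (subst lborel_affine[OF c, of t]) (simp add: integral_density integral_distr)

text \<open>Lebesgue measure is translation invariant, so that difference quotients integrate to zero, and the Gaussian bound
  on the derivative dominates them.\<close>

lemma integral_pderiv_zero:
  fixes f :: "'a::euclidean_space \<Rightarrow> complex"
  assumes b: "b \<in> Basis" and f: "integrable lborel f" and d: "\<And>x. f differentiable at x"
    and m: "pderiv_in b f \<in> borel_measurable borel"
    and bound: "\<And>x. norm (pderiv_in b f x) \<le> C * exp (- e * (norm x)\<^sup>2)" and e: "0 < e" and C: "0 \<le> C"
  shows "(\<integral>x. pderiv_in b f x \<partial>lborel) = 0"
proof -
  \<comment> \<open>steps at most \<open>1\<close>, so that one Gaussian dominates all difference quotients\<close>
  define h where "h = (\<lambda>n. 1 / real (Suc n))"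
  have h: "0 < h n" "h n \<le> 1" for n by (auto simp: h_def)
  have h0: "h \<longlonglongrightarrow> 0" unfolding h_def by (rule LIMSEQ_Suc[OF lim_1_over_n])
  let ?D = "\<lambda>n x. (f (x + h n *\<^sub>R b) - f x) /\<^sub>R h n"
  have fd: "(f has_derivative frechet_derivative f (at x)) (at x)" for x
    using d by (simp add: frechet_derivative_works)
  have path: "((\<lambda>s. f (x + s *\<^sub>R b)) has_derivative (\<lambda>r. r *\<^sub>R pderiv_in b f (x + s *\<^sub>R b))) (at s)" for x s
  proof -
    have "((\<lambda>s. x + s *\<^sub>R b) has_derivative (\<lambda>r. r *\<^sub>R b)) (at s)"
      by (auto intro!: derivative_eq_intros)
    from has_derivative_compose[OF this fd]
    show ?thesis using linear_frechet_derivative[OF d] by (simp add: linear_scale)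
  qed
  have lim: "(\<lambda>n. ?D n x) \<longlonglongrightarrow> pderiv_in b f x" for x
  proof -
    have "((\<lambda>s. norm (f (x + (0 + s) *\<^sub>R b) - f (x + 0 *\<^sub>R b) - s *\<^sub>R pderiv_in b f (x + 0 *\<^sub>R b)) / norm s) \<longlongrightarrow> 0) (at 0)"
      using path[of x 0] unfolding has_derivative_at by blast
    then have "((\<lambda>s. norm ((f (x + s *\<^sub>R b) - f x) /\<^sub>R s - pderiv_in b f x)) \<longlongrightarrow> 0) (at 0)"
    proof (rule Lim_transform_eventually)
      show "\<forall>\<^sub>F s in at 0. norm (f (x + (0 + s) *\<^sub>R b) - f (x + 0 *\<^sub>R b) - s *\<^sub>R pderiv_in b f (x + 0 *\<^sub>R b)) / norm s
        = norm ((f (x + s *\<^sub>R b) - f x) /\<^sub>R s - pderiv_in b f x)"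
        unfolding eventually_at_filter
      proof (intro always_eventually allI impI)
        fix s :: real assume s: "s \<noteq> 0"
        then have "(f (x + s *\<^sub>R b) - f x) /\<^sub>R s - pderiv_in b f x
          = (f (x + s *\<^sub>R b) - f x - s *\<^sub>R pderiv_in b f x) /\<^sub>R s" by (simp add: scaleR_diff_right)
        then show "norm (f (x + (0 + s) *\<^sub>R b) - f (x + 0 *\<^sub>R b) - s *\<^sub>R pderiv_in b f (x + 0 *\<^sub>R b)) / norm s
        = norm ((f (x + s *\<^sub>R b) - f x) /\<^sub>R s - pderiv_in b f x)"
          by (simp add: divide_inverse mult.commute)
      qed
    qed
    then have "((\<lambda>s. (f (x + s *\<^sub>R b) - f x) /\<^sub>R s) \<longlongrightarrow> pderiv_in b f x) (at 0)"
      by (rule LIM_zero_cancel[OF tendsto_norm_zero_cancel])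
    moreover have "filterlim h (at 0) sequentially"
      using h0 h by (auto simp: filterlim_at intro!: always_eventually)
       (metis less_irrefl)
    ultimately show ?thesis by (rule filterlim_compose)
  qed
  let ?w = "\<lambda>x::'a. C * exp e * exp (- (e / 2) * (norm x)\<^sup>2)"
  have bd: "norm (?D n x) \<le> ?w x" for n x
  proof -
    have "norm (f (x + h n *\<^sub>R b) - f (x + 0 *\<^sub>R b)) \<le> ?w x * norm (h n - 0)"
    proof (rule differentiable_bound[of "{0..h n}" _ "\<lambda>s r. r *\<^sub>R pderiv_in b f (x + s *\<^sub>R b)"])
      fix s assume s: "s \<in> {0..h n}"
      show "((\<lambda>s. f (x + s *\<^sub>R b)) has_derivative (\<lambda>r. r *\<^sub>R pderiv_in b f (x + s *\<^sub>R b))) (at s within {0..h n})"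
        using path by (rule has_derivative_at_withinI)
      have "norm x \<le> norm (x + s *\<^sub>R b) + norm (s *\<^sub>R b)"
        by (metis add_diff_cancel norm_triangle_ineq4)
      also have "norm (s *\<^sub>R b) \<le> 1" using s b h(2)[of n] by auto
      finally have "(norm x)\<^sup>2 \<le> (norm (x + s *\<^sub>R b) + 1)\<^sup>2" by (intro power_mono) auto
      also have "\<dots> \<le> 2 * (norm (x + s *\<^sub>R b))\<^sup>2 + 2"
        using sum_squares_ge_zero[of "norm (x + s *\<^sub>R b) - 1" 0] by (simp add: power2_eq_square algebra_simps)
      finally have "e * (norm x)\<^sup>2 \<le> e * (2 * (norm (x + s *\<^sub>R b))\<^sup>2 + 2)" using e by (intro mult_left_mono) auto
      then have "- e * (norm (x + s *\<^sub>R b))\<^sup>2 \<le> e + - (e / 2) * (norm x)\<^sup>2" by (simp add: algebra_simps)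
      then have "C * exp (- e * (norm (x + s *\<^sub>R b))\<^sup>2) \<le> ?w x"
        using C by (simp add: mult.assoc exp_add[symmetric] mult_left_mono)
      then have "norm (pderiv_in b f (x + s *\<^sub>R b)) \<le> ?w x" using bound order_trans by blast
      then show "onorm (\<lambda>r. r *\<^sub>R pderiv_in b f (x + s *\<^sub>R b)) \<le> ?w x"
        using C by (intro onorm_le) (simp add: mult.commute mult_left_mono)
    qed (use h[of n] in auto)
    then have "norm (f (x + h n *\<^sub>R b) - f x) / h n \<le> ?w x" using h(1)[of n] by (simp add: pos_divide_le_eq)
    moreover have "norm (?D n x) = norm (f (x + h n *\<^sub>R b) - f x) / h n"
      using h(1)[of n] by (simp add: divide_inverse_commute)
    ultimately show ?thesis by (simp only:)
  qed
  have fm [measurable]: "f \<in> borel_measurable borel" using f by auto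
  have tr: "integrable lborel (\<lambda>x. f (x + h n *\<^sub>R b))" for n
  proof -
    have "integrable (distr lborel borel (\<lambda>x. h n *\<^sub>R b + x)) f" using f by (simp add: lborel_distr_plus)
    then show ?thesis by (subst (asm) integrable_distr_eq) (auto simp: add.commute)
  qed
  have "(\<integral>x. ?D n x \<partial>lborel) = 0" for n
  proof -
    have "(\<integral>x. f (x + h n *\<^sub>R b) \<partial>lborel) = (\<integral>x. f x \<partial>lborel)"
      using lborel_integral_affine[of 1 f "h n *\<^sub>R b"] by (simp add: add.commute)
    then show ?thesis using tr[of n] f by (simp add: Bochner_Integration.integral_diff)
  qed
  moreover have "(\<lambda>n. \<integral>x. ?D n x \<partial>lborel) \<longlonglongrightarrow> (\<integral>x. pderiv_in b f x \<partial>lborel)"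
  proof (rule integral_dominated_convergence[where w = ?w])
    show "integrable lborel ?w" using gaussian_integrable[of "e/2", where 'a = 'a] e by (intro integrable_mult_right) auto
  qed (use lim bd m in auto)
  ultimately have "(\<lambda>n. 0) \<longlonglongrightarrow> (\<integral>x. pderiv_in b f x \<partial>lborel)" by (simp only:)
  then show ?thesis using LIMSEQ_unique[OF tendsto_const] by metis
qed

lemma norm_cis_mult [simp]: "norm (c * cis t) = norm c" "norm (cis t * c) = norm c"
  by (simp_all add: norm_mult)

lemma cis_measurable [measurable]: "cis \<in> borel_measurable borel"
  by (intro borel_measurable_continuous_onI continuous_on_cis continuous_on_id)

lemma integrable_mult_cis:
  assumes "integrable lborel f" "c \<in> borel_measurable borel"
  shows "integrable lborel (\<lambda>x. f x * cis (c x))"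
  by (rule Bochner_Integration.integrable_bound[OF assms(1)]) (use assms in auto)

lemma character_deriv:
  "((\<lambda>x. cis (- 2 * pi * (x \<bullet> \<xi>))) has_derivative (\<lambda>h. - 2 * pi * \<i> * of_real (h \<bullet> \<xi>) * cis (- 2 * pi * (x \<bullet> \<xi>)))) (at x)"
proof -
  have "((\<lambda>x. \<i> * complex_of_real (- 2 * pi * (x \<bullet> \<xi>))) has_derivative (\<lambda>h. \<i> * of_real (- 2 * pi * (h \<bullet> \<xi>)))) (at x)"
    by (auto intro!: derivative_eq_intros)
  moreover have "(exp has_derivative (*) (exp (\<i> * complex_of_real (- 2 * pi * (x \<bullet> \<xi>))))) (at (\<i> * complex_of_real (- 2 * pi * (x \<bullet> \<xi>))))"
    using DERIV_exp by (simp add: has_field_derivative_def)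
  ultimately have "((\<lambda>x. exp (\<i> * complex_of_real (- 2 * pi * (x \<bullet> \<xi>)))) has_derivative
      (\<lambda>h. exp (\<i> * complex_of_real (- 2 * pi * (x \<bullet> \<xi>))) * (\<i> * of_real (- 2 * pi * (h \<bullet> \<xi>))))) (at x)"
    by (rule has_derivative_compose)
  then show ?thesis unfolding cis_conv_exp by (simp add: mult_ac)
qed

lemma fourier_pderiv:
  assumes f: "f \<in> gauss_smooth e" and e: "0 < e" and b: "b \<in> Basis"
  shows "fourier (pderiv_in b f) \<xi> = 2 * pi * \<i> * of_real (b \<bullet> \<xi>) * fourier f \<xi>"
proof -
  let ?c = "\<lambda>x. cis (- 2 * pi * (x \<bullet> \<xi>))"
  let ?k = "2 * pi * \<i> * of_real (b \<bullet> \<xi>) :: complex"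
  have f': "pderiv_in b f \<in> gauss_smooth e" by (rule gauss_smooth_pderiv[OF f b])
  note [measurable] = gauss_smooth_measurable[OF f] gauss_smooth_measurable[OF f']
  have cd: "?c differentiable at x" for x using character_deriv differentiable_def by blast
  have deriv: "pderiv_in b (\<lambda>x. f x * ?c x) x = pderiv_in b f x * ?c x - ?k * (f x * ?c x)" for x
  proof -
    have "pderiv_in b ?c x = - 2 * pi * \<i> * of_real (b \<bullet> \<xi>) * ?c x"
      by (rule pderiv_in_eqI[OF character_deriv])
    then show ?thesis
      unfolding pderiv_in_mult[OF gauss_smooth_differentiable[OF f] cd] by (simp add: algebra_simps)
  qed
  obtain C where C: "0 \<le> C" "\<And>x. norm (f x) \<le> C * exp (- e * (norm x)\<^sup>2)"
    using gauss_smooth_bound[OF f] by blast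
  obtain D where D: "0 \<le> D" "\<And>x. norm (pderiv_in b f x) \<le> D * exp (- e * (norm x)\<^sup>2)"
    using gauss_smooth_bound[OF f'] by blast
  have i: "integrable lborel (\<lambda>x. f x * ?c x)" "integrable lborel (\<lambda>x. pderiv_in b f x * ?c x)"
    by (intro integrable_mult_cis gauss_smooth_integrable[OF _ e] f f'; measurable)+
  have "(\<integral>x. pderiv_in b (\<lambda>x. f x * ?c x) x \<partial>lborel) = 0"
  proof (rule integral_pderiv_zero[OF b i(1), where C = "D + norm ?k * C" and e = e])
    show "(\<lambda>x. f x * ?c x) differentiable at x" for x
      by (intro differentiable_mult cd gauss_smooth_differentiable[OF f])
    show "pderiv_in b (\<lambda>x. f x * ?c x) \<in> borel_measurable borel" unfolding deriv by measurable
    fix x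
    have "norm (pderiv_in b (\<lambda>x. f x * ?c x) x) \<le> norm (pderiv_in b f x) + norm ?k * norm (f x)"
      unfolding deriv by (rule order_trans[OF norm_triangle_ineq4]) (simp add: norm_mult)
    also have "\<dots> \<le> D * exp (- e * (norm x)\<^sup>2) + norm ?k * (C * exp (- e * (norm x)\<^sup>2))"
      by (intro add_mono mult_left_mono C D) auto
    also have "\<dots> = (D + norm ?k * C) * exp (- e * (norm x)\<^sup>2)" by (simp only: algebra_simps)
    finally show "norm (pderiv_in b (\<lambda>x. f x * ?c x) x) \<le> (D + norm ?k * C) * exp (- e * (norm x)\<^sup>2)" .
  qed (use C D e in auto)
  then have "(\<integral>x. pderiv_in b f x * ?c x \<partial>lborel) - (\<integral>x. ?k * (f x * ?c x) \<partial>lborel) = 0"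
    unfolding deriv using i by (subst (asm) Bochner_Integration.integral_diff) auto
  then show ?thesis by (simp add: fourier_def)
qed

lemma fourier_linear:
  assumes "integrable lborel f" "integrable lborel g"
  shows "fourier (\<lambda>x. f x + g x) \<xi> = fourier f \<xi> + fourier g \<xi>"
    "fourier (\<lambda>x. f x - g x) \<xi> = fourier f \<xi> - fourier g \<xi>"
  using integrable_mult_cis[OF assms(1), of "\<lambda>x. - 2 * pi * (x \<bullet> \<xi>)"]
    integrable_mult_cis[OF assms(2), of "\<lambda>x. - 2 * pi * (x \<bullet> \<xi>)"]
  by (simp_all add: fourier_def distrib_right left_diff_distrib)

lemma fourier_cmult: "fourier (\<lambda>x. c * f x) \<xi> = c * fourier f \<xi>"
  by (simp add: fourier_def mult.assoc)

lemma norm_fourier_le: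
  assumes "integrable lborel f" shows "norm (fourier f \<xi>) \<le> (\<integral>x. norm (f x) \<partial>lborel)"
proof -
  have "norm (fourier f \<xi>) \<le> (\<integral>x. norm (f x * cis (- 2 * pi * (x \<bullet> \<xi>))) \<partial>lborel)"
    unfolding fourier_def by (rule integral_norm_bound)
  then show ?thesis by simp
qed

text \<open>The reciprocal of the symbol of \<open>\<Prod>\<^sub>b (1 - \<partial>\<^sub>b\<^sup>2)\<close>. Unlike a radial weight, it is integrable in every
  dimension by the one-dimensional case.\<close>

definition decay_weight :: "'a::euclidean_space \<Rightarrow> real" where
  "decay_weight \<xi> = (\<Prod>b\<in>Basis. 1 / (1 + (2 * pi * (b \<bullet> \<xi>))\<^sup>2))"

lemma decay_weight_bounds: "0 \<le> decay_weight \<xi>" "decay_weight \<xi> \<le> 1"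
proof -
  have "1 / (1 + y\<^sup>2) \<le> 1" for y :: real
    by (simp add: divide_le_eq_1_pos add_pos_nonneg)
  then have b: "0 \<le> 1 / (1 + y\<^sup>2) \<and> 1 / (1 + y\<^sup>2) \<le> 1" for y :: real by simp
  show "0 \<le> decay_weight \<xi>"
    unfolding decay_weight_def by (rule prod_nonneg) simp
  show "decay_weight \<xi> \<le> 1"
    unfolding decay_weight_def by (rule prod_le_1) (rule b)
qed

lemma nn_integral_Cauchy_finite: "(\<integral>\<^sup>+x. ennreal (1 / (1 + (2 * pi * x)\<^sup>2)) \<partial>lborel) < \<infinity>"
proof -
  let ?f = "\<lambda>x::real. ennreal (1 / (1 + (2 * pi * x)\<^sup>2))"
  have "(\<integral>\<^sup>+x. ?f x * indicator {0..} x \<partial>lborel) = ennreal (1 / (2 * pi) * (pi / 2) - 1 / (2 * pi) * arctan (2 * pi * 0))"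
  proof (rule nn_integral_FTC_atLeast)
    show "((\<lambda>x. 1 / (2 * pi) * arctan (2 * pi * x)) has_real_derivative 1 / (1 + (2 * pi * x)\<^sup>2)) (at x)" for x
    proof -
      have "((\<lambda>x. arctan (2 * pi * x)) has_real_derivative inverse (1 + (2 * pi * x)\<^sup>2) * (2 * pi * 1)) (at x)"
        by (intro DERIV_chain2[OF DERIV_arctan] DERIV_cmult DERIV_ident)
      from DERIV_cmult[OF this, of "1 / (2 * pi)"] show ?thesis by (simp add: inverse_eq_divide)
    qed
    have "filterlim (\<lambda>x::real. 2 * pi * x) at_top at_top"
      by (rule filterlim_tendsto_pos_mult_at_top[OF tendsto_const]) (auto simp: filterlim_ident)
    then show "((\<lambda>x. 1 / (2 * pi) * arctan (2 * pi * x)) \<longlongrightarrow> 1 / (2 * pi) * (pi / 2)) at_top"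
      by (intro tendsto_intros filterlim_compose[OF tendsto_arctan_at_top])
  qed auto
  then have pos: "(\<integral>\<^sup>+x. ?f x * indicator {0..} x \<partial>lborel) < \<infinity>" by simp
  have neg: "(\<integral>\<^sup>+x. ?f x * indicator {..0} x \<partial>lborel) = (\<integral>\<^sup>+x. ?f x * indicator {0..} x \<partial>lborel)"
    by (subst nn_integral_real_affine[where c = "-1" and t = 0]) (auto intro!: nn_integral_cong simp: indicator_def)
  have "(\<integral>\<^sup>+x. ?f x \<partial>lborel) \<le> (\<integral>\<^sup>+x. ?f x * indicator {0..} x + ?f x * indicator {..0} x \<partial>lborel)"
    by (rule nn_integral_mono) (auto simp: indicator_def)
  also have "\<dots> = (\<integral>\<^sup>+x. ?f x * indicator {0..} x \<partial>lborel) + (\<integral>\<^sup>+x. ?f x * indicator {..0} x \<partial>lborel)"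
    by (rule nn_integral_add) auto
  also have "\<dots> < \<infinity>" unfolding neg using pos by simp
  finally show ?thesis .
qed

lemma decay_weight_measurable [measurable]: "decay_weight \<in> borel_measurable borel"
  unfolding decay_weight_def by measurable

lemma decay_weight_integrable: "integrable lborel (decay_weight :: 'a::euclidean_space \<Rightarrow> real)"
proof (rule integrableI_nonneg)
  have "ennreal (decay_weight \<xi>) = (\<Prod>b\<in>Basis. ennreal (1 / (1 + (2 * pi * (\<xi> \<bullet> b))\<^sup>2)))" for \<xi> :: 'a
    unfolding decay_weight_def inner_commute[of \<xi>] by (rule prod_ennreal[symmetric]) simp
  then have "(\<integral>\<^sup>+\<xi>. ennreal (decay_weight \<xi>) \<partial>(lborel :: 'a measure))
      = (\<integral>\<^sup>+\<xi>. (\<Prod>b\<in>Basis. ennreal (1 / (1 + (2 * pi * (\<xi> \<bullet> b))\<^sup>2))) \<partial>(lborel :: 'a measure))"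
    by (simp only:)
  also have "\<dots> = (\<Prod>b\<in>(Basis::'a set). \<integral>\<^sup>+x. ennreal (1 / (1 + (2 * pi * x)\<^sup>2)) \<partial>lborel)"
    by (rule nn_integral_lborel_prod) auto
  also have "\<dots> < \<infinity>"
    using nn_integral_Cauchy_finite by (simp add: ennreal_prod_eq_top power_eq_top_ennreal less_top[symmetric])
  finally show "(\<integral>\<^sup>+\<xi>. ennreal (decay_weight \<xi>) \<partial>(lborel :: 'a measure)) < \<infinity>" .
qed (use decay_weight_bounds in auto)

text \<open>Integrating by parts twice in each coordinate direction.\<close>

lemma fourier_poly_families:
  assumes e: "0 < e" and g: "g \<in> gauss_smooth e" and \<Phi>: "\<Phi> \<in> poly_families g"
    and B: "B \<subseteq> Basis"
  shows "\<exists>\<Psi>\<in>poly_families g. \<forall>z v \<xi>. 0 \<le> Re z \<longrightarrow> norm z \<le> 1 \<longrightarrow>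
     of_real (\<Prod>b\<in>B. 1 + (2 * pi * (b \<bullet> \<xi>))\<^sup>2) * fourier (\<lambda>w. \<Phi> (z, v) w * gauss_factor (z, v) w) \<xi>
     = fourier (\<lambda>w. \<Psi> (z, v) w * gauss_factor (z, v) w) \<xi>"
proof -
  have "finite B" using B finite_subset finite_Basis by blast
  then show ?thesis using B
  proof (induction B)
    case empty
    then show ?case using \<Phi> by auto
  next
    case (insert b B)
    then have b: "b \<in> Basis" by auto
    from insert.IH[OF insert_subset[THEN iffD1, OF insert.prems, THEN conjunct2]]
    obtain \<Psi> where \<Psi>1: "\<Psi> \<in> poly_families g"
      and \<Psi>2: "\<forall>z v \<xi>. 0 \<le> Re z \<longrightarrow> norm z \<le> 1 \<longrightarrow>
       of_real (\<Prod>b\<in>B. 1 + (2 * pi * (b \<bullet> \<xi>))\<^sup>2) * fourier (\<lambda>w. \<Phi> (z, v) w * gauss_factor (z, v) w) \<xi>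
       = fourier (\<lambda>w. \<Psi> (z, v) w * gauss_factor (z, v) w) \<xi>" by (rule bexE)
    note \<Psi> = \<Psi>1 \<Psi>2[rule_format]
    from poly_families_gauss_factor_deriv[OF g \<Psi>(1) b] obtain \<Psi>1 where \<Psi>1: "\<Psi>1 \<in> poly_families g"
      "\<And>p. pderiv_in b (\<lambda>w. \<Psi> p w * gauss_factor p w) = (\<lambda>w. \<Psi>1 p w * gauss_factor p w)" by blast
    from poly_families_gauss_factor_deriv[OF g \<Psi>1(1) b] obtain \<Psi>2 where \<Psi>2: "\<Psi>2 \<in> poly_families g"
      "\<And>p. pderiv_in b (\<lambda>w. \<Psi>1 p w * gauss_factor p w) = (\<lambda>w. \<Psi>2 p w * gauss_factor p w)" by blast
    let ?X = "\<lambda>p w. \<Psi> p w + (-1) * \<Psi>2 p w"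
    have "?X \<in> poly_families g" using \<Psi> \<Psi>2 by (intro poly_families.intros)
    moreover have "of_real (\<Prod>b\<in>insert b B. 1 + (2 * pi * (b \<bullet> \<xi>))\<^sup>2) * fourier (\<lambda>w. \<Phi> (z, v) w * gauss_factor (z, v) w) \<xi>
      = fourier (\<lambda>w. ?X (z, v) w * gauss_factor (z, v) w) \<xi>" if z: "0 \<le> Re z" "norm z \<le> 1" for z v \<xi>
    proof -
      have gs: "(\<lambda>w. \<Theta> (z, v) w * gauss_factor (z, v) w) \<in> gauss_smooth (e / 2)" if "\<Theta> \<in> poly_families g" for \<Theta>
        by (rule poly_families_gauss_smooth[OF e g that z])
      have e2: "0 < e / 2" using e by simp
      let ?F = "\<lambda>\<Theta>. fourier (\<lambda>w. \<Theta> (z, v) w * gauss_factor (z, v) w) \<xi>"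
      have F1: "?F \<Psi>1 = 2 * pi * \<i> * of_real (b \<bullet> \<xi>) * ?F \<Psi>"
        using fourier_pderiv[OF gs[OF \<Psi>(1)] e2 b] by (simp add: \<Psi>1(2))
      have F2: "?F \<Psi>2 = 2 * pi * \<i> * of_real (b \<bullet> \<xi>) * ?F \<Psi>1"
        using fourier_pderiv[OF gs[OF \<Psi>1(1)] e2 b] by (simp add: \<Psi>2(2))
      have "?F ?X = ?F \<Psi> - ?F \<Psi>2"
        using fourier_linear(2)[OF gauss_smooth_integrable[OF gs[OF \<Psi>(1)] e2] gauss_smooth_integrable[OF gs[OF \<Psi>2(1)] e2]]
        by (simp add: left_diff_distrib)
      also have "\<dots> = of_real (1 + (2 * pi * (b \<bullet> \<xi>))\<^sup>2) * ?F \<Psi>"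
        unfolding F2 F1 by (simp add: algebra_simps power2_eq_square)
      also have "?F \<Psi> = of_real (\<Prod>b\<in>B. 1 + (2 * pi * (b \<bullet> \<xi>))\<^sup>2) * ?F \<Phi>"
        using \<Psi>(2)[OF z] by simp
      finally show ?thesis using insert.hyps by (simp add: mult.assoc)
    qed
    ultimately show ?case by (intro bexI[of _ ?X] allI impI)
  qed
qed

text \<open>The estimate behind every limit below: it is uniform in \<open>z\<close>, and its growth in \<open>v\<close> is absorbed by
  \<open>exp (- \<pi> Re z |x|\<^sup>2)\<close> at \<open>v = Re z x\<close> as soon as \<open>Re z\<close> is small.\<close>

lemma fourier_window_decay:
  assumes e: "0 < e" and g: "g \<in> gauss_smooth e"
  shows "\<exists>C\<ge>0. \<forall>z v \<xi>. 0 \<le> Re z \<longrightarrow> norm z \<le> 1 \<longrightarrow>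
    norm (fourier (\<lambda>w. g w * gauss_factor (z, v) w) \<xi>) \<le> C * exp ((4 * pi\<^sup>2 / e + 1) * (norm v)\<^sup>2) * decay_weight \<xi>"
proof -
  have base: "(\<lambda>p. g) \<in> poly_families g" using poly_families.base[of "[]" g] by simp
  from fourier_poly_families[OF e g base order_refl]
  obtain \<Psi> where \<Psi>1: "\<Psi> \<in> poly_families g"
      and \<Psi>2: "\<forall>z v \<xi>. 0 \<le> Re z \<longrightarrow> norm z \<le> 1 \<longrightarrow>
       of_real (\<Prod>b\<in>Basis. 1 + (2 * pi * (b \<bullet> \<xi>))\<^sup>2) * fourier (\<lambda>w. g w * gauss_factor (z, v) w) \<xi>
       = fourier (\<lambda>w. \<Psi> (z, v) w * gauss_factor (z, v) w) \<xi>" by (rule bexE)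
  note \<Psi> = \<Psi>1 \<Psi>2[rule_format]
  obtain C where C: "0 \<le> C" "\<forall>z v w. 0 \<le> Re z \<longrightarrow> norm z \<le> 1 \<longrightarrow> norm (\<Psi> (z, v) w * gauss_factor (z, v) w)
    \<le> C * exp ((4 * pi\<^sup>2 / e + 1) * (norm v)\<^sup>2) * exp (- (e / 2) * (norm w)\<^sup>2)"
    using poly_families_gauss_factor_bound[OF e g \<Psi>(1)] by blast
  let ?I = "\<integral>w. exp (- (e / 2) * (norm w)\<^sup>2) \<partial>(lborel :: 'a measure)"
  have e2: "0 < e / 2" using e by simp
  show ?thesis
  proof (intro exI[of _ "C * ?I"] conjI allI impI)
    show "0 \<le> C * ?I" using C by (intro mult_nonneg_nonneg integral_nonneg_AE) auto
    fix z and v \<xi> :: 'a assume z: "0 \<le> Re z" "norm z \<le> 1"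
    let ?P = "\<Prod>b\<in>Basis. 1 + (2 * pi * (b \<bullet> \<xi>))\<^sup>2"
    have P: "0 < ?P" by (intro prod_pos) (auto intro: add_pos_nonneg)
    note i = gauss_smooth_integrable[OF poly_families_gauss_smooth[OF e g \<Psi>(1) z] e2]
    have "?P * norm (fourier (\<lambda>w. g w * gauss_factor (z, v) w) \<xi>)
      = norm (fourier (\<lambda>w. \<Psi> (z, v) w * gauss_factor (z, v) w) \<xi>)"
      using P unfolding \<Psi>(2)[OF z, symmetric] norm_mult norm_of_real by (simp only: abs_of_pos)
    also have "\<dots> \<le> (\<integral>w. norm (\<Psi> (z, v) w * gauss_factor (z, v) w) \<partial>lborel)"
      by (rule norm_fourier_le[OF i])
    also have "\<dots> \<le> (\<integral>w. C * exp ((4 * pi\<^sup>2 / e + 1) * (norm v)\<^sup>2) * exp (- (e / 2) * (norm w)\<^sup>2) \<partial>(lborel :: 'a measure))"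
    proof (rule integral_mono)
      show "integrable lborel (\<lambda>w. norm (\<Psi> (z, v) w * gauss_factor (z, v) w))" by (rule integrable_norm[OF i])
      show "integrable lborel (\<lambda>w::'a. C * exp ((4 * pi\<^sup>2 / e + 1) * (norm v)\<^sup>2) * exp (- (e / 2) * (norm w)\<^sup>2))"
        by (rule integrable_mult_right) (rule gaussian_integrable[OF e2])
      show "norm (\<Psi> (z, v) w * gauss_factor (z, v) w)
        \<le> C * exp ((4 * pi\<^sup>2 / e + 1) * (norm v)\<^sup>2) * exp (- (e / 2) * (norm w)\<^sup>2)" for w
        using C(2) z by blast
    qed
    also have "\<dots> = C * ?I * exp ((4 * pi\<^sup>2 / e + 1) * (norm v)\<^sup>2)" by simp
    finally have "norm (fourier (\<lambda>w. g w * gauss_factor (z, v) w) \<xi>)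
      \<le> C * ?I * exp ((4 * pi\<^sup>2 / e + 1) * (norm v)\<^sup>2) * (1 / ?P)"
      using P by (simp add: pos_le_divide_eq mult.commute)
    also have "1 / ?P = decay_weight \<xi>" unfolding decay_weight_def prod_dividef by simp
    finally show "norm (fourier (\<lambda>w. g w * gauss_factor (z, v) w) \<xi>)
      \<le> C * ?I * exp ((4 * pi\<^sup>2 / e + 1) * (norm v)\<^sup>2) * decay_weight \<xi>" .
  qed
qed

section \<open>Fourier transforms of complex Gaussians\<close>

lemma mult_inner_gauss_smooth:
  assumes f: "f \<in> gauss_smooth e" and e: "0 < e" and b: "b \<in> Basis"
  shows "(\<lambda>x. of_real (x \<bullet> b) * f x) \<in> gauss_smooth (e / 2)"
proof -
  have "(\<lambda>p w. of_real (w \<bullet> b) * partial_derivs [] f w) \<in> poly_families f"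
    by (intro poly_families.intros b) simp
  from poly_families_gauss_smooth[OF e f this, of 0 0] show ?thesis
    by (simp add: gauss_factor_def)
qed

lemma pderiv_gauss_factor:
  "pderiv_in b (gauss_factor (\<zeta>, 0)) x = - of_real (2 * pi) * \<zeta> * (of_real (x \<bullet> b) * gauss_factor (\<zeta>, 0) x)"
  using pderiv_in_eqI[OF gauss_factor_deriv[of "(\<zeta>, 0)" x], of b] by (simp only: fst_conv snd_conv inner_zero_left mult_zero_right of_real_0 diff_0_right mult.assoc)

lemma gauss_factor_gauss_smooth: "0 < Re \<zeta> \<Longrightarrow> gauss_factor (\<zeta>, 0) \<in> gauss_smooth (pi * Re \<zeta> / 2)"
  using complex_gaussian_gauss_smooth[of \<zeta> 1] by simp

lemma gauss_transform_algebra: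
  fixes p z X b F XX :: complex
  assumes 1: "- (2 * p) * z * X = 2 * p * \<i> * b * F" and 2: "F + - (2 * p) * z * XX = 2 * p * \<i> * b * X"
    and p: "p \<noteq> 0"
  shows "2 * p * z\<^sup>2 * XX = (z - 2 * (p * b\<^sup>2)) * F"
proof -
  have "2 * p * (z * X + \<i> * b * F) = 2 * p * \<i> * b * F - - (2 * p) * z * X"
    by (simp add: algebra_simps)
  also have "\<dots> = 0" unfolding 1 by simp
  finally have "2 * p * (z * X + \<i> * b * F) = 0" .
  then have X: "z * X = - (\<i> * b * F)" using p by (simp add: eq_neg_iff_add_eq_0)
  have "2 * p * z\<^sup>2 * XX = z * F - z * (F + - (2 * p) * z * XX)"
    by (simp add: algebra_simps power2_eq_square)
  also have "z * (F + - (2 * p) * z * XX) = 2 * p * \<i> * b * (z * X)"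
    unfolding 2 by (simp add: algebra_simps)
  also have "\<dots> = 2 * p * b\<^sup>2 * F" unfolding X by (simp add: power2_eq_square)
  finally show ?thesis by (simp add: algebra_simps)
qed

lemma power_sqrt_algebra:
  fixes s z n :: complex
  assumes "z = s * s" "s \<noteq> 0"
  shows "n * (inverse (2 * s) * s ^ m) = s ^ Suc m * (n / (2 * z))"
  using assms by (simp add: field_simps)

lemma gauss_quotient_algebra:
  fixes z a b c n p E M :: complex
  assumes "z \<noteq> 0"
  shows "(a * (n / (2 * z)) * b + b * (- c / z\<^sup>2) * a) * E + - p * M * (a * b)
    = a * b / (2 * z\<^sup>2) * ((n * z - 2 * c) * E - 2 * p * z\<^sup>2 * M)"
  using assms by (simp add: field_simps power2_eq_square)

text \<open>Differentiating \<open>G\<close> and \<open>x\<^sub>b G\<close> in direction \<open>b\<close> and summing over \<open>b\<close> expresses the transform of \<open>|x|\<^sup>2 G\<close>,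
  which is the derivative in \<open>\<zeta>\<close>, by the transform of \<open>G\<close> itself.\<close>

lemma fourier_norm_square_gauss_factor:
  fixes \<xi> :: "'a::euclidean_space"
  assumes z: "0 < Re \<zeta>"
  shows "2 * of_real pi * \<zeta>\<^sup>2 * fourier (\<lambda>x. of_real ((norm x)\<^sup>2) * gauss_factor (\<zeta>, 0) x) \<xi>
    = (of_nat DIM('a) * \<zeta> - 2 * of_real (pi * (norm \<xi>)\<^sup>2)) * fourier (gauss_factor (\<zeta>, 0)) \<xi>"
proof -
  let ?G = "gauss_factor (\<zeta>, 0) :: 'a \<Rightarrow> complex" and ?e = "pi * Re \<zeta> / 2"
  let ?x = "\<lambda>b x. of_real (x \<bullet> b) * ?G x"
  have e: "0 < ?e" "0 < ?e / 2" "0 < ?e / 2 / 2" using z by auto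
  have G: "?G \<in> gauss_smooth ?e" by (rule gauss_factor_gauss_smooth[OF z])
  have one: "2 * of_real pi * \<zeta>\<^sup>2 * fourier (\<lambda>x. of_real (x \<bullet> b) * ?x b x) \<xi>
    = (\<zeta> - 2 * of_real (pi * (\<xi> \<bullet> b)\<^sup>2)) * fourier ?G \<xi>" if b: "b \<in> Basis" for b
  proof -
    have xG: "?x b \<in> gauss_smooth (?e / 2)" by (rule mult_inner_gauss_smooth[OF G e(1) b])
    have xxG: "(\<lambda>x. of_real (x \<bullet> b) * ?x b x) \<in> gauss_smooth (?e / 2 / 2)" by (rule mult_inner_gauss_smooth[OF xG e(2) b])
    let ?k = "- of_real (2 * pi) * \<zeta>"
    have "fourier (\<lambda>x. ?k * ?x b x) \<xi> = 2 * pi * \<i> * of_real (b \<bullet> \<xi>) * fourier ?G \<xi>"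
      using fourier_pderiv[OF G e(1) b, of \<xi>] unfolding pderiv_gauss_factor .
    then have F1: "?k * fourier (?x b) \<xi> = 2 * pi * \<i> * of_real (b \<bullet> \<xi>) * fourier ?G \<xi>"
      unfolding fourier_cmult .
    have d: "pderiv_in b (?x b) x = ?G x + ?k * (of_real (x \<bullet> b) * ?x b x)" for x
      unfolding pderiv_in_mult[OF differentiable_of_real_inner gauss_factor_differentiable]
        pderiv_gauss_factor pderiv_in_of_real_inner using b by (simp add: algebra_simps)
    have "fourier (\<lambda>x. ?G x + ?k * (of_real (x \<bullet> b) * ?x b x)) \<xi> = 2 * pi * \<i> * of_real (b \<bullet> \<xi>) * fourier (?x b) \<xi>"
      using fourier_pderiv[OF xG e(2) b, of \<xi>] unfolding d .
    then have F2: "fourier ?G \<xi> + ?k * fourier (\<lambda>x. of_real (x \<bullet> b) * ?x b x) \<xi> = 2 * pi * \<i> * of_real (b \<bullet> \<xi>) * fourier (?x b) \<xi>"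
      using fourier_linear(1)[OF gauss_smooth_integrable[OF G e(1)] integrable_mult_right[OF gauss_smooth_integrable[OF xxG e(3)], of ?k], of \<xi>]
      unfolding fourier_cmult by (simp only: )
    have p: "complex_of_real (2 * pi) = 2 * of_real pi" by simp
    have q: "complex_of_real (pi * (\<xi> \<bullet> b)\<^sup>2) = of_real pi * (of_real (b \<bullet> \<xi>))\<^sup>2" by (simp add: inner_commute)
    show ?thesis
      unfolding q by (rule gauss_transform_algebra[OF F1[unfolded p] F2[unfolded p]]) simp
  qed
  have nsq: "(norm x)\<^sup>2 = (\<Sum>b\<in>Basis. (x \<bullet> b)\<^sup>2)" for x :: 'a
    unfolding power2_norm_eq_inner by (subst euclidean_inner) (simp add: power2_eq_square)
  have int: "integrable lborel (\<lambda>x. (of_real (x \<bullet> b) * ?x b x) * cis (- 2 * pi * (x \<bullet> \<xi>)))" if b: "b \<in> Basis" for b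
    using gauss_smooth_integrable[OF mult_inner_gauss_smooth[OF mult_inner_gauss_smooth[OF G e(1) b] e(2) b] e(3)]
    by (rule integrable_mult_cis) simp
  have "fourier (\<lambda>x. of_real ((norm x)\<^sup>2) * ?G x) \<xi>
     = (\<integral>x. (\<Sum>b\<in>Basis. (of_real (x \<bullet> b) * ?x b x) * cis (- 2 * pi * (x \<bullet> \<xi>))) \<partial>lborel)"
    unfolding fourier_def nsq of_real_sum
    by (intro Bochner_Integration.integral_cong refl) (simp add: sum_distrib_right power2_eq_square mult.assoc)
  also have "\<dots> = (\<Sum>b\<in>Basis. fourier (\<lambda>x. of_real (x \<bullet> b) * ?x b x) \<xi>)"
    unfolding fourier_def by (rule Bochner_Integration.integral_sum) (rule int)
  finally have "2 * of_real pi * \<zeta>\<^sup>2 * fourier (\<lambda>x. of_real ((norm x)\<^sup>2) * ?G x) \<xi>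
     = (\<Sum>b\<in>Basis. 2 * of_real pi * \<zeta>\<^sup>2 * fourier (\<lambda>x. of_real (x \<bullet> b) * ?x b x) \<xi>)"
    by (simp only: sum_distrib_left)
  also have "\<dots> = (\<Sum>b\<in>Basis. (\<zeta> - 2 * of_real (pi * (\<xi> \<bullet> b)\<^sup>2)) * fourier ?G \<xi>)"
    by (intro sum.cong refl one)
  also have "\<dots> = (of_nat DIM('a) * \<zeta> - 2 * of_real (pi * (norm \<xi>)\<^sup>2)) * fourier ?G \<xi>"
    unfolding nsq sum_distrib_right[symmetric] by (simp add: sum_subtractf sum_distrib_left of_real_sum)
  finally show ?thesis .
qed

text \<open>Differentiation under the integral sign; on \<open>Re z > \<rho>\<close> the mean value inequality gives a Gaussian majorant for the
  difference quotients.\<close>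

lemma fourier_gauss_factor_deriv:
  fixes \<xi> :: "'a::euclidean_space"
  assumes z: "0 < Re \<zeta>"
  shows "((\<lambda>\<zeta>. fourier (gauss_factor (\<zeta>, 0)) \<xi>) has_field_derivative
    - of_real pi * fourier (\<lambda>x. of_real ((norm x)\<^sup>2) * gauss_factor (\<zeta>, 0) x) \<xi>) (at \<zeta>)"
proof -
  define \<rho> where "\<rho> = Re \<zeta> / 2"
  let ?S = "{z. \<rho> < Re z}" and ?G = "\<lambda>\<zeta>. gauss_factor (\<zeta>, 0) :: 'a \<Rightarrow> complex"
  let ?c = "\<lambda>x::'a. cis (- 2 * pi * (x \<bullet> \<xi>))"
  have \<rho>: "0 < \<rho>" "\<zeta> \<in> ?S" using z by (auto simp: \<rho>_def)
  have "open ?S" by (rule open_halfspace_Re_gt)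
  then have at: "at \<zeta> = at \<zeta> within ?S" using \<rho>(2) by (metis at_within_open)
  have dG: "((\<lambda>\<zeta>. ?G \<zeta> x) has_field_derivative (- of_real (pi * (norm x)\<^sup>2) * ?G \<zeta>' x)) (at \<zeta>' within A)" for x \<zeta>' A
    unfolding gauss_factor_def by (auto intro!: derivative_eq_intros)
  obtain C where C: "0 \<le> C" "\<And>s. 0 \<le> s \<Longrightarrow> (1 + s) ^ 2 \<le> C * exp (pi * \<rho> / 2 * s\<^sup>2)"
    using pow_le_exp_square[of "pi * \<rho> / 2" 2] \<rho>(1) by (metis half_gt_zero mult_pos_pos pi_gt_zero)
  let ?w = "\<lambda>x::'a. pi * C * exp (- (pi * \<rho> / 2) * (norm x)\<^sup>2)"
  have pr: "0 < pi * \<rho> / 2" using \<rho>(1) by simp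
  have wi: "integrable lborel ?w"
    by (rule integrable_mult_right) (rule gaussian_integrable[OF pr])
  have bd: "norm (?G z1 x - ?G \<zeta> x) \<le> ?w x * norm (z1 - \<zeta>)" if z1: "z1 \<in> ?S" for z1 x
  proof (rule field_differentiable_bound[OF convex_halfspace_Re_gt dG _ z1 \<rho>(2)])
    fix z' assume z': "z' \<in> ?S"
    have "norm (- of_real (pi * (norm x)\<^sup>2) * ?G z' x) = pi * (norm x)\<^sup>2 * exp (- (pi * Re z' * (norm x)\<^sup>2))"
      unfolding norm_mult norm_minus_cancel norm_of_real norm_gauss_factor by simp
    also have "\<dots> \<le> pi * (C * exp (pi * \<rho> / 2 * (norm x)\<^sup>2)) * exp (- (pi * \<rho> * (norm x)\<^sup>2))"
    proof (intro mult_mono)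
      have "(norm x)\<^sup>2 \<le> (1 + norm x)\<^sup>2" by (intro power_mono) auto
      then show "(norm x)\<^sup>2 \<le> C * exp (pi * \<rho> / 2 * (norm x)\<^sup>2)" using C(2)[of "norm x"] by (meson norm_ge_zero order_trans)
      show "exp (- (pi * Re z' * (norm x)\<^sup>2)) \<le> exp (- (pi * \<rho> * (norm x)\<^sup>2))"
        using z' by (intro iffD2[OF exp_le_cancel_iff] iffD2[OF neg_le_iff_le] mult_right_mono mult_left_mono) auto
    qed (use C in auto)
    also have "\<dots> = pi * C * (exp (pi * \<rho> / 2 * (norm x)\<^sup>2) * exp (- (pi * \<rho> * (norm x)\<^sup>2)))" by (simp only: mult_ac)
    also have "exp (pi * \<rho> / 2 * (norm x)\<^sup>2) * exp (- (pi * \<rho> * (norm x)\<^sup>2)) = exp (- (pi * \<rho> / 2) * (norm x)\<^sup>2)"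
      by (simp add: exp_add[symmetric] field_simps)
    finally show "norm (- of_real (pi * (norm x)\<^sup>2) * ?G z' x) \<le> ?w x" .
  qed
  have Gi: "integrable lborel (\<lambda>x. ?G z' x * ?c x)" if "z' \<in> ?S" for z'
  proof (rule integrable_mult_cis)
    have p: "0 < Re z'" using that \<rho>(1) by auto
    then have q: "0 < pi * Re z' / 2" by simp
    show "integrable lborel (?G z')" by (rule gauss_smooth_integrable[OF gauss_factor_gauss_smooth[OF p] q])
  qed simp
  have Gm [measurable]: "?G z' \<in> borel_measurable borel" for z'
    unfolding gauss_factor_def by measurable
  show ?thesis
    unfolding at has_field_derivative_iff tendsto_at_iff_sequentially
  proof (intro allI impI)
    fix X assume X: "\<forall>i. X i \<in> ?S - {\<zeta>}" "X \<longlonglongrightarrow> \<zeta>"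
    let ?q = "\<lambda>i x. (?G (X i) x - ?G \<zeta> x) / (X i - \<zeta>) * ?c x"
    have "(\<lambda>i. \<integral>x. ?q i x \<partial>lborel) \<longlonglongrightarrow> (\<integral>x. - of_real (pi * (norm x)\<^sup>2) * ?G \<zeta> x * ?c x \<partial>lborel)"
    proof (rule integral_dominated_convergence[where w = ?w])
      show "AE x in lborel. (\<lambda>i. ?q i x) \<longlonglongrightarrow> - of_real (pi * (norm x)\<^sup>2) * ?G \<zeta> x * ?c x"
      proof (intro AE_I2 tendsto_mult_right)
        fix x
        have "((\<lambda>y. (?G y x - ?G \<zeta> x) / (y - \<zeta>)) \<longlongrightarrow> - of_real (pi * (norm x)\<^sup>2) * ?G \<zeta> x) (at \<zeta> within ?S)"
          using dG unfolding has_field_derivative_iff .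
        from this[unfolded tendsto_at_iff_sequentially, rule_format, OF X(1)[rule_format] X(2)]
        show "(\<lambda>i. (?G (X i) x - ?G \<zeta> x) / (X i - \<zeta>)) \<longlonglongrightarrow> - of_real (pi * (norm x)\<^sup>2) * ?G \<zeta> x"
          by (simp add: o_def)
      qed
      show "AE x in lborel. norm (?q i x) \<le> ?w x" for i
      proof (rule AE_I2)
        fix x
        have "0 < norm (X i - \<zeta>)" using X(1) by auto
        moreover have "norm (?G (X i) x - ?G \<zeta> x) \<le> ?w x * norm (X i - \<zeta>)" using bd X(1) by blast
        ultimately show "norm (?q i x) \<le> ?w x"
          unfolding norm_mult norm_divide by (simp only: pos_divide_le_eq norm_cis mult_1_right)
      qed
    qed (use wi in \<open>auto\<close>)
    moreover have "(\<integral>x. ?q i x \<partial>lborel) = (fourier (?G (X i)) \<xi> - fourier (?G \<zeta>) \<xi>) / (X i - \<zeta>)" for i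
    proof -
      have "(\<integral>x. ?q i x \<partial>lborel) = (\<integral>x. (?G (X i) x * ?c x - ?G \<zeta> x * ?c x) / (X i - \<zeta>) \<partial>lborel)"
        by (simp only: left_diff_distrib times_divide_eq_left)
      also have "\<dots> = (\<integral>x. ?G (X i) x * ?c x - ?G \<zeta> x * ?c x \<partial>lborel) / (X i - \<zeta>)"
        by (rule integral_divide_zero)
      also have "(\<integral>x. ?G (X i) x * ?c x - ?G \<zeta> x * ?c x \<partial>lborel) = fourier (?G (X i)) \<xi> - fourier (?G \<zeta>) \<xi>"
        unfolding fourier_def using Gi \<rho>(2) X(1) by (intro Bochner_Integration.integral_diff) blast+
      finally show ?thesis .
    qed
    moreover have "(\<integral>x. - of_real (pi * (norm x)\<^sup>2) * ?G \<zeta> x * ?c x \<partial>lborel)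
      = - of_real pi * fourier (\<lambda>x. of_real ((norm x)\<^sup>2) * ?G \<zeta> x) \<xi>"
      unfolding fourier_cmult[symmetric] unfolding fourier_def by (simp add: mult.assoc)
    ultimately show "((\<lambda>y. (fourier (?G y) \<xi> - fourier (?G \<zeta>) \<xi>) / (y - \<zeta>)) \<circ> X) \<longlonglongrightarrow>
      - of_real pi * fourier (\<lambda>x. of_real ((norm x)\<^sup>2) * ?G \<zeta> x) \<xi>"
      unfolding o_def by (simp only:)
  qed
qed

text \<open>By the two preceding lemmas the quotient of both sides is constant in the right half-plane, and it tends
  to \<open>1\<close> as \<open>\<zeta> \<rightarrow> \<infinity>\<close> along the reals, where the problem rescales to the total mass of \<open>exp (- \<pi> |y|\<^sup>2)\<close>.\<close>

lemma fourier_gauss_factor: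
  fixes \<xi> :: "'a::euclidean_space"
  assumes z: "0 < Re \<zeta>"
  shows "fourier (gauss_factor (\<zeta>, 0)) \<xi> = gauss_factor (inverse \<zeta>, 0) \<xi> / csqrt \<zeta> ^ DIM('a)"
proof -
  let ?c = "of_real (pi * (norm \<xi>)\<^sup>2) :: complex" and ?d = "DIM('a)"
  let ?E = "\<lambda>\<zeta>. fourier (gauss_factor (\<zeta>, 0)) \<xi>"
  define \<phi> where "\<phi> = (\<lambda>\<zeta>. csqrt \<zeta> ^ ?d * exp (?c / \<zeta>) * ?E \<zeta>)"
  have d: "(\<phi> has_field_derivative 0) (at z within {z. 0 < Re z})" if "z \<in> {z. 0 < Re z}" for z
  proof -
    have z: "0 < Re z" using that by simp
    then have nz: "z \<noteq> 0" "z \<notin> \<real>\<^sub>\<le>\<^sub>0" by (auto simp: complex_nonpos_Reals_iff)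
    let ?M = "fourier (\<lambda>x. of_real ((norm x)\<^sup>2) * gauss_factor (z, 0) x) \<xi>"
    have pw: "((\<lambda>z. csqrt z ^ ?d) has_field_derivative csqrt z ^ ?d * (of_nat ?d / (2 * z))) (at z)"
    proof -
      obtain m where m: "?d = Suc m" using DIM_positive[where 'a = 'a] by (cases ?d) auto
      have "((\<lambda>z. csqrt z ^ ?d) has_field_derivative of_nat ?d * (inverse (2 * csqrt z) * csqrt z ^ (?d - Suc 0))) (at z)"
        by (rule DERIV_power[OF has_field_derivative_csqrt[OF nz(2)]])
      moreover have "of_nat ?d * (inverse (2 * csqrt z) * csqrt z ^ (?d - Suc 0)) = csqrt z ^ ?d * (of_nat ?d / (2 * z))"
      proof -
        have "z = csqrt z * csqrt z" by (metis power2_csqrt power2_eq_square)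
        moreover have "csqrt z \<noteq> 0" using nz by simp
        ultimately show ?thesis unfolding m diff_Suc_Suc diff_zero
          by (rule power_sqrt_algebra)
      qed
      ultimately show ?thesis by (simp only:)
    qed
    have ex: "((\<lambda>z. exp (?c / z)) has_field_derivative exp (?c / z) * (- ?c / z\<^sup>2)) (at z)"
      using nz by (auto intro!: derivative_eq_intros simp: power2_eq_square)
    have E: "(?E has_field_derivative - of_real pi * ?M) (at z)"
      by (rule fourier_gauss_factor_deriv[OF z])
    have "(\<phi> has_field_derivative (csqrt z ^ ?d * (of_nat ?d / (2 * z)) * exp (?c / z) + exp (?c / z) * (- ?c / z\<^sup>2) * csqrt z ^ ?d) * ?E z
        + - of_real pi * ?M * (csqrt z ^ ?d * exp (?c / z))) (at z)"
      unfolding \<phi>_def by (rule DERIV_mult[OF DERIV_mult[OF pw ex] E])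
    moreover have "(csqrt z ^ ?d * (of_nat ?d / (2 * z)) * exp (?c / z) + exp (?c / z) * (- ?c / z\<^sup>2) * csqrt z ^ ?d) * ?E z
        + - of_real pi * ?M * (csqrt z ^ ?d * exp (?c / z)) = 0" (is "?L = 0")
    proof -
      have "?L = csqrt z ^ ?d * exp (?c / z) / (2 * z\<^sup>2) * ((of_nat ?d * z - 2 * ?c) * ?E z - 2 * of_real pi * z\<^sup>2 * ?M)"
        by (rule gauss_quotient_algebra[OF nz(1)])
      then show ?thesis using fourier_norm_square_gauss_factor[OF z, of \<xi>] by simp
    qed
    ultimately show ?thesis by (simp add: has_field_derivative_at_within)
  qed
  have "\<exists>c. \<forall>z\<in>{z. 0 < Re z}. \<phi> z = c"
    by (rule has_field_derivative_zero_constant[OF convex_halfspace_Re_gt d])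
  then obtain c where c: "\<And>z. 0 < Re z \<Longrightarrow> \<phi> z = c" by auto
  let ?s = "\<lambda>n. real (Suc n)"
  let ?f = "\<lambda>n y. of_real (exp (- pi * (norm y)\<^sup>2)) * cis (- 2 * pi * (y \<bullet> \<xi>) / sqrt (?s n))"
  have real: "\<phi> (of_real (?s n)) = exp (?c / of_real (?s n)) * (\<integral>y. ?f n y \<partial>lborel)" for n
  proof -
    have s: "0 < sqrt (?s n)" "sqrt (?s n) \<noteq> 0" by auto
    have "(\<integral>y. ?f n y \<partial>lborel) = \<bar>sqrt (?s n)\<bar> ^ ?d *\<^sub>R (\<integral>x. ?f n (0 + sqrt (?s n) *\<^sub>R x) \<partial>lborel)"
      by (rule lborel_integral_affine) (use s in auto)
    also have "(\<lambda>x. ?f n (0 + sqrt (?s n) *\<^sub>R x)) = (\<lambda>x. gauss_factor (of_real (?s n), 0) x * cis (- 2 * pi * (x \<bullet> \<xi>)))"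
    proof
      fix x :: 'a
      have 1: "(norm (0 + sqrt (?s n) *\<^sub>R x))\<^sup>2 = ?s n * (norm x)\<^sup>2" by (simp add: power_mult_distrib del: of_nat_Suc)
      have 2: "- 2 * pi * ((0 + sqrt (?s n) *\<^sub>R x) \<bullet> \<xi>) / sqrt (?s n) = - 2 * pi * (x \<bullet> \<xi>)"
        using s by (simp del: of_nat_Suc)
      show "?f n (0 + sqrt (?s n) *\<^sub>R x) = gauss_factor (of_real (?s n), 0) x * cis (- 2 * pi * (x \<bullet> \<xi>))"
        unfolding 1 2 gauss_factor_of_real by (simp only: mult.assoc)
    qed
    finally have "(\<integral>y. ?f n y \<partial>lborel) = of_real (sqrt (?s n) ^ ?d) * ?E (of_real (?s n))"
      using s by (simp add: fourier_def scaleR_conv_of_real del: of_nat_Suc)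
    moreover have "csqrt (of_real (?s n)) ^ ?d = of_real (sqrt (?s n) ^ ?d)"
    proof -
      have "csqrt (of_real (?s n)) = of_real (sqrt (?s n))"
        by (subst csqrt_of_real_nonneg) (auto simp del: of_nat_Suc)
      then show ?thesis by (simp only: of_real_power)
    qed
    ultimately show ?thesis unfolding \<phi>_def by (simp only: mult_ac)
  qed
  have "(\<lambda>n. \<integral>y. ?f n y \<partial>lborel) \<longlonglongrightarrow> (\<integral>y. of_real (exp (- pi * (norm (y::'a))\<^sup>2)) * cis 0 \<partial>lborel)"
  proof (rule integral_dominated_convergence[where w = "\<lambda>y. exp (- pi * (norm y)\<^sup>2)"])
    show "integrable lborel (\<lambda>y::'a. exp (- pi * (norm y)\<^sup>2))" by (rule gaussian_integrable) simp
    show "AE y in lborel. (\<lambda>n. ?f n y) \<longlonglongrightarrow> of_real (exp (- pi * (norm (y::'a))\<^sup>2)) * cis 0"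
    proof (intro AE_I2 tendsto_mult tendsto_const)
      fix y
      have "filterlim (\<lambda>n. sqrt (?s n)) at_top sequentially"
        by (intro filterlim_compose[OF sqrt_at_top] filterlim_compose[OF filterlim_real_sequentially] filterlim_Suc)
      then have "(\<lambda>n. - 2 * pi * (y \<bullet> \<xi>) / sqrt (?s n)) \<longlonglongrightarrow> 0"
        by (intro tendsto_divide_0[OF tendsto_const] filterlim_at_top_imp_at_infinity)
      then show "(\<lambda>n. cis (- 2 * pi * (y \<bullet> \<xi>) / sqrt (?s n))) \<longlonglongrightarrow> cis 0"
        by (rule tendsto_cis)
    qed
  qed auto
  moreover have "(\<integral>y. of_real (exp (- pi * (norm (y::'a))\<^sup>2)) * cis 0 \<partial>lborel) = (1 :: complex)"
  proof -
    have "(\<integral>y. exp (- pi * (norm (y::'a))\<^sup>2) \<partial>lborel) = 1"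
      by (subst integral_eq_nn_integral) (use nn_integral_gaussian[where 'a = 'a] in auto)
    then show ?thesis by (simp add: integral_complex_of_real cis_zero)
  qed
  moreover have "(\<lambda>n. exp (?c / of_real (?s n))) \<longlonglongrightarrow> exp 0"
  proof (rule tendsto_exp)
    have "(\<lambda>n. pi * (norm \<xi>)\<^sup>2 / ?s n) \<longlonglongrightarrow> 0"
      by (rule LIMSEQ_Suc[OF lim_const_over_n])
    then have "(\<lambda>n. complex_of_real (pi * (norm \<xi>)\<^sup>2 / ?s n)) \<longlonglongrightarrow> of_real 0" by (rule tendsto_of_real)
    then show "(\<lambda>n. ?c / of_real (?s n)) \<longlonglongrightarrow> 0" by (simp only: of_real_divide of_real_0)
  qed
  ultimately have "(\<lambda>n. \<phi> (of_real (?s n))) \<longlonglongrightarrow> exp 0 * 1" unfolding real by (intro tendsto_mult) auto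
  moreover have "(\<lambda>n. \<phi> (of_real (?s n))) = (\<lambda>n. c)" using c by auto
  ultimately have "c = 1" by (simp add: LIMSEQ_const_iff)
  with c[OF z] have 1: "csqrt \<zeta> ^ ?d * exp (?c / \<zeta>) * ?E \<zeta> = 1" by (simp add: \<phi>_def)
  have nz: "csqrt \<zeta> ^ ?d \<noteq> 0" using z by auto
  have "?E \<zeta> = (csqrt \<zeta> ^ ?d * exp (?c / \<zeta>) * ?E \<zeta>) * (exp (- (?c / \<zeta>)) / csqrt \<zeta> ^ ?d)"
    using nz by (simp add: exp_minus field_simps)
  also have "\<dots> = exp (- (?c / \<zeta>)) / csqrt \<zeta> ^ ?d" unfolding 1 by simp
  also have "exp (- (?c / \<zeta>)) = gauss_factor (inverse \<zeta>, 0) \<xi>"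
    unfolding gauss_factor_def by (simp add: divide_inverse mult_ac)
  finally show ?thesis .
qed

lemma inverse_fourier_eq: "inverse_fourier h x = fourier h (- x)"
  by (simp add: inverse_fourier_def fourier_def inner_commute)

lemma gauss_factor_even: "gauss_factor (\<zeta>, 0) (- x) = gauss_factor (\<zeta>, 0) x"
  by (simp add: gauss_factor_def)

lemma inverse_fourier_gauss_factor:
  fixes x :: "'a::euclidean_space"
  assumes z: "0 < Re \<zeta>"
  shows "inverse_fourier (gauss_factor (\<zeta>, 0)) x = gauss_factor (inverse \<zeta>, 0) x / csqrt \<zeta> ^ DIM('a)"
  unfolding inverse_fourier_eq fourier_gauss_factor[OF z] gauss_factor_even ..

lemma schrodinger_gaussian:
  fixes x :: "'a::euclidean_space" and l t :: real
  assumes l: "0 < l"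
  defines "\<zeta> \<equiv> Complex (1 / l) (4 * pi * t)"
  shows "schrodinger t (gauss_factor (of_real l, 0)) x
    = 1 / (of_real (sqrt l ^ DIM('a)) * csqrt \<zeta> ^ DIM('a)) * gauss_factor (inverse \<zeta>, 0) x"
proof -
  let ?k = "1 / of_real (sqrt l ^ DIM('a)) :: complex"
  have "cis (- 4 * pi\<^sup>2 * t * (norm \<xi>)\<^sup>2) * fourier (gauss_factor (of_real l, 0)) \<xi> = ?k * gauss_factor (\<zeta>, 0) \<xi>" for \<xi> :: 'a
  proof -
    have "cis (- 4 * pi\<^sup>2 * t * (norm \<xi>)\<^sup>2) * gauss_factor (inverse (of_real l), 0) \<xi> = gauss_factor (\<zeta>, 0) \<xi>"
      unfolding gauss_factor_def cis_conv_exp exp_add[symmetric] \<zeta>_def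
      by (simp add: complex_eq_iff power2_eq_square field_simps complex_eq Complex_eq)
    moreover have "csqrt (of_real l) = of_real (sqrt l)" using l by (simp add: csqrt_of_real_nonneg)
    ultimately show ?thesis using l by (simp add: fourier_gauss_factor)
  qed
  then have "schrodinger t (gauss_factor (of_real l, 0)) x = inverse_fourier (\<lambda>\<xi>. ?k * gauss_factor (\<zeta>, 0) \<xi>) x"
    unfolding schrodinger_def by (simp only:)
  also have "\<dots> = ?k * inverse_fourier (gauss_factor (\<zeta>, 0)) x"
    unfolding inverse_fourier_eq fourier_cmult ..
  also have "\<dots> = ?k * (gauss_factor (inverse \<zeta>, 0) x / csqrt \<zeta> ^ DIM('a))"
    using l by (subst inverse_fourier_gauss_factor) (auto simp: \<zeta>_def)
  finally show ?thesis by simp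
qed

section \<open>Energy and convolution bounds\<close>

lemma fourier_measurable:
  assumes [measurable]: "f \<in> borel_measurable borel"
  shows "fourier f \<in> borel_measurable borel"
  unfolding fourier_def by measurable

lemma norm_integral_le_nn_integral: "ennreal (norm (\<integral>x. f x \<partial>M)) \<le> (\<integral>\<^sup>+x. ennreal (norm (f x)) \<partial>M)"
  by (cases "integrable M f") (auto simp: not_integrable_integral_eq integral_norm_bound_ennreal)

text \<open>By Fubini. With an explicit Gaussian as one of the two functions, this formula does the work of Fourier inversion.\<close>

lemma fourier_multiplication:
  fixes u v :: "'a::euclidean_space \<Rightarrow> complex"
  assumes u: "integrable lborel u" and v: "integrable lborel v"
  shows "(\<integral>\<xi>. fourier u \<xi> * v \<xi> \<partial>lborel) = (\<integral>x. u x * fourier v x \<partial>lborel)"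
proof -
  have [measurable]: "u \<in> borel_measurable borel" "v \<in> borel_measurable borel" using u v by auto
  let ?k = "\<lambda>x \<xi>. u x * v \<xi> * cis (- 2 * pi * (x \<bullet> \<xi>))"
  have nk: "norm (?k x \<xi>) = norm (u x) * norm (v \<xi>)" for x \<xi> by (simp add: norm_mult)
  have int: "integrable (lborel \<Otimes>\<^sub>M lborel) (\<lambda>(x, \<xi>). ?k x \<xi>)"
  proof (rule lborel_pair.Fubini_integrable)
    show "(\<lambda>(x, \<xi>). ?k x \<xi>) \<in> borel_measurable (lborel \<Otimes>\<^sub>M lborel)" by measurable
    show "integrable lborel (\<lambda>x. \<integral>\<xi>. norm (case (x, \<xi>) of (x, \<xi>) \<Rightarrow> ?k x \<xi>) \<partial>lborel)"
      unfolding prod.case nk by (simp add: integrable_norm[OF u])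
    show "AE x in lborel. integrable lborel (\<lambda>\<xi>. case (x, \<xi>) of (x, \<xi>) \<Rightarrow> ?k x \<xi>)"
      unfolding prod.case using v by (intro AE_I2 integrable_mult_cis integrable_mult_right) auto
  qed
  have "(\<integral>\<xi>. fourier u \<xi> * v \<xi> \<partial>lborel) = (\<integral>\<xi>. (\<integral>x. ?k x \<xi> \<partial>lborel) \<partial>lborel)"
    unfolding fourier_def integral_mult_left_zero[symmetric] by (simp only: mult_ac)
  also have "\<dots> = (\<integral>x. (\<integral>\<xi>. ?k x \<xi> \<partial>lborel) \<partial>lborel)"
    by (rule lborel_pair.Fubini_integral[OF int])
  also have "\<dots> = (\<integral>x. u x * fourier v x \<partial>lborel)"
    unfolding fourier_def integral_mult_right_zero[symmetric] by (simp only: mult_ac inner_commute)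
  finally show ?thesis .
qed

lemma fourier_modulate:
  "fourier (\<lambda>x. f x * cis (2 * pi * (x \<bullet> \<eta>))) \<xi> = fourier f (\<xi> - \<eta>)"
proof -
  have "cis (2 * pi * (x \<bullet> \<eta>)) * cis (- 2 * pi * (x \<bullet> \<xi>)) = cis (- 2 * pi * (x \<bullet> (\<xi> - \<eta>)))" for x
    unfolding cis_mult by (rule arg_cong[where f = cis]) (simp add: inner_diff_right algebra_simps)
  then show ?thesis unfolding fourier_def by (simp only: mult.assoc)
qed

lemma cnj_fourier: "cnj (fourier f \<xi>) = fourier (\<lambda>x. cnj (f x)) (- \<xi>)"
proof -
  have "cnj (fourier f \<xi>) = (\<integral>x. cnj (f x * cis (- 2 * pi * (x \<bullet> \<xi>))) \<partial>lborel)"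
    unfolding fourier_def by (rule Bochner_Integration.integral_cnj[symmetric])
  then show ?thesis by (simp add: fourier_def cis_cnj)
qed

lemma gauss_factor_measurable [measurable]: "gauss_factor p \<in> borel_measurable borel"
  unfolding gauss_factor_def by measurable

lemma cnj_measurable [measurable]: "cnj \<in> borel_measurable borel"
  by (intro borel_measurable_continuous_onI continuous_on_cnj continuous_on_id)

lemma norm_gauss_factor0: "norm (gauss_factor (\<zeta>, 0) x) = exp (- (pi * Re \<zeta>) * (norm x)\<^sup>2)"
  by (simp add: norm_gauss_factor)

lemma gauss_factor_integrable:
  assumes "0 < Re \<zeta>" shows "integrable lborel (gauss_factor (\<zeta>, 0))"
  using gauss_smooth_integrable[OF gauss_factor_gauss_smooth[OF assms]] assms by simp

text \<open>Half of Plancherel's theorem. Damping the frequency integral by a wide Gaussian turns it, by the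
  multiplication formula, into a space integral against an approximate identity.\<close>

lemma plancherel_le:
  fixes h :: "'a::euclidean_space \<Rightarrow> complex"
  assumes hi: "integrable lborel h" and hc: "\<And>x. isCont h x" and hM: "\<And>x. norm (h x) \<le> M"
  shows "(\<integral>\<^sup>+x. ennreal ((norm (h x))\<^sup>2) \<partial>lborel) \<le> (\<integral>\<^sup>+\<xi>. ennreal ((norm (fourier h \<xi>))\<^sup>2) \<partial>lborel)"
proof -
  have hm [measurable]: "h \<in> borel_measurable borel" using hi by auto
  note [measurable] = fourier_measurable[OF hm]
  have M: "0 \<le> M" using order_trans[OF norm_ge_zero hM] by blast
  define s where "s = (\<lambda>n. 1 / real (Suc n))"
  have s: "0 < s n" for n by (simp add: s_def)
  have s0: "s \<longlonglongrightarrow> 0" unfolding s_def by (rule LIMSEQ_Suc[OF lim_1_over_n])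
  let ?\<gamma> = "\<lambda>n. gauss_factor (of_real ((s n)\<^sup>2), 0) :: 'a \<Rightarrow> complex"
  let ?avg = "\<lambda>n x. \<integral>u. cnj (h (x + s n *\<^sub>R u)) * of_real (exp (- pi * (norm u)\<^sup>2)) \<partial>(lborel :: 'a measure)"
  have s2: "0 < Re (of_real ((s n)\<^sup>2))" for n using s[of n] by simp
  have gi: "integrable lborel (?\<gamma> n)" for n by (rule gauss_factor_integrable[OF s2])
  have chi: "integrable lborel (\<lambda>x. cnj (h x))" using hi by simp
  have Fcb: "norm (fourier f \<xi>) \<le> (\<integral>x. norm (f x) \<partial>lborel)" if "integrable lborel f" for f :: "'a \<Rightarrow> complex" and \<xi>
    by (rule norm_fourier_le[OF that])
  have inner: "fourier (\<lambda>\<xi>. cnj (fourier h \<xi>) * ?\<gamma> n \<xi>) x = ?avg n x" for n x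
  proof -
    let ?v = "\<lambda>\<xi>. ?\<gamma> n \<xi> * cis (2 * pi * (\<xi> \<bullet> x))"
    have vi: "integrable lborel ?v" by (rule integrable_mult_cis[OF gi]) simp
    have "fourier (\<lambda>\<xi>. cnj (fourier h \<xi>) * ?\<gamma> n \<xi>) x
      = (\<integral>\<xi>. fourier (\<lambda>x. cnj (h x)) (- \<xi>) * ?\<gamma> n \<xi> * cis (- 2 * pi * (\<xi> \<bullet> x)) \<partial>lborel)"
      by (subst fourier_def) (simp only: cnj_fourier)
    also have "\<dots> = (\<integral>\<xi>. fourier (\<lambda>x. cnj (h x)) \<xi> * ?v \<xi> \<partial>lborel)"
    proof -
      have m: "(\<lambda>\<xi>. fourier (\<lambda>x. cnj (h x)) \<xi> * ?v \<xi>) \<in> borel_measurable borel"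
        by (intro borel_measurable_times fourier_measurable) auto
      show ?thesis
        using lborel_integral_affine[OF _ m, of "-1" 0] by (simp add: gauss_factor_even mult.assoc)
    qed
    also have "\<dots> = (\<integral>y. cnj (h y) * fourier ?v y \<partial>lborel)"
      by (rule fourier_multiplication[OF chi vi])
    also have "\<dots> = (\<integral>y. cnj (h y) * (gauss_factor (inverse (of_real ((s n)\<^sup>2)), 0) (y - x) / of_real (s n ^ DIM('a))) \<partial>lborel)"
    proof -
      have "csqrt (of_real ((s n)\<^sup>2)) = of_real (s n)" using s[of n] by (subst csqrt_of_real_nonneg) auto
      then show ?thesis
        unfolding fourier_modulate fourier_gauss_factor[OF s2] by (simp only: of_real_power)
    qed
    also have "\<dots> = \<bar>s n\<bar> ^ DIM('a) *\<^sub>R (\<integral>u. cnj (h (x + s n *\<^sub>R u)) *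
        (gauss_factor (inverse (of_real ((s n)\<^sup>2)), 0) ((x + s n *\<^sub>R u) - x) / of_real (s n ^ DIM('a))) \<partial>lborel)"
      using s[of n] by (intro lborel_integral_affine) (auto simp: gauss_factor_def)
    also have "\<dots> = (\<integral>u. of_real (s n ^ DIM('a)) * (cnj (h (x + s n *\<^sub>R u)) *
        (gauss_factor (inverse (of_real ((s n)\<^sup>2)), 0) ((x + s n *\<^sub>R u) - x) / of_real (s n ^ DIM('a)))) \<partial>lborel)"
      using s[of n] unfolding scaleR_conv_of_real integral_mult_right_zero by simp
    also have "\<dots> = ?avg n x"
    proof (intro Bochner_Integration.integral_cong refl)
      fix u :: 'a
      have g1: "gauss_factor (inverse (of_real ((s n)\<^sup>2)), 0) ((x + s n *\<^sub>R u) - x) = of_real (exp (- pi * (norm u)\<^sup>2))"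
      proof -
        have "- pi * inverse ((s n)\<^sup>2) * (norm ((x + s n *\<^sub>R u) - x))\<^sup>2 = - pi * (norm u)\<^sup>2"
          using s[of n] by (simp add: power_mult_distrib)
        then show ?thesis unfolding of_real_inverse[symmetric] gauss_factor_of_real by (simp only:)
      qed
      have "complex_of_real (s n ^ DIM('a)) \<noteq> 0" using s[of n] by simp
      then show "of_real (s n ^ DIM('a)) * (cnj (h (x + s n *\<^sub>R u)) *
        (gauss_factor (inverse (of_real ((s n)\<^sup>2)), 0) ((x + s n *\<^sub>R u) - x) / of_real (s n ^ DIM('a))))
        = cnj (h (x + s n *\<^sub>R u)) * of_real (exp (- pi * (norm u)\<^sup>2))" unfolding g1 by simp
    qed
    finally show ?thesis .
  qed
  have vi: "integrable lborel (\<lambda>\<xi>. cnj (fourier h \<xi>) * ?\<gamma> n \<xi>)" for n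
  proof (rule Bochner_Integration.integrable_bound[of _ "\<lambda>\<xi>. of_real (\<integral>x. norm (h x) \<partial>lborel) * ?\<gamma> n \<xi>"])
    show "integrable lborel (\<lambda>\<xi>. of_real (\<integral>x. norm (h x) \<partial>lborel) * ?\<gamma> n \<xi>)" using gi by (rule integrable_mult_right)
    show "(\<lambda>\<xi>. cnj (fourier h \<xi>) * ?\<gamma> n \<xi>) \<in> borel_measurable lborel"
      using gi[of n] by (auto intro!: borel_measurable_times)
    show "AE \<xi> in lborel. norm (cnj (fourier h \<xi>) * ?\<gamma> n \<xi>) \<le> norm (of_real (\<integral>x. norm (h x) \<partial>lborel) * ?\<gamma> n \<xi>)"
      using Fcb[OF hi] unfolding norm_mult complex_mod_cnj norm_of_real
      by (intro AE_I2 mult_right_mono) (auto intro: order_trans[OF _ abs_ge_self])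
  qed
  have eq: "(\<integral>\<xi>. fourier h \<xi> * (cnj (fourier h \<xi>) * ?\<gamma> n \<xi>) \<partial>lborel) = (\<integral>x. h x * ?avg n x \<partial>lborel)" for n
    using fourier_multiplication[OF hi vi[of n]] unfolding inner .
  have Gi: "integrable lborel (\<lambda>u::'a. M * exp (- pi * (norm u)\<^sup>2))"
    by (rule integrable_mult_right) (rule gaussian_integrable, simp)
  have G1: "(\<integral>u. exp (- pi * (norm u)\<^sup>2) \<partial>(lborel :: 'a measure)) = 1"
    by (subst integral_eq_nn_integral) (use nn_integral_gaussian[where 'a = 'a] in auto)
  have avgb: "norm (?avg n x) \<le> M" for n x
  proof -
    have "norm (?avg n x) \<le> (\<integral>u. M * exp (- pi * (norm u)\<^sup>2) \<partial>(lborel :: 'a measure))"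
    proof (rule Bochner_Integration.integral_norm_bound_integral[OF _ Gi])
      show "integrable lborel (\<lambda>u. cnj (h (x + s n *\<^sub>R u)) * of_real (exp (- pi * (norm u)\<^sup>2)))"
        by (rule Bochner_Integration.integrable_bound[OF Gi])
          (use hM M in \<open>auto simp: norm_mult intro!: mult_right_mono\<close>)
      show "norm (cnj (h (x + s n *\<^sub>R u)) * of_real (exp (- pi * (norm u)\<^sup>2))) \<le> M * exp (- pi * (norm u)\<^sup>2)" for u
        using hM by (simp add: norm_mult mult_right_mono)
    qed
    then show ?thesis using G1 by simp
  qed
  have "(\<lambda>n. \<integral>x. h x * ?avg n x \<partial>lborel) \<longlonglongrightarrow> (\<integral>x. h x * cnj (h x) \<partial>lborel)"
  proof (rule integral_dominated_convergence[where w = "\<lambda>x. norm (h x) * M"])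
    show "integrable lborel (\<lambda>x. norm (h x) * M)" using hi by simp
    show "AE x in lborel. norm (h x * ?avg n x) \<le> norm (h x) * M" for n
      unfolding norm_mult by (intro AE_I2 mult_left_mono avgb norm_ge_zero)
    show "AE x in lborel. (\<lambda>n. h x * ?avg n x) \<longlonglongrightarrow> h x * cnj (h x)"
    proof (intro AE_I2 tendsto_mult tendsto_const)
      fix x
      have "(\<lambda>n. ?avg n x) \<longlonglongrightarrow> (\<integral>u. cnj (h x) * of_real (exp (- pi * (norm u)\<^sup>2)) \<partial>(lborel :: 'a measure))"
      proof (rule integral_dominated_convergence[OF _ _ Gi])
        show "AE u in lborel. (\<lambda>n. cnj (h (x + s n *\<^sub>R u)) * of_real (exp (- pi * (norm u)\<^sup>2)))
          \<longlonglongrightarrow> cnj (h x) * of_real (exp (- pi * (norm u)\<^sup>2))"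
        proof (intro AE_I2 tendsto_mult tendsto_const tendsto_cnj isCont_tendsto_compose[OF hc])
          fix u
          have "(\<lambda>n. x + s n *\<^sub>R u) \<longlonglongrightarrow> x + 0 *\<^sub>R u" by (intro tendsto_intros s0)
          then show "(\<lambda>n. x + s n *\<^sub>R u) \<longlonglongrightarrow> x" by simp
        qed
        show "AE u in lborel. norm (cnj (h (x + s n *\<^sub>R u)) * of_real (exp (- pi * (norm u)\<^sup>2))) \<le> M * exp (- pi * (norm u)\<^sup>2)" for n
          using hM by (simp add: norm_mult mult_right_mono)
      qed auto
      also have "(\<integral>u. cnj (h x) * of_real (exp (- pi * (norm u)\<^sup>2)) \<partial>(lborel :: 'a measure)) = cnj (h x)"
        unfolding integral_mult_right_zero integral_complex_of_real G1 by simp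
      finally show "(\<lambda>n. ?avg n x) \<longlonglongrightarrow> cnj (h x)" .
    qed
  qed auto
  moreover have "(\<integral>x. h x * cnj (h x) \<partial>lborel) = of_real (\<integral>x. (norm (h x))\<^sup>2 \<partial>lborel)"
    unfolding complex_norm_square[symmetric] by (rule integral_complex_of_real)
  moreover have "(\<integral>\<xi>. fourier h \<xi> * (cnj (fourier h \<xi>) * ?\<gamma> n \<xi>) \<partial>lborel)
      = of_real (\<integral>\<xi>. (norm (fourier h \<xi>))\<^sup>2 * exp (- pi * (s n)\<^sup>2 * (norm \<xi>)\<^sup>2) \<partial>lborel)" for n
    unfolding mult.assoc[symmetric] complex_norm_square[symmetric] gauss_factor_of_real of_real_mult[symmetric]
    by (simp only: integral_complex_of_real mult.assoc)
  ultimately have "(\<lambda>n. complex_of_real (\<integral>\<xi>. (norm (fourier h \<xi>))\<^sup>2 * exp (- pi * (s n)\<^sup>2 * (norm \<xi>)\<^sup>2) \<partial>lborel))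
     \<longlonglongrightarrow> of_real (\<integral>x. (norm (h x))\<^sup>2 \<partial>lborel)"
    unfolding eq[symmetric] by (simp only:)
  then have lim: "(\<lambda>n. \<integral>\<xi>. (norm (fourier h \<xi>))\<^sup>2 * exp (- pi * (s n)\<^sup>2 * (norm \<xi>)\<^sup>2) \<partial>lborel)
     \<longlonglongrightarrow> (\<integral>x. (norm (h x))\<^sup>2 \<partial>lborel)"
    by (simp only: tendsto_of_real_iff)
  have "ennreal (\<integral>\<xi>. (norm (fourier h \<xi>))\<^sup>2 * exp (- pi * (s n)\<^sup>2 * (norm \<xi>)\<^sup>2) \<partial>lborel)
     \<le> (\<integral>\<^sup>+\<xi>. ennreal ((norm (fourier h \<xi>))\<^sup>2) \<partial>lborel)" for n
  proof -
    have "ennreal (\<integral>\<xi>. (norm (fourier h \<xi>))\<^sup>2 * exp (- pi * (s n)\<^sup>2 * (norm \<xi>)\<^sup>2) \<partial>lborel)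
      \<le> (\<integral>\<^sup>+\<xi>. ennreal ((norm (fourier h \<xi>))\<^sup>2 * exp (- pi * (s n)\<^sup>2 * (norm \<xi>)\<^sup>2)) \<partial>lborel)"
    proof -
      let ?f = "\<lambda>\<xi>. (norm (fourier h \<xi>))\<^sup>2 * exp (- pi * (s n)\<^sup>2 * (norm \<xi>)\<^sup>2)"
      have "ennreal (\<integral>\<xi>. ?f \<xi> \<partial>lborel) \<le> ennreal (norm (\<integral>\<xi>. ?f \<xi> \<partial>lborel))" by (intro ennreal_leI) simp
      also have "\<dots> \<le> (\<integral>\<^sup>+\<xi>. ennreal (norm (?f \<xi>)) \<partial>lborel)" by (rule norm_integral_le_nn_integral)
      finally show ?thesis by simp
    qed
    also have "\<dots> \<le> (\<integral>\<^sup>+\<xi>. ennreal ((norm (fourier h \<xi>))\<^sup>2) \<partial>lborel)"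
      by (intro nn_integral_mono ennreal_leI mult_right_le_one_le) auto
    finally show ?thesis .
  qed
  then have "ennreal (\<integral>x. (norm (h x))\<^sup>2 \<partial>lborel) \<le> (\<integral>\<^sup>+\<xi>. ennreal ((norm (fourier h \<xi>))\<^sup>2) \<partial>lborel)"
    by (intro LIMSEQ_le_const2[OF tendsto_ennrealI[OF lim]]) blast
  moreover have "integrable lborel (\<lambda>x. (norm (h x))\<^sup>2)"
  proof (rule Bochner_Integration.integrable_bound[of _ "\<lambda>x. M * norm (h x)"])
    show "integrable lborel (\<lambda>x. M * norm (h x))" using hi by simp
    show "AE x in lborel. norm ((norm (h x))\<^sup>2) \<le> norm (M * norm (h x))"
      using hM M by (auto simp: power2_eq_square abs_mult intro!: mult_right_mono)
  qed auto
  ultimately show ?thesis by (simp add: nn_integral_eq_integral)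
qed

text \<open>Multiplying by a Gaussian convolves the transform with an explicit Gaussian, of which the supremum and the
  \<open>L\<^sup>1\<close> norm are known. This is how large \<open>z\<close> are treated, where bounds by integration by parts are too weak.\<close>

lemma fourier_mult_gauss_factor:
  fixes h :: "'a::euclidean_space \<Rightarrow> complex"
  assumes h: "integrable lborel h" and z: "0 < Re z"
  shows "fourier (\<lambda>y. h y * gauss_factor (z, 0) y) \<xi>
    = (\<integral>\<eta>. fourier h (\<xi> + \<eta>) * (gauss_factor (inverse z, 0) \<eta> / csqrt z ^ DIM('a)) \<partial>lborel)"
proof -
  have iz: "0 < Re (inverse z)" using z by (simp add: divide_pos_pos sum_power2_gt_zero_iff)
  let ?\<phi> = "\<lambda>\<eta>. gauss_factor (inverse z, 0) \<eta> / csqrt z ^ DIM('a) :: complex"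
  let ?v = "\<lambda>y. h y * cis (2 * pi * (y \<bullet> (- \<xi>)))"
  have nz: "z \<noteq> 0" "z \<notin> \<real>\<^sub>\<le>\<^sub>0" using z by (auto simp: complex_nonpos_Reals_iff)
  have \<phi>i: "integrable lborel ?\<phi>" using gauss_factor_integrable[OF iz] by (rule integrable_divide_zero)
  have vi: "integrable lborel ?v" by (rule integrable_mult_cis[OF h]) simp
  have F\<phi>: "fourier ?\<phi> y = gauss_factor (z, 0) y" for y :: 'a
  proof -
    have "fourier ?\<phi> y = fourier (\<lambda>\<eta>. inverse (csqrt z ^ DIM('a)) * gauss_factor (inverse z, 0) \<eta>) y"
      by (simp add: divide_inverse mult.commute)
    also have "\<dots> = inverse (csqrt z ^ DIM('a)) * (gauss_factor (inverse (inverse z), 0) y / csqrt (inverse z) ^ DIM('a))"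
      unfolding fourier_cmult fourier_gauss_factor[OF iz] ..
    also have "\<dots> = gauss_factor (z, 0) y"
      unfolding csqrt_inverse[OF nz(2)] using nz(1) by (simp add: power_inverse)
    finally show ?thesis .
  qed
  have "fourier (\<lambda>y. h y * gauss_factor (z, 0) y) \<xi> = (\<integral>y. ?v y * fourier ?\<phi> y \<partial>lborel)"
    unfolding F\<phi> fourier_def by (simp add: mult_ac)
  also have "\<dots> = (\<integral>\<eta>. fourier ?v \<eta> * ?\<phi> \<eta> \<partial>lborel)"
    by (rule fourier_multiplication[OF vi \<phi>i, symmetric])
  also have "\<dots> = (\<integral>\<eta>. fourier h (\<xi> + \<eta>) * ?\<phi> \<eta> \<partial>lborel)"
    unfolding fourier_modulate by (simp add: add.commute)
  finally show ?thesis .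
qed

lemma fourier_mult_gauss_factor_bounds:
  fixes h :: "'a::euclidean_space \<Rightarrow> complex"
  assumes h: "integrable lborel h" and z: "0 < Re z"
    and D: "(\<integral>\<^sup>+\<xi>. ennreal (norm (fourier h \<xi>)) \<partial>lborel) \<le> ennreal D" "0 \<le> D"
  shows "norm (fourier (\<lambda>y. h y * gauss_factor (z, 0) y) \<xi>) \<le> norm z powr - (real DIM('a) / 2) * D"
    "(\<integral>\<^sup>+\<xi>. ennreal (norm (fourier (\<lambda>y. h y * gauss_factor (z, 0) y) \<xi>)) \<partial>lborel)
      \<le> ennreal ((norm z / Re z) powr (real DIM('a) / 2) * D)"
proof -
  have hm [measurable]: "h \<in> borel_measurable borel" using h by auto
  note [measurable] = fourier_measurable[OF hm]
  have z0: "z \<noteq> 0" "0 < norm z" using z by auto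
  have iz: "0 < Re (inverse z)" using z by (simp add: divide_pos_pos sum_power2_gt_zero_iff)
  let ?r = "norm z powr - (real DIM('a) / 2)"
  let ?\<phi> = "\<lambda>\<eta>::'a. gauss_factor (inverse z, 0) \<eta> / csqrt z ^ DIM('a)"
  have r: "1 / norm (csqrt z ^ DIM('a)) = ?r"
    using z0 by (simp add: norm_power powr_half_sqrt[symmetric] powr_realpow[symmetric] powr_powr powr_minus_divide)
  have n\<phi>: "norm (?\<phi> \<eta>) = ?r * exp (- (pi * Re (inverse z)) * (norm \<eta>)\<^sup>2)" for \<eta>
    unfolding norm_divide norm_gauss_factor0 r[symmetric] by simp
  have n\<phi>1: "norm (?\<phi> \<eta>) \<le> ?r" for \<eta>
  proof -
    have "0 \<le> pi * Re (inverse z) * (norm \<eta>)\<^sup>2"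
      by (intro mult_nonneg_nonneg zero_le_power2 pi_ge_zero less_imp_le[OF iz])
    then have "exp (- (pi * Re (inverse z)) * (norm \<eta>)\<^sup>2) \<le> 1"
      by (simp only: exp_le_one_iff mult_minus_left neg_le_0_iff_le)
    then show ?thesis unfolding n\<phi> by (rule mult_left_le) simp
  qed
  have le: "ennreal (norm (fourier (\<lambda>y. h y * gauss_factor (z, 0) y) \<xi>))
     \<le> (\<integral>\<^sup>+\<eta>. ennreal (norm (fourier h (\<xi> + \<eta>)) * norm (?\<phi> \<eta>)) \<partial>lborel)" for \<xi>
    unfolding fourier_mult_gauss_factor[OF h z] norm_mult[symmetric]
    by (rule norm_integral_le_nn_integral)
  have tr: "(\<integral>\<^sup>+\<xi>. ennreal (norm (fourier h (t + \<xi>))) \<partial>lborel) = (\<integral>\<^sup>+\<xi>. ennreal (norm (fourier h \<xi>)) \<partial>lborel)" for t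
    using nn_integral_lborel_affine[of "\<lambda>\<xi>. ennreal (norm (fourier h \<xi>))" 1 t] by simp
  have "ennreal (norm (fourier (\<lambda>y. h y * gauss_factor (z, 0) y) \<xi>)) \<le> (\<integral>\<^sup>+\<eta>. ennreal ?r * ennreal (norm (fourier h (\<xi> + \<eta>))) \<partial>lborel)"
    by (rule order_trans[OF le nn_integral_mono]) (auto simp: ennreal_mult'[symmetric] mult.commute intro!: ennreal_leI mult_left_mono n\<phi>1)
  also have "\<dots> = ennreal ?r * (\<integral>\<^sup>+\<xi>. ennreal (norm (fourier h \<xi>)) \<partial>lborel)"
    by (subst nn_integral_cmult) (auto simp: tr)
  also have "\<dots> \<le> ennreal ?r * ennreal D" by (rule mult_left_mono[OF D(1)]) simp
  also have "\<dots> = ennreal (?r * D)" using D(2) by (simp add: ennreal_mult)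
  finally show "norm (fourier (\<lambda>y. h y * gauss_factor (z, 0) y) \<xi>) \<le> ?r * D"
    using D(2) by (subst (asm) ennreal_le_iff) auto
  have \<phi>1: "(\<integral>\<^sup>+\<eta>. ennreal (norm (?\<phi> \<eta>)) \<partial>lborel) = ennreal ((norm z / Re z) powr (real DIM('a) / 2))"
  proof -
    have p: "0 < pi * Re (inverse z)" by (rule mult_pos_pos[OF pi_gt_zero iz])
    have R: "Re (inverse z) = Re z / (norm z)\<^sup>2" by (simp add: cmod_power2)
    have R0: "0 \<le> Re z / (norm z)\<^sup>2" using z by simp
    have sq: "sqrt (Re (inverse z)) powr - real DIM('a) = (Re z / (norm z)\<^sup>2) powr - (real DIM('a) / 2)"
      unfolding R powr_half_sqrt[symmetric, OF R0] powr_powr by simp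
    have "(\<integral>\<^sup>+\<eta>. ennreal (norm (?\<phi> \<eta>)) \<partial>lborel) = ennreal ?r * (\<integral>\<^sup>+\<eta>. ennreal (exp (- (pi * Re (inverse z)) * (norm \<eta>)\<^sup>2)) \<partial>(lborel :: 'a measure))"
      unfolding n\<phi> by (subst nn_integral_cmult[symmetric]) (auto simp: ennreal_mult')
    also have "\<dots> = ennreal ?r * ennreal (sqrt (Re (inverse z)) powr - real DIM('a))"
      unfolding nn_integral_gaussian_scaled[OF p] by simp
    also have "\<dots> = ennreal (norm z powr - (real DIM('a) / 2) * (Re z / (norm z)\<^sup>2) powr - (real DIM('a) / 2))"
      unfolding sq by (simp add: ennreal_mult')
    also have "norm z powr - (real DIM('a) / 2) * (Re z / (norm z)\<^sup>2) powr - (real DIM('a) / 2)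
      = (norm z * (Re z / (norm z)\<^sup>2)) powr - (real DIM('a) / 2)" by (simp only: powr_mult)
    also have "norm z * (Re z / (norm z)\<^sup>2) = inverse (norm z / Re z)"
      using z0 z by (simp add: power2_eq_square)
    also have "inverse (norm z / Re z) powr - (real DIM('a) / 2) = (norm z / Re z) powr (real DIM('a) / 2)"
      using z0 z by (simp add: powr_minus inverse_powr[symmetric] powr_divide)
    finally show ?thesis .
  qed
  have "(\<integral>\<^sup>+\<xi>. ennreal (norm (fourier (\<lambda>y. h y * gauss_factor (z, 0) y) \<xi>)) \<partial>lborel)
    \<le> (\<integral>\<^sup>+\<xi>. (\<integral>\<^sup>+\<eta>. ennreal (norm (fourier h (\<xi> + \<eta>)) * norm (?\<phi> \<eta>)) \<partial>lborel) \<partial>lborel)"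
    by (rule nn_integral_mono) (rule le)
  also have "\<dots> = (\<integral>\<^sup>+\<eta>. (\<integral>\<^sup>+\<xi>. ennreal (norm (fourier h (\<xi> + \<eta>)) * norm (?\<phi> \<eta>)) \<partial>lborel) \<partial>lborel)"
    by (rule lborel_pair.Fubini') measurable
  also have "\<dots> = (\<integral>\<^sup>+\<eta>. (\<integral>\<^sup>+\<xi>. ennreal (norm (fourier h \<xi>)) \<partial>lborel) * ennreal (norm (?\<phi> \<eta>)) \<partial>lborel)"
  proof (rule nn_integral_cong)
    fix \<eta> :: 'a
    have "(\<integral>\<^sup>+\<xi>. ennreal (norm (fourier h (\<xi> + \<eta>)) * norm (?\<phi> \<eta>)) \<partial>lborel)
      = (\<integral>\<^sup>+\<xi>. ennreal (norm (fourier h (\<eta> + \<xi>))) \<partial>lborel) * ennreal (norm (?\<phi> \<eta>))"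
      by (subst nn_integral_multc[symmetric]) (auto simp: ennreal_mult' add.commute)
    then show "(\<integral>\<^sup>+\<xi>. ennreal (norm (fourier h (\<xi> + \<eta>)) * norm (?\<phi> \<eta>)) \<partial>lborel)
      = (\<integral>\<^sup>+\<xi>. ennreal (norm (fourier h \<xi>)) \<partial>lborel) * ennreal (norm (?\<phi> \<eta>))" unfolding tr .
  qed
  also have "\<dots> = (\<integral>\<^sup>+\<xi>. ennreal (norm (fourier h \<xi>)) \<partial>lborel) * (\<integral>\<^sup>+\<eta>. ennreal (norm (?\<phi> \<eta>)) \<partial>lborel)"
    by (rule nn_integral_cmult) measurable
  also have "\<dots> \<le> ennreal D * ennreal ((norm z / Re z) powr (real DIM('a) / 2))"
    unfolding \<phi>1 by (rule mult_right_mono[OF D(1)]) simp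
  also have "\<dots> = ennreal ((norm z / Re z) powr (real DIM('a) / 2) * D)"
    using D(2) by (simp add: ennreal_mult mult.commute)
  finally show "(\<integral>\<^sup>+\<xi>. ennreal (norm (fourier (\<lambda>y. h y * gauss_factor (z, 0) y) \<xi>)) \<partial>lborel)
      \<le> ennreal ((norm z / Re z) powr (real DIM('a) / 2) * D)" .
qed

section \<open>Windowed Gaussians\<close>

text \<open>With \<open>s = (z, Re z x)\<close> this is, up to a factor \<open>exp (- \<pi> Re z |x|\<^sup>2)\<close>, the \<open>\<F>L\<^sup>p\<close> norm of a Gaussian
  seen through the window at \<open>x\<close>.\<close>

definition window_norm ::
  "ennreal \<Rightarrow> ('a::euclidean_space \<Rightarrow> complex) \<Rightarrow> complex \<times> 'a \<Rightarrow> ennreal" where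
  "window_norm p g s = Lp_norm p (\<lambda>\<xi>. ennreal (norm (fourier (\<lambda>w. g w * gauss_factor s w) \<xi>)))"

text \<open>Translating the window to the origin turns the Gaussian factor into one with a linear term, of which the
  imaginary part only shifts the frequency, so that it is invisible to the \<open>L\<^sup>p\<close> norm.\<close>

lemma FL_norm_gauss_factor_window:
  fixes g :: "'a::euclidean_space \<Rightarrow> complex"
  assumes g [measurable]: "g \<in> borel_measurable borel" and p: "1 \<le> p"
  shows "FL_norm p (\<lambda>y. gauss_factor (z, 0) y * g (y - x))
    = ennreal (exp (- (pi * Re z) * (norm x)\<^sup>2)) * window_norm p g (z, Re z *\<^sub>R x)"
proof -
  let ?h = "\<lambda>w. g w * gauss_factor (z, Re z *\<^sub>R x) w"
  let ?k = "gauss_factor (z, 0) x"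
  have F: "fourier (\<lambda>y. gauss_factor (z, 0) y * g (y - x)) \<xi>
    = ?k * cis (- 2 * pi * (x \<bullet> \<xi>)) * fourier ?h (Im z *\<^sub>R x + 1 *\<^sub>R \<xi>)" for \<xi>
  proof -
    have "fourier (\<lambda>y. gauss_factor (z, 0) y * g (y - x)) \<xi>
      = (\<integral>w. gauss_factor (z, 0) (x + 1 *\<^sub>R w) * g ((x + 1 *\<^sub>R w) - x) * cis (- 2 * pi * ((x + 1 *\<^sub>R w) \<bullet> \<xi>)) \<partial>lborel)"
      unfolding fourier_def by (subst lborel_integral_affine[where c = 1 and t = x]) auto
    also have "\<dots> = (\<integral>w. (?k * cis (- 2 * pi * (x \<bullet> \<xi>))) * (?h w * cis (- 2 * pi * (w \<bullet> (Im z *\<^sub>R x + 1 *\<^sub>R \<xi>)))) \<partial>lborel)"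
    proof (intro Bochner_Integration.integral_cong refl)
      fix w :: 'a
      have n: "(norm (x + w))\<^sup>2 = (norm x)\<^sup>2 + (norm w)\<^sup>2 + 2 * (x \<bullet> w)"
        by (simp add: power2_norm_eq_inner inner_add_left inner_add_right inner_commute)
      have "gauss_factor (z, 0) (x + w) * cis (- 2 * pi * ((x + w) \<bullet> \<xi>))
        = ?k * cis (- 2 * pi * (x \<bullet> \<xi>)) * (gauss_factor (z, Re z *\<^sub>R x) w * cis (- 2 * pi * (w \<bullet> (Im z *\<^sub>R x + \<xi>))))"
        unfolding gauss_factor_def cis_conv_exp exp_add[symmetric] n fst_conv snd_conv
        by (rule arg_cong[where f = exp])
          (simp add: complex_eq_iff inner_add_left inner_add_right inner_commute algebra_simps)
      then show "gauss_factor (z, 0) (x + 1 *\<^sub>R w) * g ((x + 1 *\<^sub>R w) - x) * cis (- 2 * pi * ((x + 1 *\<^sub>R w) \<bullet> \<xi>))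
        = (?k * cis (- 2 * pi * (x \<bullet> \<xi>))) * (?h w * cis (- 2 * pi * (w \<bullet> (Im z *\<^sub>R x + 1 *\<^sub>R \<xi>))))"
        unfolding scaleR_one add_diff_cancel_left' by (simp only: mult_ac)
    qed
    finally show ?thesis unfolding integral_mult_right_zero fourier_def .
  qed
  have [measurable]: "fourier ?h \<in> borel_measurable borel" by (intro fourier_measurable) measurable
  let ?e = "exp (- (pi * Re z) * (norm x)\<^sup>2)"
  have "FL_norm p (\<lambda>y. gauss_factor (z, 0) y * g (y - x))
    = Lp_norm p (\<lambda>\<xi>. ennreal ?e * ennreal (norm (fourier ?h (Im z *\<^sub>R x + 1 *\<^sub>R \<xi>))))"
    unfolding FL_norm_def F norm_mult norm_cis mult_1_right norm_gauss_factor0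
    by (simp only: ennreal_mult'[OF norm_ge_zero] mult.commute ennreal_mult'[OF exp_ge_zero])
  also have "\<dots> = ennreal ?e * Lp_norm p (\<lambda>\<xi>. ennreal (norm (fourier ?h (Im z *\<^sub>R x + 1 *\<^sub>R \<xi>))))"
    by (rule Lp_norm_cmult[OF _ _ p]) auto
  also have "Lp_norm p (\<lambda>\<xi>. ennreal (norm (fourier ?h (Im z *\<^sub>R x + 1 *\<^sub>R \<xi>)))) = window_norm p g (z, Re z *\<^sub>R x)"
    unfolding window_norm_def
    by (subst Lp_norm_affine[where F = "\<lambda>\<xi>. ennreal (norm (fourier ?h \<xi>))", OF _ _ p]) auto
  finally show ?thesis .
qed

definition half_disc :: "complex set" where
  "half_disc = {z. 0 \<le> Re z \<and> norm z \<le> 1}"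

lemma window_norm_bound:
  fixes g :: "'a::euclidean_space \<Rightarrow> complex"
  assumes e: "0 < e" and g: "g \<in> gauss_smooth e" and p: "1 \<le> p"
  shows "\<exists>C>0. \<exists>c>0. \<forall>z\<in>half_disc. \<forall>v. window_norm p g (z, v) \<le> ennreal (C * exp (c * (norm v)\<^sup>2))"
proof -
  note [measurable] = gauss_smooth_measurable[OF g]
  obtain C where C: "0 \<le> C" and "\<forall>z v \<xi>. 0 \<le> Re z \<longrightarrow> norm z \<le> 1 \<longrightarrow>
    norm (fourier (\<lambda>w. g w * gauss_factor (z, v) w) \<xi>) \<le> C * exp ((4 * pi\<^sup>2 / e + 1) * (norm v)\<^sup>2) * decay_weight \<xi>"
    using fourier_window_decay[OF e g] by (elim exE conjE) (rule that)
  note D = this(2)[rule_format]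
  let ?c = "4 * pi\<^sup>2 / e + 1"
  let ?W = "Lp_norm p (\<lambda>\<xi>. ennreal (decay_weight (\<xi> :: 'a)))"
  have W: "?W < \<infinity>"
    by (rule Lp_norm_finite[OF p _ decay_weight_integrable, where M = 1]) (auto simp: decay_weight_bounds)
  have "window_norm p g (z, v) \<le> ennreal ((C + 1) * (enn2real ?W + 1) * exp (?c * (norm v)\<^sup>2))"
    if z: "z \<in> half_disc" for z and v :: 'a
  proof -
    let ?k = "(C + 1) * exp (?c * (norm v)\<^sup>2)"
    have k: "0 < ?k" using C by (intro mult_pos_pos) auto
    have "window_norm p g (z, v) \<le> Lp_norm p (\<lambda>\<xi>::'a. ennreal ?k * ennreal (decay_weight \<xi>))"
      unfolding window_norm_def
    proof (rule Lp_norm_mono[OF p])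
      have [measurable]: "fourier (\<lambda>w. g w * gauss_factor (z, v) w) \<in> borel_measurable borel"
        by (intro fourier_measurable) measurable
      show "(\<lambda>\<xi>. ennreal (norm (fourier (\<lambda>w. g w * gauss_factor (z, v) w) \<xi>))) \<in> borel_measurable borel" by measurable
      fix \<xi>
      have "norm (fourier (\<lambda>w. g w * gauss_factor (z, v) w) \<xi>) \<le> C * exp (?c * (norm v)\<^sup>2) * decay_weight \<xi>"
        by (rule D) (use z in \<open>auto simp: half_disc_def\<close>)
      also have "\<dots> \<le> ?k * decay_weight \<xi>" by (intro mult_right_mono decay_weight_bounds) auto
      finally show "ennreal (norm (fourier (\<lambda>w. g w * gauss_factor (z, v) w) \<xi>)) \<le> ennreal ?k * ennreal (decay_weight \<xi>)"
        using k by (simp only: ennreal_mult'[OF less_imp_le[OF k], symmetric] ennreal_leI)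
    qed
    also have "\<dots> = ennreal ?k * ?W" by (rule Lp_norm_cmult[OF k _ p]) measurable
    also have "\<dots> = ennreal (?k * enn2real ?W)" using k W by (simp add: ennreal_mult')
    also have "\<dots> \<le> ennreal (?k * (enn2real ?W + 1))" using k by (intro ennreal_leI mult_left_mono) auto
    also have "?k * (enn2real ?W + 1) = (C + 1) * (enn2real ?W + 1) * exp (?c * (norm v)\<^sup>2)" by (simp only: mult_ac)
    finally show ?thesis .
  qed
  moreover have "0 < (C + 1) * (enn2real ?W + 1)" using C by (intro mult_pos_pos) (auto intro: add_nonneg_pos)
  moreover have "0 < ?c" using e by (intro add_nonneg_pos) auto
  ultimately show ?thesis by blast
qed

lemma window_norm_finite:
  assumes "0 < e" "g \<in> gauss_smooth e" "1 \<le> p" "z \<in> half_disc"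
  shows "window_norm p g (z, v) < \<infinity>"
proof -
  from window_norm_bound[OF assms(1-3)] obtain C c where
    "\<forall>z\<in>half_disc. \<forall>v. window_norm p g (z, v) \<le> ennreal (C * exp (c * (norm v)\<^sup>2))" by blast
  from this[rule_format, OF assms(4), of v] show ?thesis by (auto intro: le_less_trans)
qed

text \<open>The transforms converge uniformly, because the windowed factors converge in \<open>L\<^sup>1\<close>, and they are dominated by a
  multiple of \<open>decay_weight\<close>.\<close>

lemma window_norm_continuous:
  fixes g :: "'a::euclidean_space \<Rightarrow> complex"
  assumes e: "0 < e" and g: "g \<in> gauss_smooth e" and p: "1 \<le> p"
  shows "continuous_on (half_disc \<times> UNIV) (\<lambda>s. enn2real (window_norm p g s))"
  unfolding continuous_on_sequentially
proof (intro allI ballI impI, elim conjE)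
  fix S :: "nat \<Rightarrow> complex \<times> 'a" and s0
  assume s0: "s0 \<in> half_disc \<times> UNIV" and S: "\<forall>n. S n \<in> half_disc \<times> UNIV" and lim: "S \<longlonglongrightarrow> s0"
  note [measurable] = gauss_smooth_measurable[OF g]
  have gi: "integrable lborel g" by (rule gauss_smooth_integrable[OF g e])
  obtain R where R: "0 < R" "\<And>n. norm (S n) \<le> R"
    using convergent_imp_Bseq[of S] lim unfolding convergent_def Bseq_def by blast
  have R0: "norm s0 \<le> R" by (rule LIMSEQ_le_const2[OF tendsto_norm[OF lim]]) (use R in auto)
  have Rv: "norm (snd s) \<le> R" if "norm s \<le> R" for s :: "complex \<times> 'a"
    using norm_snd_le[of "snd s" "fst s"] that by simp
  let ?F = "\<lambda>s. fourier (\<lambda>w. g w * gauss_factor s w)"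
  let ?c = "4 * pi\<^sup>2 / e + 1"
  obtain C where C: "0 \<le> C" and "\<forall>z v \<xi>. 0 \<le> Re z \<longrightarrow> norm z \<le> 1 \<longrightarrow>
    norm (fourier (\<lambda>w. g w * gauss_factor (z, v) w) \<xi>) \<le> C * exp (?c * (norm v)\<^sup>2) * decay_weight \<xi>"
    using fourier_window_decay[OF e g] by (elim exE conjE) (rule that)
  note D = this(2)[rule_format]
  let ?K = "C * exp (?c * R\<^sup>2)"
  have c0: "0 \<le> ?c" using e by simp
  have dom: "norm (?F s \<xi>) \<le> ?K * decay_weight \<xi>" if s: "s \<in> half_disc \<times> UNIV" "norm s \<le> R" for s \<xi>
  proof -
    have "norm (?F s \<xi>) \<le> C * exp (?c * (norm (snd s))\<^sup>2) * decay_weight \<xi>"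
      using D[of "fst s" "snd s" \<xi>] s(1) by (auto simp: half_disc_def)
    also have "\<dots> \<le> ?K * decay_weight \<xi>"
      using C Rv[OF s(2)] c0 by (intro mult_right_mono mult_left_mono decay_weight_bounds iffD2[OF exp_le_cancel_iff] power_mono) auto
    finally show ?thesis .
  qed
  have [measurable]: "?F s \<in> borel_measurable borel" for s by (intro fourier_measurable) measurable
  \<comment> \<open>uniform convergence in \<open>\<xi>\<close> follows from convergence in \<open>L\<^sup>1\<close> of the windowed factors\<close>
  let ?d = "\<lambda>n. \<integral>w. norm (g w * gauss_factor (S n) w - g w * gauss_factor s0 w) \<partial>lborel"
  let ?w = "\<lambda>w. norm (g w) * (exp (4 * pi\<^sup>2 / e * R\<^sup>2) * exp (e / 4 * (norm w)\<^sup>2))"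
  obtain M where M: "0 \<le> M" "\<And>x. norm (g x) \<le> M * exp (- e * (norm x)\<^sup>2)"
    using gauss_smooth_bound[OF g] by blast
  have wi: "integrable lborel ?w"
  proof (rule Bochner_Integration.integrable_bound[of _ "\<lambda>w. M * exp (4 * pi\<^sup>2 / e * R\<^sup>2) * exp (- (e / 2) * (norm w)\<^sup>2)"])
    have e2: "0 < e / 2" using e by simp
    show "integrable lborel (\<lambda>w::'a. M * exp (4 * pi\<^sup>2 / e * R\<^sup>2) * exp (- (e / 2) * (norm w)\<^sup>2))"
      by (rule integrable_mult_right) (rule gaussian_integrable[OF e2])
    show "AE w in lborel. norm (?w w) \<le> norm (M * exp (4 * pi\<^sup>2 / e * R\<^sup>2) * exp (- (e / 2) * (norm w)\<^sup>2))"
    proof (rule AE_I2)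
      fix w :: 'a
      have "?w w \<le> (M * exp (- e * (norm w)\<^sup>2)) * (exp (4 * pi\<^sup>2 / e * R\<^sup>2) * exp (e / 4 * (norm w)\<^sup>2))"
        by (intro mult_right_mono M) auto
      also have "\<dots> = M * exp (4 * pi\<^sup>2 / e * R\<^sup>2) * (exp (- e * (norm w)\<^sup>2) * exp (e / 4 * (norm w)\<^sup>2))"
        by (simp only: mult_ac)
      also have "\<dots> \<le> M * exp (4 * pi\<^sup>2 / e * R\<^sup>2) * exp (- (e / 2) * (norm w)\<^sup>2)"
        unfolding exp_add[symmetric] using M(1) e by (intro mult_left_mono) (auto simp: algebra_simps)
      finally show "norm (?w w) \<le> norm (M * exp (4 * pi\<^sup>2 / e * R\<^sup>2) * exp (- (e / 2) * (norm w)\<^sup>2))"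
        using M(1) by simp
    qed
  qed measurable
  have gf: "norm (g w * gauss_factor s w) \<le> ?w w" if s: "s \<in> half_disc \<times> UNIV" "norm s \<le> R" for s w
  proof -
    have "norm (gauss_factor s w) \<le> exp (4 * pi\<^sup>2 / e * (norm (snd s))\<^sup>2) * exp (e / 4 * (norm w)\<^sup>2)"
      by (rule norm_gauss_factor_le[OF e]) (use s in \<open>auto simp: half_disc_def\<close>)
    also have "\<dots> \<le> exp (4 * pi\<^sup>2 / e * R\<^sup>2) * exp (e / 4 * (norm w)\<^sup>2)"
      using Rv[OF s(2)] e by (intro mult_right_mono iffD2[OF exp_le_cancel_iff] mult_left_mono power_mono) auto
    finally show ?thesis unfolding norm_mult by (intro mult_left_mono) auto
  qed
  have gfi: "integrable lborel (\<lambda>w. g w * gauss_factor s w)" if s: "s \<in> half_disc \<times> UNIV" "norm s \<le> R" for s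
    by (rule Bochner_Integration.integrable_bound[OF wi]) (use gf[OF s] in \<open>auto simp: abs_mult\<close>)
  have "?d \<longlonglongrightarrow> (\<integral>w. 0 \<partial>(lborel :: 'a measure))"
  proof (rule integral_dominated_convergence[where w = "\<lambda>w. 2 * ?w w"])
    show "integrable lborel (\<lambda>w. 2 * ?w w)" by (rule integrable_mult_right[OF wi])
    show "AE w in lborel. (\<lambda>n. norm (g w * gauss_factor (S n) w - g w * gauss_factor s0 w)) \<longlonglongrightarrow> 0"
    proof (rule AE_I2)
      fix w
      have "(\<lambda>n. g w * gauss_factor (S n) w) \<longlonglongrightarrow> g w * gauss_factor s0 w"
        unfolding gauss_factor_def by (intro tendsto_intros lim)
      then show "(\<lambda>n. norm (g w * gauss_factor (S n) w - g w * gauss_factor s0 w)) \<longlonglongrightarrow> 0"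
        by (intro tendsto_norm_zero LIM_zero)
    qed
    show "AE w in lborel. norm (norm (g w * gauss_factor (S n) w - g w * gauss_factor s0 w)) \<le> 2 * ?w w" for n
    proof (rule AE_I2)
      fix w
      have "norm (g w * gauss_factor (S n) w - g w * gauss_factor s0 w) \<le> ?w w + ?w w"
        using S s0 R R0 by (intro order_trans[OF norm_triangle_ineq4] add_mono gf) auto
      then show "norm (norm (g w * gauss_factor (S n) w - g w * gauss_factor s0 w)) \<le> 2 * ?w w"
        by (simp only: real_norm_def abs_norm_cancel mult_2)
    qed
  qed measurable
  then have d0: "?d \<longlonglongrightarrow> 0" by simp
  show "((\<lambda>s. enn2real (window_norm p g s)) \<circ> S) \<longlonglongrightarrow> enn2real (window_norm p g s0)"
    unfolding o_def window_norm_def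
  proof (rule Lp_norm_tendsto[OF p])
    show "integrable lborel (\<lambda>\<xi>::'a. ?K * decay_weight \<xi>)" by (rule integrable_mult_right[OF decay_weight_integrable])
    show "?K * decay_weight \<xi> \<le> ?K" for \<xi> :: 'a using C by (intro mult_left_le decay_weight_bounds) auto
    show "norm (?F (S n) \<xi>) \<le> ?K * decay_weight \<xi>" for n \<xi> using S R by (intro dom) auto
    show "norm (?F s0 \<xi>) \<le> ?K * decay_weight \<xi>" for \<xi> using s0 R0 by (intro dom) auto
    fix \<epsilon> :: real assume "0 < \<epsilon>"
    then have "\<forall>\<^sub>F n in sequentially. ?d n < \<epsilon>" by (rule order_tendstoD(2)[OF d0])
    then show "\<forall>\<^sub>F n in sequentially. \<forall>\<xi>. \<bar>norm (?F (S n) \<xi>) - norm (?F s0 \<xi>)\<bar> \<le> \<epsilon>"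
    proof eventually_elim
      case (elim n)
      show ?case
      proof
        fix \<xi>
        have i: "integrable lborel (\<lambda>w. g w * gauss_factor (S n) w)" "integrable lborel (\<lambda>w. g w * gauss_factor s0 w)"
          using S s0 R R0 by (auto intro!: gfi)
        have "\<bar>norm (?F (S n) \<xi>) - norm (?F s0 \<xi>)\<bar> \<le> norm (?F (S n) \<xi> - ?F s0 \<xi>)" by (rule norm_triangle_ineq3)
        also have "?F (S n) \<xi> - ?F s0 \<xi> = fourier (\<lambda>w. g w * gauss_factor (S n) w - g w * gauss_factor s0 w) \<xi>"
          by (rule fourier_linear(2)[OF i, symmetric])
        also have "norm \<dots> \<le> ?d n" by (rule norm_fourier_le[OF Bochner_Integration.integrable_diff[OF i]])
        finally show "\<bar>norm (?F (S n) \<xi>) - norm (?F s0 \<xi>)\<bar> \<le> \<epsilon>" using elim by simp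
      qed
    qed
  qed auto
qed

lemma window_norm_measurable:
  fixes g :: "'a::euclidean_space \<Rightarrow> complex"
  assumes e: "0 < e" and g: "g \<in> gauss_smooth e" and p: "1 \<le> p" and z: "z \<in> half_disc"
  shows "(\<lambda>v. window_norm p g (z, v)) \<in> borel_measurable borel"
proof -
  have "(\<lambda>v. enn2real (window_norm p g (z, v))) \<in> borel_measurable borel"
  proof (rule borel_measurable_continuous_onI, rule continuous_on_compose2[OF window_norm_continuous[OF e g p]])
    show "continuous_on UNIV (\<lambda>v. (z, v))" by (intro continuous_intros)
  qed (use z in auto)
  then have "(\<lambda>v. ennreal (enn2real (window_norm p g (z, v)))) \<in> borel_measurable borel" by measurable
  moreover have "window_norm p g (z, v) < top" for v using window_norm_finite[OF e g p z, of v] by simp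
  ultimately show ?thesis by (simp only: ennreal_enn2real)
qed

lemma gauss_factor_00: "gauss_factor (0, 0) w = 1"
  by (simp add: gauss_factor_def)

lemma window_norm_pos:
  fixes g :: "'a::euclidean_space \<Rightarrow> complex"
  assumes e: "0 < e" and g: "g \<in> gauss_smooth e" and p: "1 \<le> p"
    and nz: "(\<integral>\<^sup>+x. ennreal ((norm (g x))\<^sup>2) \<partial>lborel) \<noteq> 0"
  shows "0 < window_norm p g (0, 0)"
  unfolding window_norm_def gauss_factor_00 mult_1_right
proof (rule Lp_norm_pos[OF p])
  have [measurable]: "fourier g \<in> borel_measurable borel" by (intro fourier_measurable gauss_smooth_measurable[OF g])
  show "(\<lambda>\<xi>. ennreal (norm (fourier (\<lambda>w. g w) \<xi>))) \<in> borel_measurable borel" by measurable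
  show "\<not> (AE \<xi> in lborel. ennreal (norm (fourier (\<lambda>w. g w) \<xi>)) = 0)"
  proof
    assume "AE \<xi> in lborel. ennreal (norm (fourier (\<lambda>w. g w) \<xi>)) = 0"
    then have "AE \<xi> in lborel. ennreal ((norm (fourier g \<xi>))\<^sup>2) = 0" by eventually_elim simp
    then have "(\<integral>\<^sup>+\<xi>. ennreal ((norm (fourier g \<xi>))\<^sup>2) \<partial>lborel) = 0" by (subst nn_integral_0_iff_AE) auto
    moreover obtain M where "\<forall>x. norm (g x) \<le> M" using gauss_smooth_bounded[OF g e] by blast
    ultimately show False
      using plancherel_le[OF gauss_smooth_integrable[OF g e] gauss_smooth_isCont[OF g], of M] nz by simp
  qed
qed

text \<open>In the variable \<open>X = sqrt (Re z) x\<close> the norm of the windowed function tends to \<open>exp (- \<pi> |X|\<^sup>2)\<close> times the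
  \<open>L\<^sup>p\<close> norm of the transform of \<open>g\<close>, uniformly and with a Gaussian majorant; the power of \<open>Re z\<close> is the
  Jacobian of this substitution.\<close>

lemma amalgam_norm_gaussian_asymp:
  fixes g :: "'a::euclidean_space \<Rightarrow> complex"
  assumes e: "0 < e" and g: "g \<in> gauss_smooth e" and p: "1 \<le> p" and q: "1 \<le> q"
    and nz: "(\<integral>\<^sup>+x. ennreal ((norm (g x))\<^sup>2) \<partial>lborel) \<noteq> 0"
  shows "\<exists>K>0. \<exists>\<delta>>0. (\<forall>z. 0 < Re z \<longrightarrow> norm z < \<delta> \<longrightarrow> amalgam_norm g p q (gauss_factor (z, 0)) < \<infinity>) \<and>
    (\<forall>Z. (\<forall>k. 0 < Re (Z k) \<and> norm (Z k) < \<delta>) \<longrightarrow> Z \<longlonglongrightarrow> 0 \<longrightarrow>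
      (\<lambda>k. enn2real (amalgam_norm g p q (gauss_factor (Z k, 0))) * Re (Z k) powr (real DIM('a) / 2 * enn2real (1 / q))) \<longlonglongrightarrow> K)"
proof -
  obtain C c where C: "0 < C" "0 < c" and bd: "\<And>z v. z \<in> half_disc \<Longrightarrow> window_norm p g (z, v) \<le> ennreal (C * exp (c * (norm v)\<^sup>2))"
    using window_norm_bound[OF e g p] by metis
  let ?N = "\<lambda>s. enn2real (window_norm p g s)"
  have N: "window_norm p g (z, v) = ennreal (?N (z, v))" if "z \<in> half_disc" for z v
    using window_norm_finite[OF e g p that, of v] by simp
  have Nb: "?N (z, v) \<le> C * exp (c * (norm v)\<^sup>2)" if "z \<in> half_disc" for z v
  proof -
    have "ennreal (?N (z, v)) \<le> ennreal (C * exp (c * (norm v)\<^sup>2))"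
      unfolding N[OF that, symmetric] by (rule bd[OF that])
    then show ?thesis using C by (subst (asm) ennreal_le_iff) auto
  qed
  \<comment> \<open>half of the exponent of \<open>exp (- \<pi> |X|\<^sup>2)\<close> is spent on the growth \<open>exp (c Re z |X|\<^sup>2)\<close>\<close>
  define \<delta> where "\<delta> = min 1 (pi / (2 * c))"
  have \<delta>: "0 < \<delta>" "\<delta> \<le> 1" "c * \<delta> \<le> pi / 2" using C by (auto simp: \<delta>_def min_def field_simps)
  have hd: "z \<in> half_disc" "Re z < \<delta>" if "0 < Re z" "norm z < \<delta>" for z
    using that \<delta> complex_Re_le_cmod[of z] by (auto simp: half_disc_def)
  have h0: "0 \<in> half_disc" by (simp add: half_disc_def)
  define F where "F = (\<lambda>z (X::'a). exp (- pi * (norm X)\<^sup>2) * ?N (z, sqrt (Re z) *\<^sub>R X))"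
  define F0 where "F0 = (\<lambda>X::'a. exp (- pi * (norm X)\<^sup>2) * ?N (0, 0))"
  define G where "G = (\<lambda>X::'a. C * exp (- (pi / 2) * (norm X)\<^sup>2))"
  have Nm: "(\<lambda>v. ?N (z, v)) \<in> borel_measurable borel" if "z \<in> half_disc" for z
    using window_norm_measurable[OF e g p that] by measurable
  have Fm: "F z \<in> borel_measurable borel" if "0 < Re z" "norm z < \<delta>" for z
  proof -
    have "(\<lambda>X. ?N (z, sqrt (Re z) *\<^sub>R X)) \<in> borel_measurable borel"
      by (rule measurable_compose[OF _ Nm[OF hd(1)[OF that]]]) measurable
    then show ?thesis unfolding F_def by measurable
  qed
  have F0m: "F0 \<in> borel_measurable borel" unfolding F0_def by measurable
  have Gi: "integrable lborel G" unfolding G_def by (rule integrable_mult_right) (rule gaussian_integrable, simp)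
  have GC: "G X \<le> C" for X unfolding G_def using C by (intro mult_left_le) auto
  have FG: "F z X \<le> G X" if z: "0 < Re z" "norm z < \<delta>" for z X
  proof -
    have "F z X \<le> exp (- pi * (norm X)\<^sup>2) * (C * exp (c * (norm (sqrt (Re z) *\<^sub>R X))\<^sup>2))"
      unfolding F_def by (intro mult_left_mono Nb hd[OF z]) auto
    also have "(norm (sqrt (Re z) *\<^sub>R X))\<^sup>2 = Re z * (norm X)\<^sup>2" using z by (simp add: power_mult_distrib)
    also have "exp (- pi * (norm X)\<^sup>2) * (C * exp (c * (Re z * (norm X)\<^sup>2))) = C * exp (- pi * (norm X)\<^sup>2 + c * Re z * (norm X)\<^sup>2)"
      unfolding exp_add mult.assoc by (rule mult.left_commute)
    also have "\<dots> \<le> G X"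
    proof -
      have "c * Re z \<le> c * \<delta>" using C hd(2)[OF z] by (intro mult_left_mono) auto
      then have "c * Re z * (norm X)\<^sup>2 \<le> (pi / 2) * (norm X)\<^sup>2" using \<delta>(3) by (intro mult_right_mono) auto
      then show ?thesis unfolding G_def using C by (intro mult_left_mono) auto
    qed
    finally show ?thesis .
  qed
  have F0G: "F0 X \<le> G X" for X
  proof -
    have "F0 X \<le> exp (- pi * (norm X)\<^sup>2) * (C * exp (c * (norm (0::'a))\<^sup>2))"
      unfolding F0_def by (intro mult_left_mono Nb h0) auto
    also have "\<dots> \<le> G X" unfolding G_def using C by simp
    finally show ?thesis .
  qed
  have F_nonneg: "0 \<le> F z X" "0 \<le> F0 X" for z X unfolding F_def F0_def by auto
  define K where "K = enn2real (Lp_norm q (\<lambda>X. ennreal (F0 X)))"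
  have amalgam: "amalgam_norm g p q (gauss_factor (z, 0))
      = ennreal (Re z powr - (real DIM('a) / 2 * enn2real (1 / q))) * Lp_norm q (\<lambda>X. ennreal (F z X))"
    if z: "0 < Re z" "norm z < \<delta>" for z
  proof -
    have s: "0 < sqrt (Re z)" using z by simp
    have "FL_norm p (\<lambda>y. gauss_factor (z, 0) y * g (y - x)) = ennreal (F z (0 + sqrt (Re z) *\<^sub>R x))" for x
    proof -
      have "sqrt (Re z) * sqrt (Re z) = Re z" using z by simp
      moreover have "(norm (sqrt (Re z) *\<^sub>R x))\<^sup>2 = Re z * (norm x)\<^sup>2" using z by (simp add: power_mult_distrib)
      ultimately show ?thesis
        unfolding FL_norm_gauss_factor_window[OF gauss_smooth_measurable[OF g] p] F_def
        by (subst N[OF hd(1)[OF z]]) (simp add: ennreal_mult' mult.assoc)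
    qed
    then have "amalgam_norm g p q (gauss_factor (z, 0)) = Lp_norm q (\<lambda>x. ennreal (F z (0 + sqrt (Re z) *\<^sub>R x)))"
      unfolding amalgam_norm_def by (simp only:)
    also have "\<dots> = ennreal (sqrt (Re z) powr - (real DIM('a) * enn2real (1 / q))) * Lp_norm q (\<lambda>X. ennreal (F z X))"
      by (rule Lp_norm_affine[OF _ s q]) (use Fm[OF z] in measurable)
    also have "sqrt (Re z) powr - (real DIM('a) * enn2real (1 / q)) = Re z powr - (real DIM('a) / 2 * enn2real (1 / q))"
      using z by (simp add: powr_half_sqrt[symmetric] powr_powr)
    finally show ?thesis .
  qed
  have fin: "Lp_norm q (\<lambda>X. ennreal (F z X)) < \<infinity>" if z: "0 < Re z" "norm z < \<delta>" for z
    by (rule Lp_norm_finite[OF q Fm[OF z] Gi GC]) (use F_nonneg FG[OF z] in auto)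
  have "0 < K"
  proof -
    have "0 < ?N (0, 0)" 
      using window_norm_pos[OF e g p nz] window_norm_finite[OF e g p h0, of 0] by (simp add: enn2real_positive_iff)
    then have p0: "F0 X \<noteq> 0" for X unfolding F0_def by simp
    have "0 < Lp_norm q (\<lambda>X. ennreal (F0 X))"
    proof (rule Lp_norm_pos[OF q])
      show "(\<lambda>X. ennreal (F0 X)) \<in> borel_measurable borel" using F0m by measurable
      have "ennreal (F0 X) \<noteq> 0" for X using p0[of X] F_nonneg(2)[of X] by (simp add: ennreal_eq_0_iff)
      then show "\<not> (AE X in lborel. ennreal (F0 X) = 0)"
        using ae_filter_eq_bot_iff[of "lborel :: 'a measure"] by (simp add: eventually_False emeasure_lborel_UNIV)
    qed
    moreover have "Lp_norm q (\<lambda>X. ennreal (F0 X)) < \<infinity>"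
      by (rule Lp_norm_finite[OF q F0m Gi GC]) (use F_nonneg F0G in auto)
    ultimately show ?thesis unfolding K_def by (simp add: enn2real_positive_iff)
  qed
  moreover have "amalgam_norm g p q (gauss_factor (z, 0)) < \<infinity>" if z: "0 < Re z" "norm z < \<delta>" for z
    unfolding amalgam[OF z] using fin[OF z] by (simp add: ennreal_mult_less_top)
  moreover have "(\<lambda>k. enn2real (amalgam_norm g p q (gauss_factor (Z k, 0))) * Re (Z k) powr (real DIM('a) / 2 * enn2real (1 / q))) \<longlonglongrightarrow> K"
    if Z: "\<forall>k. 0 < Re (Z k) \<and> norm (Z k) < \<delta>" and Z0: "Z \<longlonglongrightarrow> 0" for Z
  proof -
    have Zk: "0 < Re (Z k)" "norm (Z k) < \<delta>" for k using Z by auto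
    have ReZ: "(\<lambda>k. Re (Z k)) \<longlonglongrightarrow> 0" using tendsto_Re[OF Z0] by simp
    have "enn2real (amalgam_norm g p q (gauss_factor (Z k, 0))) * Re (Z k) powr (real DIM('a) / 2 * enn2real (1 / q))
      = enn2real (Lp_norm q (\<lambda>X. ennreal (F (Z k) X)))" for k
      unfolding amalgam[OF Zk] using Zk(1)[of k]
      by (simp add: enn2real_mult powr_minus field_simps)
    moreover have "(\<lambda>k. enn2real (Lp_norm q (\<lambda>X. ennreal (F (Z k) X)))) \<longlonglongrightarrow> K"
      unfolding K_def
    proof (rule Lp_norm_tendsto[OF q Fm[OF Zk] F0m Gi GC])
      fix \<epsilon> :: real assume \<epsilon>: "0 < \<epsilon>"
      have "continuous_on (half_disc \<times> UNIV) ?N" by (rule window_norm_continuous[OF e g p])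
      then obtain d where d: "0 < d" and "\<forall>s\<in>half_disc \<times> UNIV. dist s (0, 0) < d \<longrightarrow> dist (?N s) (?N (0, 0)) < \<epsilon>"
        unfolding continuous_on_iff using h0 \<epsilon> by (metis (no_types, lifting) SigmaI UNIV_I)
      note dd = this(2)[rule_format]
      have "\<forall>\<^sub>F k in sequentially. norm (Z k) < d / 2"
        using tendsto_norm[OF Z0] d by (intro order_tendstoD(2)[of _ "norm (0::complex)"]) auto
      moreover have "\<forall>\<^sub>F k in sequentially. C * exp (- (pi / 2) * (d\<^sup>2 / 4 / Re (Z k))) < \<epsilon>"
      proof (rule order_tendstoD(2)[OF _ \<epsilon>])
        have "filterlim (\<lambda>k. d\<^sup>2 / 4 / Re (Z k)) at_top sequentially"
          using d Zk(1) by (intro LIM_at_top_divide[OF tendsto_const _ ReZ]) auto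
        then have "filterlim (\<lambda>k. (pi / 2) * (d\<^sup>2 / 4 / Re (Z k))) at_top sequentially"
          by (intro filterlim_tendsto_pos_mult_at_top[OF tendsto_const]) auto
        then have "filterlim (\<lambda>k. - ((pi / 2) * (d\<^sup>2 / 4 / Re (Z k)))) at_bot sequentially"
          by (simp add: filterlim_uminus_at_top)
        from tendsto_mult[OF tendsto_const[of C] filterlim_compose[OF exp_at_bot this]]
        show "(\<lambda>k. C * exp (- (pi / 2) * (d\<^sup>2 / 4 / Re (Z k)))) \<longlonglongrightarrow> 0" by simp
      qed
      ultimately show "\<forall>\<^sub>F k in sequentially. \<forall>X. \<bar>F (Z k) X - F0 X\<bar> \<le> \<epsilon>"
      proof eventually_elim
        case (elim k)
        show ?case
        proof
          fix X
          show "\<bar>F (Z k) X - F0 X\<bar> \<le> \<epsilon>"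
          proof (cases "norm (sqrt (Re (Z k)) *\<^sub>R X) < d / 2")
            case True
            have "dist (Z k, sqrt (Re (Z k)) *\<^sub>R X) (0, 0) \<le> norm (Z k) + norm (sqrt (Re (Z k)) *\<^sub>R X)"
              using norm_Pair_le[of "Z k" "sqrt (Re (Z k)) *\<^sub>R X"] by (simp add: dist_norm del: norm_scaleR)
            also have "\<dots> < d" using True elim(1) by linarith
            finally have "dist (?N (Z k, sqrt (Re (Z k)) *\<^sub>R X)) (?N (0, 0)) < \<epsilon>"
              by (intro dd) (use hd(1)[OF Zk] in auto)
            then have 1: "\<bar>?N (Z k, sqrt (Re (Z k)) *\<^sub>R X) - ?N (0, 0)\<bar> \<le> \<epsilon>" by (simp add: dist_real_def)
            have "\<bar>F (Z k) X - F0 X\<bar> = exp (- pi * (norm X)\<^sup>2) * \<bar>?N (Z k, sqrt (Re (Z k)) *\<^sub>R X) - ?N (0, 0)\<bar>"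
              unfolding F_def F0_def right_diff_distrib[symmetric] abs_mult by simp
            also have "\<dots> \<le> 1 * \<epsilon>" by (intro mult_mono 1) auto
            finally show ?thesis by simp
          next
            case False
            then have "(d / 2)\<^sup>2 \<le> (norm (sqrt (Re (Z k)) *\<^sub>R X))\<^sup>2" using d by (intro power_mono) auto
            also have "\<dots> = Re (Z k) * (norm X)\<^sup>2" using Zk(1)[of k] by (simp add: power_mult_distrib)
            finally have "d\<^sup>2 / 4 / Re (Z k) \<le> (norm X)\<^sup>2"
              using Zk(1)[of k] by (subst pos_divide_le_eq) (simp_all add: power_divide mult_ac)
            then have "(pi / 2) * (d\<^sup>2 / 4 / Re (Z k)) \<le> (pi / 2) * (norm X)\<^sup>2" by (intro mult_left_mono) auto
            then have "G X \<le> C * exp (- (pi / 2) * (d\<^sup>2 / 4 / Re (Z k)))"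
              unfolding G_def using C by (intro mult_left_mono) auto
            with elim(2) have "G X < \<epsilon>" by linarith
            then show ?thesis using F_nonneg(1)[of "Z k" X] F_nonneg(2)[of X] FG[OF Zk, of k X] F0G[of X]
              unfolding abs_le_iff by linarith
          qed
        qed
      qed
    qed (use F_nonneg FG[OF Zk] F0G in auto)
    ultimately show ?thesis by simp
  qed
  ultimately show ?thesis
    using \<delta>(1) by (intro exI[of _ K] conjI exI[of _ \<delta>]) (assumption | blast)+
qed

section \<open>Fixed time and large time\<close>

lemma FL_norm_cmult:
  assumes [measurable]: "f \<in> borel_measurable borel" and p: "1 \<le> p" and A: "A \<noteq> 0"
  shows "FL_norm p (\<lambda>y. A * f y) = ennreal (norm A) * FL_norm p f"
proof -
  have [measurable]: "fourier f \<in> borel_measurable borel" by (intro fourier_measurable) measurable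
  show ?thesis
    unfolding FL_norm_def fourier_cmult norm_mult ennreal_mult'[OF norm_ge_zero]
    using A by (intro Lp_norm_cmult p) auto
qed

lemma amalgam_norm_gaussian_cmult:
  fixes g :: "'a::euclidean_space \<Rightarrow> complex"
  assumes e: "0 < e" and g: "g \<in> gauss_smooth e" and p: "1 \<le> p" and q: "1 \<le> q"
    and z: "z \<in> half_disc" and A: "A \<noteq> 0"
  shows "amalgam_norm g p q (\<lambda>x. A * gauss_factor (z, 0) x) = ennreal (norm A) * amalgam_norm g p q (gauss_factor (z, 0))"
proof -
  note [measurable] = gauss_smooth_measurable[OF g]
  have "(\<lambda>x. window_norm p g (z, Re z *\<^sub>R x)) \<in> borel_measurable borel"
    by (rule measurable_compose[OF _ window_norm_measurable[OF e g p z]]) measurable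
  then have m: "(\<lambda>x. FL_norm p (\<lambda>y. gauss_factor (z, 0) y * g (y - x))) \<in> borel_measurable borel"
    unfolding FL_norm_gauss_factor_window[OF gauss_smooth_measurable[OF g] p] by measurable
  have "FL_norm p (\<lambda>y. A * gauss_factor (z, 0) y * g (y - x)) = ennreal (norm A) * FL_norm p (\<lambda>y. gauss_factor (z, 0) y * g (y - x))" for x
    unfolding mult.assoc by (rule FL_norm_cmult[OF _ p A]) measurable
  then show ?thesis
    unfolding amalgam_norm_def using A by (simp only:) (rule Lp_norm_cmult[OF _ m q], simp)
qed

text \<open>As a limit along a filter the asymptotics can be composed with any curve \<open>z\<close> in the right half-plane that tends
  to \<open>0\<close>, whether parametrised by \<open>l\<close> or by \<open>t\<close>.\<close>

lemma amalgam_norm_gaussian_tendsto: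
  fixes g :: "'a::euclidean_space \<Rightarrow> complex"
  assumes e: "0 < e" and g: "g \<in> gauss_smooth e" and p: "1 \<le> p" and q: "1 \<le> q"
    and nz: "(\<integral>\<^sup>+x. ennreal ((norm (g x))\<^sup>2) \<partial>lborel) \<noteq> 0"
  obtains K where "0 < K"
    "((\<lambda>z. enn2real (amalgam_norm g p q (gauss_factor (z, 0))) * Re z powr (real DIM('a) / 2 * enn2real (1 / q)))
        \<longlongrightarrow> K) (at 0 within {z. 0 < Re z})"
    "\<forall>\<^sub>F z in at 0 within {z. 0 < Re z}. z \<in> half_disc \<and> amalgam_norm g p q (gauss_factor (z, 0)) < \<infinity>"
proof -
  obtain K \<delta> where K: "0 < K" and \<delta>: "0 < \<delta>"
    and fin: "\<forall>z. 0 < Re z \<longrightarrow> norm z < \<delta> \<longrightarrow> amalgam_norm g p q (gauss_factor (z, 0)) < \<infinity>"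
    and lim: "\<forall>Z. (\<forall>k. 0 < Re (Z k) \<and> norm (Z k) < \<delta>) \<longrightarrow> Z \<longlonglongrightarrow> 0 \<longrightarrow>
      (\<lambda>k. enn2real (amalgam_norm g p q (gauss_factor (Z k, 0))) * Re (Z k) powr (real DIM('a) / 2 * enn2real (1 / q))) \<longlonglongrightarrow> K"
    using amalgam_norm_gaussian_asymp[OF e g p q nz] by (elim exE conjE) (rule that)
  let ?S = "{z. 0 < Re z}"
  have at: "at 0 within ?S = at 0 within (?S \<inter> ball 0 \<delta>)"
    using \<delta> by (intro at_within_nhd[of 0 "ball 0 \<delta>"]) auto
  have "((\<lambda>z. enn2real (amalgam_norm g p q (gauss_factor (z, 0))) * Re z powr (real DIM('a) / 2 * enn2real (1 / q)))
        \<longlongrightarrow> K) (at 0 within ?S)"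
    unfolding at tendsto_at_iff_sequentially o_def
  proof (intro allI impI)
    fix Z assume "\<forall>i. Z i \<in> ?S \<inter> ball 0 \<delta> - {0}" and Z0: "Z \<longlonglongrightarrow> 0"
    then have "\<forall>k. 0 < Re (Z k) \<and> norm (Z k) < \<delta>" by simp
    from lim[rule_format, OF this[rule_format] Z0]
    show "(\<lambda>k. enn2real (amalgam_norm g p q (gauss_factor (Z k, 0))) * Re (Z k) powr (real DIM('a) / 2 * enn2real (1 / q))) \<longlonglongrightarrow> K" .
  qed
  moreover have "\<forall>\<^sub>F z in at 0 within ?S. z \<in> half_disc \<and> amalgam_norm g p q (gauss_factor (z, 0)) < \<infinity>"
    unfolding eventually_at
    by (rule exI[of _ "min \<delta> 1"]) (use \<delta> fin in \<open>auto simp: half_disc_def\<close>)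
  ultimately show thesis using K that by blast
qed

text \<open>The parameter of the Gaussian that the Schroedinger flow makes of \<open>exp (- \<pi> l |x|\<^sup>2)\<close> in time \<open>t\<close>.\<close>

definition evolved_param :: "real \<Rightarrow> real \<Rightarrow> complex" where
  "evolved_param t l = inverse (Complex (1 / l) (4 * pi * t))"

lemma evolved_param:
  assumes l: "0 < l"
  shows "norm (evolved_param t l) = l / sqrt (1 + (4 * pi * t * l)\<^sup>2)"
    "Re (evolved_param t l) = l / (1 + (4 * pi * t * l)\<^sup>2)"
    "Im (evolved_param t l) = - (4 * pi * t * l\<^sup>2) / (1 + (4 * pi * t * l)\<^sup>2)"
proof -
  have eq: "(1 / l)\<^sup>2 + (4 * pi * t)\<^sup>2 = (1 + (4 * pi * t * l)\<^sup>2) / l\<^sup>2"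
    using l by (simp add: field_simps power2_eq_square)
  have pos: "0 < 1 + (4 * pi * t * l)\<^sup>2" by (rule add_pos_nonneg) auto
  show "norm (evolved_param t l) = l / sqrt (1 + (4 * pi * t * l)\<^sup>2)"
    unfolding evolved_param_def norm_inverse complex_norm eq real_sqrt_divide using l by simp
  show "Re (evolved_param t l) = l / (1 + (4 * pi * t * l)\<^sup>2)"
    unfolding evolved_param_def inverse_complex.simps complex.sel eq using l pos by (simp add: power2_eq_square)
  show "Im (evolved_param t l) = - (4 * pi * t * l\<^sup>2) / (1 + (4 * pi * t * l)\<^sup>2)"
    unfolding evolved_param_def inverse_complex.simps complex.sel eq using l pos by (simp add: power2_eq_square)
qed

lemma schrodinger_gaussian_norm:
  assumes l: "0 < l"
  obtains \<kappa> where "schrodinger t (gauss_factor (of_real l, 0) :: 'a::euclidean_space \<Rightarrow> complex)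
      = (\<lambda>x. \<kappa> * gauss_factor (evolved_param t l, 0) x)"
    "norm \<kappa> = (1 + (4 * pi * t * l)\<^sup>2) powr - (real DIM('a) / 4)"
proof
  let ?\<zeta> = "Complex (1 / l) (4 * pi * t)"
  let ?k = "1 / (of_real (sqrt l ^ DIM('a)) * csqrt ?\<zeta> ^ DIM('a)) :: complex"
  show "schrodinger t (gauss_factor (of_real l, 0) :: 'a \<Rightarrow> complex) = (\<lambda>x. ?k * gauss_factor (evolved_param t l, 0) x)"
    unfolding evolved_param_def by (rule ext) (rule schrodinger_gaussian[OF l])
  have pos: "0 < 1 + (4 * pi * t * l)\<^sup>2" by (rule add_pos_nonneg) auto
  have "norm ?\<zeta> = inverse (norm (evolved_param t l))" by (simp add: evolved_param_def norm_inverse)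
  then have n: "l * norm ?\<zeta> = sqrt (1 + (4 * pi * t * l)\<^sup>2)"
    unfolding evolved_param(1)[OF l] using l by simp
  have "norm ?k = inverse ((sqrt l * sqrt (norm ?\<zeta>)) ^ DIM('a))"
    using l by (simp add: norm_divide norm_inverse norm_mult norm_power power_mult_distrib divide_inverse)
  also have "sqrt l * sqrt (norm ?\<zeta>) = sqrt (sqrt (1 + (4 * pi * t * l)\<^sup>2))"
    unfolding real_sqrt_mult[symmetric] n ..
  also have "\<dots> = (1 + (4 * pi * t * l)\<^sup>2) powr (1 / 4)"
    using pos by (simp add: powr_half_sqrt[symmetric] powr_powr)
  also have "inverse (\<dots> ^ DIM('a)) = (1 + (4 * pi * t * l)\<^sup>2) powr - (real DIM('a) / 4)"
    using pos by (simp add: powr_realpow[symmetric] powr_powr powr_minus)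
  finally show "norm ?k = (1 + (4 * pi * t * l)\<^sup>2) powr - (real DIM('a) / 4)" .
qed

lemma powr_one_tendsto:
  fixes f :: "'b \<Rightarrow> real"
  assumes "(f \<longlongrightarrow> 1) F" shows "((\<lambda>x. f x powr a) \<longlongrightarrow> 1) F"
  using tendsto_powr[OF assms tendsto_const[of a]] by simp

lemma gaussian_schwartz: "0 < l \<Longrightarrow> gauss_factor (of_real l, 0) \<in> schwartz"
  by (rule gauss_smooth_schwartz[OF gauss_factor_gauss_smooth]) auto

text \<open>Flat Gaussians \<open>l \<rightarrow> 0\<close> hardly move in a fixed time. Both norms are then governed by the width
  \<open>l\<^sup>-\<^sup>1\<^sup>/\<^sup>2\<close> through the outer exponent, which forces \<open>1 / r \<le> 1 / r'\<close>.\<close>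

lemma fixed_time_exponent:
  fixes g :: "'a::euclidean_space \<Rightarrow> complex"
  assumes e: "0 < e" and g: "g \<in> gauss_smooth e"
    and nz: "(\<integral>\<^sup>+x. ennreal ((norm (g x))\<^sup>2) \<partial>lborel) \<noteq> 0"
    and r: "1 \<le> r" and C: "0 < C"
    and est: "\<forall>u0\<in>schwartz. amalgam_norm g (conj_exponent r) r (schrodinger t0 u0)
      \<le> ennreal C * amalgam_norm g r (conj_exponent r) u0"
  shows "2 \<le> r"
proof (rule ccontr)
  assume "\<not> 2 \<le> r"
  define u where "u = enn2real (1 / r)"
  have u: "1 / 2 < u" using \<open>\<not> 2 \<le> r\<close> two_le_exponent_iff[OF r] by (simp add: u_def)
  note cr = conj_exponent_recip[OF r, folded u_def]
  define h where "h = real DIM('a) / 2"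
  have h: "0 < h" using DIM_positive[where 'a = 'a] by (simp add: h_def)
  let ?A = "\<lambda>z. enn2real (amalgam_norm g (conj_exponent r) r (gauss_factor (z, 0)))"
  let ?B = "\<lambda>z. enn2real (amalgam_norm g r (conj_exponent r) (gauss_factor (z, 0)))"
  obtain K1 where K1: "0 < K1" "((\<lambda>z. ?A z * Re z powr (h * u)) \<longlongrightarrow> K1) (at 0 within {z. 0 < Re z})"
    "\<forall>\<^sub>F z in at 0 within {z. 0 < Re z}. z \<in> half_disc \<and> amalgam_norm g (conj_exponent r) r (gauss_factor (z, 0)) < \<infinity>"
    by (rule amalgam_norm_gaussian_tendsto[OF e g cr(1) r nz, folded h_def u_def])
  obtain K2 where K2: "0 < K2" "((\<lambda>z. ?B z * Re z powr (h * (1 - u))) \<longlongrightarrow> K2) (at 0 within {z. 0 < Re z})"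
    "\<forall>\<^sub>F z in at 0 within {z. 0 < Re z}. z \<in> half_disc \<and> amalgam_norm g r (conj_exponent r) (gauss_factor (z, 0)) < \<infinity>"
    by (rule amalgam_norm_gaussian_tendsto[OF e g r cr(1) nz, folded h_def, unfolded cr(2)])
  let ?Z = "evolved_param t0"
  let ?w = "\<lambda>l. 1 + (4 * pi * t0 * l)\<^sup>2"
  have w: "0 < ?w l" for l by (rule add_pos_nonneg) auto
  have pos: "\<forall>\<^sub>F l in at_right 0. 0 < (l::real)" by (simp add: eventually_at_right_less)
  have id0: "((\<lambda>l. l) \<longlongrightarrow> 0) (at_right (0::real))" by (rule tendsto_ident_at)
  have w1: "(?w \<longlongrightarrow> 1) (at_right 0)"
    by (rule tendsto_eq_rhs[where x = "1 + (4 * pi * t0 * 0)\<^sup>2"]) (intro tendsto_intros id0, simp)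
  have Z: "filterlim ?Z (at 0 within {z. 0 < Re z}) (at_right 0)"
    unfolding filterlim_at
  proof
    show "\<forall>\<^sub>F l in at_right 0. ?Z l \<in> {z. 0 < Re z} \<and> ?Z l \<noteq> 0"
      using pos
    proof eventually_elim
      case (elim l)
      then have "0 < Re (?Z l)" using w[of l] by (simp add: evolved_param(2))
      then show ?case by auto
    qed
    have "((\<lambda>l. l / sqrt (?w l)) \<longlongrightarrow> 0 / sqrt 1) (at_right 0)"
      by (intro tendsto_divide id0 tendsto_real_sqrt w1) simp
    moreover have "\<forall>\<^sub>F l in at_right 0. l / sqrt (?w l) = norm (?Z l)"
      using pos by eventually_elim (simp add: evolved_param(1))
    ultimately have "((\<lambda>l. norm (?Z l)) \<longlongrightarrow> 0 / sqrt 1) (at_right 0)" by (rule Lim_transform_eventually)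
    then show "(?Z \<longlongrightarrow> 0) (at_right 0)" by (subst (asm) div_0) (rule tendsto_norm_zero_cancel)
  qed
  have L: "filterlim complex_of_real (at 0 within {z. 0 < Re z}) (at_right 0)"
    unfolding filterlim_at
  proof
    show "\<forall>\<^sub>F l in at_right 0. complex_of_real l \<in> {z. 0 < Re z} \<and> complex_of_real l \<noteq> 0"
      using pos by eventually_elim auto
    show "(complex_of_real \<longlongrightarrow> 0) (at_right 0)" using tendsto_of_real[OF id0] by simp
  qed
  \<comment> \<open>both sides of the estimate, multiplied by the power of \<open>l\<close> that makes the left one converge\<close>
  have lim1: "((\<lambda>l. ?w l powr - (h / 2) * (?A (?Z l) * Re (?Z l) powr (h * u)) * ?w l powr (h * u)) \<longlongrightarrow> 1 * K1 * 1) (at_right 0)"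
    by (intro tendsto_mult powr_one_tendsto w1 filterlim_compose[OF K1(2) Z])
  have lim2: "((\<lambda>l. C * (?B (of_real l) * Re (of_real l) powr (h * (1 - u))) * l powr (h * (2 * u - 1))) \<longlongrightarrow> C * K2 * 0 powr (h * (2 * u - 1))) (at_right 0)"
  proof (intro tendsto_mult tendsto_const filterlim_compose[OF K2(2) L])
    show "((\<lambda>l. l powr (h * (2 * u - 1))) \<longlongrightarrow> 0 powr (h * (2 * u - 1))) (at_right (0::real))"
    proof (rule tendsto_powr'[OF id0 tendsto_const])
      show "(0::real) \<noteq> 0 \<or> 0 < h * (2 * u - 1) \<and> (\<forall>\<^sub>F l in at_right (0::real). 0 \<le> l)"
        using h u pos by (auto elim: eventually_mono)
    qed
  qed
  have "\<forall>\<^sub>F l in at_right 0. ?w l powr - (h / 2) * (?A (?Z l) * Re (?Z l) powr (h * u)) * ?w l powr (h * u)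
      \<le> C * (?B (of_real l) * Re (of_real l) powr (h * (1 - u))) * l powr (h * (2 * u - 1))"
    using pos eventually_compose_filterlim[OF K1(3) Z] eventually_compose_filterlim[OF K2(3) L]
  proof eventually_elim
    case (elim l)
    obtain \<kappa> where \<kappa>: "schrodinger t0 (gauss_factor (of_real l, 0) :: 'a \<Rightarrow> complex)
      = (\<lambda>x. \<kappa> * gauss_factor (?Z l, 0) x)" "norm \<kappa> = ?w l powr - (real DIM('a) / 4)"
      by (rule schrodinger_gaussian_norm[OF elim(1)])
    have \<kappa>h: "norm \<kappa> = ?w l powr - (h / 2)" unfolding \<kappa>(2) h_def by simp
    then have "0 < norm \<kappa>" using w[of l] by simp
    then have \<kappa>0: "\<kappa> \<noteq> 0" by simp
    have "ennreal (norm \<kappa>) * amalgam_norm g (conj_exponent r) r (gauss_factor (?Z l, 0))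
      \<le> ennreal C * amalgam_norm g r (conj_exponent r) (gauss_factor (of_real l, 0))"
      using est[rule_format, OF gaussian_schwartz[OF elim(1)]]
      unfolding \<kappa>(1) using amalgam_norm_gaussian_cmult[OF e g cr(1) r _ \<kappa>0, of "?Z l"] elim(2) by simp
    then have "enn2real (ennreal (norm \<kappa>) * amalgam_norm g (conj_exponent r) r (gauss_factor (?Z l, 0)))
      \<le> enn2real (ennreal C * amalgam_norm g r (conj_exponent r) (gauss_factor (of_real l, 0)))"
      using elim(3) by (intro enn2real_mono) (auto simp: ennreal_mult_less_top)
    then have main: "?w l powr - (h / 2) * ?A (?Z l) \<le> C * ?B (of_real l)"
      using C by (simp add: enn2real_mult \<kappa>h)
    have "Re (?Z l) * ?w l = l" using w[of l] by (simp add: evolved_param(2)[OF elim(1)])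
    then have rw: "Re (?Z l) powr (h * u) * ?w l powr (h * u) = l powr (h * u)" by (simp add: powr_mult[symmetric])
    have "?w l powr - (h / 2) * (?A (?Z l) * Re (?Z l) powr (h * u)) * ?w l powr (h * u)
      = (?w l powr - (h / 2) * ?A (?Z l)) * (Re (?Z l) powr (h * u) * ?w l powr (h * u))" by (simp only: mult.assoc)
    also have "\<dots> = (?w l powr - (h / 2) * ?A (?Z l)) * l powr (h * u)" unfolding rw ..
    also have "\<dots> \<le> (C * ?B (of_real l)) * l powr (h * u)" by (rule mult_right_mono[OF main]) simp
    also have "l powr (h * u) = l powr (h * (1 - u)) * l powr (h * (2 * u - 1))"
      by (simp add: powr_add[symmetric] algebra_simps)
    also have "(C * ?B (of_real l)) * (l powr (h * (1 - u)) * l powr (h * (2 * u - 1)))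
      = C * (?B (of_real l) * Re (of_real l) powr (h * (1 - u))) * l powr (h * (2 * u - 1))"
      by (simp only: Re_complex_of_real mult.assoc)
    finally show ?case .
  qed
  from tendsto_le[OF _ lim2 lim1 this] have "1 * K1 * 1 \<le> C * K2 * 0 powr (h * (2 * u - 1))"
    by (simp add: trivial_limit_at_right_real)
  with K1(1) show False by simp
qed

text \<open>For large times the evolved unit Gaussian is itself a flat Gaussian, so that its norm is
  known up to a factor tending to \<open>1\<close>.\<close>

lemma gaussian_large_time:
  fixes g :: "'a::euclidean_space \<Rightarrow> complex"
  assumes e: "0 < e" and g: "g \<in> gauss_smooth e"
    and nz: "(\<integral>\<^sup>+x. ennreal ((norm (g x))\<^sup>2) \<partial>lborel) \<noteq> 0"
    and r: "1 \<le> r"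
  shows "\<exists>c>0. ((\<lambda>t::real. amalgam_norm g (conj_exponent r) r (schrodinger t (gauss_factor (of_real 1, 0)))
      / ennreal (c * t powr (- real DIM('a) * (1 / 2 - enn2real (1 / r))))) \<longlongrightarrow> 1) at_top"
proof -
  define u where "u = enn2real (1 / r)"
  note cr = conj_exponent_recip[OF r, folded u_def]
  define h where "h = real DIM('a) / 2"
  define s where "s = real DIM('a) * (1 / 2 - u)"
  have sh: "s = h - 2 * (h * u)" by (simp add: s_def h_def algebra_simps)
  let ?A = "\<lambda>z. enn2real (amalgam_norm g (conj_exponent r) r (gauss_factor (z, 0)))"
  obtain K where K: "0 < K" "((\<lambda>z. ?A z * Re z powr (h * u)) \<longlongrightarrow> K) (at 0 within {z. 0 < Re z})"
    "\<forall>\<^sub>F z in at 0 within {z. 0 < Re z}. z \<in> half_disc \<and> amalgam_norm g (conj_exponent r) r (gauss_factor (z, 0)) < \<infinity>"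
    by (rule amalgam_norm_gaussian_tendsto[OF e g cr(1) r nz, folded h_def u_def])
  let ?Z = "\<lambda>t. evolved_param t 1"
  let ?w = "\<lambda>t. 1 + (4 * pi * t)\<^sup>2"
  have w: "0 < ?w t" for t by (rule add_pos_nonneg) auto
  note ev = evolved_param[OF zero_less_one, unfolded mult_1_right]
  have pos: "\<forall>\<^sub>F t in at_top. 0 < (t::real)" by (rule eventually_gt_at_top)
  let ?y = "\<lambda>t::real. 1 / (4 * pi * t)"
  have "filterlim (\<lambda>t::real. 4 * pi * t) at_top at_top"
    by (rule filterlim_tendsto_pos_mult_at_top[OF tendsto_const]) (auto simp: filterlim_ident)
  then have y0: "(?y \<longlongrightarrow> 0) at_top"
    by (intro tendsto_divide_0[OF tendsto_const] filterlim_at_top_imp_at_infinity)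
  have y: "?y t / sqrt ((?y t)\<^sup>2 + 1) = 1 / sqrt (?w t)" "1 / sqrt ((?y t)\<^sup>2 + 1) = 4 * pi * t / sqrt (?w t)"
    if t: "0 < t" for t
  proof -
    have x: "0 < 4 * pi * t" using t by simp
    have "(?y t)\<^sup>2 + 1 = ?w t / (4 * pi * t)\<^sup>2" using t by (simp add: add_divide_distrib power_divide)
    then have "sqrt ((?y t)\<^sup>2 + 1) = sqrt (?w t) / (4 * pi * t)"
      using x by (simp only: real_sqrt_divide real_sqrt_abs abs_of_pos)
    then show "?y t / sqrt ((?y t)\<^sup>2 + 1) = 1 / sqrt (?w t)" "1 / sqrt ((?y t)\<^sup>2 + 1) = 4 * pi * t / sqrt (?w t)"
      using t by simp_all
  qed
  have Z: "filterlim ?Z (at 0 within {z. 0 < Re z}) at_top"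
    unfolding filterlim_at
  proof
    show "\<forall>\<^sub>F t in at_top. ?Z t \<in> {z. 0 < Re z} \<and> ?Z t \<noteq> 0"
    proof (rule always_eventually, rule allI)
      fix t
      have "0 < Re (?Z t)" using w[of t] by (simp add: ev(2))
      then show "?Z t \<in> {z. 0 < Re z} \<and> ?Z t \<noteq> 0" by auto
    qed
    have "((\<lambda>t. ?y t / sqrt ((?y t)\<^sup>2 + 1)) \<longlongrightarrow> 0 / sqrt (0\<^sup>2 + 1)) at_top"
      by (intro tendsto_intros y0) simp
    moreover have "\<forall>\<^sub>F t in at_top. ?y t / sqrt ((?y t)\<^sup>2 + 1) = 1 / sqrt (?w t)"
      using pos by eventually_elim (rule y(1))
    ultimately have "((\<lambda>t::real. 1 / sqrt (1 + (4 * pi * t)\<^sup>2)) \<longlongrightarrow> 0 / sqrt (0\<^sup>2 + 1)) at_top"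
      by (rule Lim_transform_eventually)
    then show "(?Z \<longlongrightarrow> 0) at_top" by (intro tendsto_norm_zero_cancel[of ?Z]) (simp add: ev(1))
  qed
  \<comment> \<open>\<open>t |z| \<rightarrow> 1 / (4 \<pi>)\<close>, and \<open>|\<kappa>| = |z|\<^sup>d\<^sup>/\<^sup>2\<close>, \<open>Re z = |z|\<^sup>2\<close> for \<open>l = 1\<close>\<close>
  define c where "c = K * (4 * pi) powr - s"
  have c: "0 < c" using K(1) by (simp add: c_def)
  let ?q = "\<lambda>t. (?A (?Z t) * Re (?Z t) powr (h * u)) / K * (4 * pi * t / sqrt (?w t)) powr s"
  have "(?q \<longlongrightarrow> K / K * 1) at_top"
  proof (intro tendsto_mult tendsto_divide tendsto_const filterlim_compose[OF K(2) Z] powr_one_tendsto)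
    have "((\<lambda>t. 1 / sqrt ((?y t)\<^sup>2 + 1)) \<longlongrightarrow> 1 / sqrt (0\<^sup>2 + 1)) at_top"
      by (intro tendsto_intros y0) simp
    moreover have "\<forall>\<^sub>F t in at_top. 1 / sqrt ((?y t)\<^sup>2 + 1) = 4 * pi * t / sqrt (?w t)"
      using pos by eventually_elim (rule y(2))
    ultimately have "((\<lambda>t::real. 4 * pi * t / sqrt (1 + (4 * pi * t)\<^sup>2)) \<longlongrightarrow> 1 / sqrt (0\<^sup>2 + 1)) at_top"
      by (rule Lim_transform_eventually)
    then show "((\<lambda>t::real. 4 * pi * t / sqrt (1 + (4 * pi * t)\<^sup>2)) \<longlongrightarrow> 1) at_top" by simp
  qed (use K in auto)
  then have "((\<lambda>t. ennreal (?q t)) \<longlongrightarrow> ennreal (K / K * 1)) at_top" by (rule tendsto_ennrealI)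
  then have q1: "((\<lambda>t. ennreal (?q t)) \<longlongrightarrow> 1) at_top" using K(1) by simp
  have "\<forall>\<^sub>F t in at_top. ennreal (?q t) = amalgam_norm g (conj_exponent r) r (schrodinger t (gauss_factor (of_real 1, 0)))
      / ennreal (c * t powr (- real DIM('a) * (1 / 2 - enn2real (1 / r))))"
    using pos eventually_compose_filterlim[OF K(3) Z]
  proof eventually_elim
    case (elim t)
    obtain \<kappa> where \<kappa>: "schrodinger t (gauss_factor (of_real 1, 0) :: 'a \<Rightarrow> complex)
      = (\<lambda>x. \<kappa> * gauss_factor (?Z t, 0) x)" "norm \<kappa> = (1 + (4 * pi * t * 1)\<^sup>2) powr - (real DIM('a) / 4)"
      by (rule schrodinger_gaussian_norm[OF zero_less_one])
    have \<kappa>h: "norm \<kappa> = ?w t powr - (h / 2)" unfolding \<kappa>(2) h_def by simp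
    then have "0 < norm \<kappa>" using w[of t] by simp
    then have \<kappa>0: "\<kappa> \<noteq> 0" by simp
    have am: "amalgam_norm g (conj_exponent r) r (schrodinger t (gauss_factor (of_real 1, 0))) = ennreal (norm \<kappa> * ?A (?Z t))"
      unfolding \<kappa>(1) using amalgam_norm_gaussian_cmult[OF e g cr(1) r _ \<kappa>0, of "?Z t"] elim(2)
      by (simp add: ennreal_mult')
    have sq: "(4 * pi * t / sqrt (?w t)) powr s = (4 * pi) powr s * t powr s * ?w t powr - (s / 2)"
    proof -
      have "sqrt (?w t) = ?w t powr (1 / 2)" using w[of t] by (simp add: powr_half_sqrt)
      then have "sqrt (?w t) powr s = ?w t powr (s / 2)" by (simp add: powr_powr)
      then have "(4 * pi * t / sqrt (?w t)) powr s = (4 * pi * t) powr s / ?w t powr (s / 2)"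
        by (simp only: powr_divide)
      also have "(4 * pi * t) powr s = (4 * pi) powr s * t powr s" by (rule powr_mult)
      finally show ?thesis by (simp only: powr_minus divide_inverse)
    qed
    have Rz: "Re (?Z t) powr (h * u) = ?w t powr - (h * u)"
      unfolding ev(2) powr_divide powr_one_eq_one powr_minus by (rule inverse_eq_divide[symmetric])
    have wexp: "?w t powr - (h * u) * ?w t powr - (s / 2) = ?w t powr - (h / 2)"
      unfolding powr_add[symmetric] sh by (simp add: field_simps)
    have "?q t = (?A (?Z t) * (?w t powr - (h * u) * ?w t powr - (s / 2))) * ((4 * pi) powr s * t powr s) / K"
      unfolding sq Rz by (simp only: mult_ac times_divide_eq_left times_divide_eq_right)
    also have "\<dots> = norm \<kappa> * ?A (?Z t) / (c * t powr - s)"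
      unfolding wexp \<kappa>h c_def using elim(1) K(1) by (simp add: powr_minus field_simps)
    finally have "ennreal (?q t) = ennreal (norm \<kappa> * ?A (?Z t)) / ennreal (c * t powr - s)"
      using c elim(1) by (simp add: divide_ennreal)
    then show ?case unfolding am s_def u_def by (simp only: mult_minus_left)
  qed
  from Lim_transform_eventually[OF q1 this] c show ?thesis by blast
qed

section \<open>Small time\<close>

text \<open>For a large parameter \<open>z\<close>, a fixed small part \<open>B\<close> of the Gaussian is kept with the window, where it
  provides the decay in \<open>x\<close>, and the remaining Gaussian acts by convolution.\<close>

lemma windowed_gaussian_bounds:
  fixes g :: "'a::euclidean_space \<Rightarrow> complex"
  assumes e: "0 < e" and g: "g \<in> gauss_smooth e" and \<beta>: "0 < \<beta>"
  shows "\<exists>B>0. \<exists>C>0. B \<le> \<beta> \<and>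
    (\<forall>z x \<xi>. B < Re z \<longrightarrow> norm (fourier (\<lambda>y. gauss_factor (z, 0) y * g (y - x)) \<xi>)
       \<le> norm (z - of_real B) powr - (real DIM('a) / 2) * (C * exp (- (pi * B / 2) * (norm x)\<^sup>2))) \<and>
    (\<forall>z x. B < Re z \<longrightarrow> (\<integral>\<^sup>+\<xi>. ennreal (norm (fourier (\<lambda>y. gauss_factor (z, 0) y * g (y - x)) \<xi>)) \<partial>lborel)
       \<le> ennreal ((norm (z - of_real B) / (Re z - B)) powr (real DIM('a) / 2) * (C * exp (- (pi * B / 2) * (norm x)\<^sup>2))))"
proof -
  note [measurable] = gauss_smooth_measurable[OF g]
  obtain C c where C: "0 < C" "0 < c"
    and bd: "\<forall>z\<in>half_disc. \<forall>v. window_norm 1 g (z, v) \<le> ennreal (C * exp (c * (norm v)\<^sup>2))"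
    using window_norm_bound[OF e g order_refl] by (elim exE conjE) (rule that)
  obtain M where M: "0 \<le> M" "\<And>x. norm (g x) \<le> M" using gauss_smooth_bounded[OF g e] by blast
  \<comment> \<open>small enough for \<open>exp (- \<pi> B |x|\<^sup>2)\<close> to absorb \<open>exp (c |B x|\<^sup>2)\<close>\<close>
  define B where "B = min \<beta> (min 1 (pi / (2 * c)))"
  have "B \<le> pi / (2 * c)" by (simp add: B_def)
  then have "c * B \<le> c * (pi / (2 * c))" using C by (intro mult_left_mono) auto
  then have B: "0 < B" "B \<le> \<beta>" "B \<le> 1" "c * B \<le> pi / 2" using \<beta> C by (auto simp: B_def)
  let ?h = "\<lambda>x y. gauss_factor (of_real B, 0) y * g (y - x)"
  let ?D = "\<lambda>x::'a. C * exp (- (pi * B / 2) * (norm x)\<^sup>2)"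
  have hi: "integrable lborel (?h x)" for x
  proof (rule Bochner_Integration.integrable_bound[of _ "\<lambda>y::'a. M * exp (- (pi * B) * (norm y)\<^sup>2)"])
    have "0 < pi * B" using B by simp
    then show "integrable lborel (\<lambda>y::'a. M * exp (- (pi * B) * (norm y)\<^sup>2))"
      by (intro integrable_mult_right gaussian_integrable)
    show "AE y in lborel. norm (?h x y) \<le> norm (M * exp (- (pi * B) * (norm y)\<^sup>2))"
    proof (rule AE_I2)
      fix y
      have "norm (?h x y) \<le> exp (- (pi * B) * (norm y)\<^sup>2) * M"
        unfolding norm_mult norm_gauss_factor0 Re_complex_of_real by (intro mult_left_mono M) simp
      then show "norm (?h x y) \<le> norm (M * exp (- (pi * B) * (norm y)\<^sup>2))" using M(1) by (simp add: mult.commute)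
    qed
  qed measurable
  have L1: "(\<integral>\<^sup>+\<xi>. ennreal (norm (fourier (?h x) \<xi>)) \<partial>lborel) \<le> ennreal (?D x)" for x
  proof -
    have hd: "complex_of_real B \<in> half_disc" using B by (simp add: half_disc_def)
    have "(\<integral>\<^sup>+\<xi>. ennreal (norm (fourier (?h x) \<xi>)) \<partial>lborel)
      = ennreal (exp (- (pi * B) * (norm x)\<^sup>2)) * window_norm 1 g (of_real B, B *\<^sub>R x)"
      using FL_norm_gauss_factor_window[OF gauss_smooth_measurable[OF g] order_refl, of "of_real B" x]
      unfolding FL_norm_def Lp_norm_1 Re_complex_of_real .
    also have "\<dots> \<le> ennreal (exp (- (pi * B) * (norm x)\<^sup>2)) * ennreal (C * exp (c * (norm (B *\<^sub>R x))\<^sup>2))"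
      by (intro mult_left_mono bd[rule_format, OF hd]) simp
    also have "\<dots> = ennreal (exp (- (pi * B) * (norm x)\<^sup>2) * (C * exp (c * (norm (B *\<^sub>R x))\<^sup>2)))"
      by (rule ennreal_mult'[symmetric]) simp
    also have "exp (- (pi * B) * (norm x)\<^sup>2) * (C * exp (c * (norm (B *\<^sub>R x))\<^sup>2))
      = C * exp (- (pi * B) * (norm x)\<^sup>2 + c * (norm (B *\<^sub>R x))\<^sup>2)"
      unfolding exp_add by (rule mult.left_commute)
    also have "ennreal (C * exp (- (pi * B) * (norm x)\<^sup>2 + c * (norm (B *\<^sub>R x))\<^sup>2)) \<le> ennreal (?D x)"
    proof -
      have "c * (norm (B *\<^sub>R x))\<^sup>2 = (c * B) * (B * (norm x)\<^sup>2)" by (simp add: power_mult_distrib power2_eq_square)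
      also have "\<dots> \<le> (pi / 2) * (B * (norm x)\<^sup>2)" using B by (intro mult_right_mono) auto
      finally have "- (pi * B) * (norm x)\<^sup>2 + c * (norm (B *\<^sub>R x))\<^sup>2 \<le> - (pi * B / 2) * (norm x)\<^sup>2" by simp
      then show ?thesis using C by (intro ennreal_leI mult_left_mono) auto
    qed
    finally show ?thesis .
  qed
  have D0: "0 \<le> ?D x" for x using C by simp
  have split: "(\<lambda>y. gauss_factor (z, 0) y * g (y - x)) = (\<lambda>y. ?h x y * gauss_factor (z - of_real B, 0) y)" for z x
  proof
    fix y :: 'a
    have "gauss_factor (z, 0) y = gauss_factor (of_real B, 0) y * gauss_factor (z - of_real B, 0) y"
      unfolding gauss_factor_def exp_add[symmetric] by (simp add: algebra_simps)
    then show "gauss_factor (z, 0) y * g (y - x) = ?h x y * gauss_factor (z - of_real B, 0) y" by (simp only: mult_ac)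
  qed
  show ?thesis
  proof (rule exI[of _ B], intro conjI B(1), rule exI[of _ C], intro conjI C(1) B(2) allI impI)
    fix z :: complex and x \<xi> :: 'a assume "B < Re z"
    then have z: "0 < Re (z - of_real B)" by simp
    show "norm (fourier (\<lambda>y. gauss_factor (z, 0) y * g (y - x)) \<xi>) \<le> norm (z - of_real B) powr - (real DIM('a) / 2) * ?D x"
      unfolding split by (rule fourier_mult_gauss_factor_bounds(1)[OF hi z L1 D0])
  next
    fix z :: complex and x :: 'a assume "B < Re z"
    then have z: "0 < Re (z - of_real B)" by simp
    show "(\<integral>\<^sup>+\<xi>. ennreal (norm (fourier (\<lambda>y. gauss_factor (z, 0) y * g (y - x)) \<xi>)) \<partial>lborel)
       \<le> ennreal ((norm (z - of_real B) / (Re z - B)) powr (real DIM('a) / 2) * ?D x)"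
      using fourier_mult_gauss_factor_bounds(2)[OF hi z L1 D0] unfolding split by simp
  qed
qed

text \<open>For real \<open>z\<close> the convolution kernel has \<open>L\<^sup>1\<close> norm one, so in the interpolation only the supremum
  contributes a power of \<open>l\<close>.\<close>

lemma amalgam_norm_narrow_gaussian_le:
  fixes g :: "'a::euclidean_space \<Rightarrow> complex"
  assumes e: "0 < e" and g: "g \<in> gauss_smooth e" and p: "1 \<le> p" and q: "1 \<le> q" "q \<noteq> \<infinity>"
  shows "\<exists>K>0. \<forall>l\<ge>2. amalgam_norm g p q (gauss_factor (of_real l, 0))
    \<le> ennreal (K * l powr - (real DIM('a) / 2 * (1 - enn2real (1 / p))))"
proof -
  note [measurable] = gauss_smooth_measurable[OF g]
  obtain B C where B: "0 < B" "B \<le> 1" "0 < C"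
    and sup0: "\<forall>z x \<xi>. B < Re z \<longrightarrow> norm (fourier (\<lambda>y. gauss_factor (z, 0) y * g (y - x)) \<xi>)
       \<le> norm (z - of_real B) powr - (real DIM('a) / 2) * (C * exp (- (pi * B / 2) * (norm x)\<^sup>2))"
    and L10: "\<forall>z x. B < Re z \<longrightarrow> (\<integral>\<^sup>+\<xi>. ennreal (norm (fourier (\<lambda>y. gauss_factor (z, 0) y * g (y - x)) \<xi>)) \<partial>lborel)
       \<le> ennreal ((norm (z - of_real B) / (Re z - B)) powr (real DIM('a) / 2) * (C * exp (- (pi * B / 2) * (norm x)\<^sup>2)))"
    using windowed_gaussian_bounds[OF e g zero_less_one] by (elim exE conjE) (rule that)
  note sup = sup0[rule_format] and L1 = L10[rule_format]
  let ?D = "\<lambda>x::'a. C * exp (- (pi * B / 2) * (norm x)\<^sup>2)" and ?h = "real DIM('a) / 2"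
  define a where "a = 1 - enn2real (1 / p)"
  have a: "0 \<le> a" using recip_exponent_bounds[OF p] by (simp add: a_def)
  define K0 where "K0 = Lp_norm q (\<lambda>x. ennreal (?D x))"
  have K0: "K0 < \<infinity>"
    unfolding K0_def
  proof (rule Lp_norm_finite[OF q(1)])
    have "0 < pi * B / 2" using B by simp
    then show "integrable lborel ?D" by (intro integrable_mult_right gaussian_integrable)
    show "?D x \<le> C" for x using B by (intro mult_left_le) auto
  qed (use B in auto)
  have "amalgam_norm g p q (gauss_factor (of_real l, 0)) \<le> ennreal ((enn2real K0 + 1) * (1 / 2) powr - (?h * a) * l powr - (?h * a))"
    if l: "2 \<le> l" for l
  proof -
    have lB: "B < Re (of_real l)" "0 < l - B" "l * (1 / 2) \<le> l - B" using l B by auto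
    have nl: "norm (of_real l - complex_of_real B) = l - B"
      unfolding of_real_diff[symmetric] norm_of_real using lB by simp
    let ?s = "(l - B) powr - (?h * a)"
    have s: "0 < ?s" using lB by simp
    have "amalgam_norm g p q (gauss_factor (of_real l, 0)) \<le> Lp_norm q (\<lambda>x. ennreal ?s * ennreal (?D x))"
      unfolding amalgam_norm_def
    proof (rule Lp_norm_mono_finite[OF q])
      fix x
      let ?F = "fourier (\<lambda>y. gauss_factor (of_real l, 0) y * g (y - x))"
      have [measurable]: "?F \<in> borel_measurable borel" by (intro fourier_measurable) measurable
      have D: "0 < ?D x" using B by simp
      have "FL_norm p (\<lambda>y. gauss_factor (of_real l, 0) y * g (y - x))
        \<le> ennreal (((l - B) powr - ?h * ?D x) powr (1 - enn2real (1 / p)) * ?D x powr enn2real (1 / p))"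
        unfolding FL_norm_def
      proof (rule Lp_norm_interpolate[OF p])
        show "norm (?F \<xi>) \<le> (l - B) powr - ?h * ?D x" for \<xi> using sup[OF lB(1), of x \<xi>] unfolding nl .
        show "(\<integral>\<^sup>+\<xi>. ennreal (norm (?F \<xi>)) \<partial>lborel) \<le> ennreal (?D x)"
          using L1[OF lB(1), of x] lB(2) unfolding nl Re_complex_of_real by simp
      qed (use D in auto)
      also have "((l - B) powr - ?h * ?D x) powr (1 - enn2real (1 / p)) * ?D x powr enn2real (1 / p) = ?s * ?D x"
      proof -
        have "((l - B) powr - ?h * ?D x) powr a = ?s * ?D x powr a" unfolding powr_mult powr_powr by simp
        moreover have "?D x powr a * ?D x powr enn2real (1 / p) = ?D x"
          using D unfolding powr_add[symmetric] a_def by simp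
        ultimately show ?thesis unfolding a_def[symmetric] by (simp only: mult.assoc)
      qed
      finally show "FL_norm p (\<lambda>y. gauss_factor (of_real l, 0) y * g (y - x)) \<le> ennreal ?s * ennreal (?D x)"
        by (simp only: ennreal_mult'[OF less_imp_le[OF s]])
    qed
    also have "\<dots> = ennreal ?s * K0" unfolding K0_def by (rule Lp_norm_cmult[OF s _ q(1)]) measurable
    also have "\<dots> = ennreal (?s * enn2real K0)" using K0 s by (simp add: ennreal_mult')
    also have "\<dots> \<le> ennreal ((l * (1 / 2)) powr - (?h * a) * (enn2real K0 + 1))"
    proof (intro ennreal_leI mult_mono)
      show "?s \<le> (l * (1 / 2)) powr - (?h * a)"
        using l lB a by (intro powr_mono2') auto
    qed auto
    also have "(l * (1 / 2)) powr - (?h * a) * (enn2real K0 + 1) = (enn2real K0 + 1) * (1 / 2) powr - (?h * a) * l powr - (?h * a)"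
      unfolding powr_mult by (simp only: mult_ac)
    finally show ?thesis .
  qed
  moreover have "0 < (enn2real K0 + 1) * (1 / 2) powr - (?h * a)"
    by (intro mult_pos_pos add_nonneg_pos) auto
  ultimately show ?thesis unfolding a_def by blast
qed

text \<open>Near the origin the window sees a fixed part of the energy of the Gaussian, whatever its chirp, and Plancherel's
  inequality transfers this to frequency.\<close>

lemma windowed_gaussian_L2:
  fixes g :: "'a::euclidean_space \<Rightarrow> complex"
  assumes e: "0 < e" and g: "g \<in> gauss_smooth e"
    and nz: "(\<integral>\<^sup>+x. ennreal ((norm (g x))\<^sup>2) \<partial>lborel) \<noteq> 0"
  shows "\<exists>\<kappa>>0. \<forall>z x. 0 < Re z \<longrightarrow> Re z \<le> 1 \<longrightarrow> norm x \<le> 1 \<longrightarrow>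
    ennreal \<kappa> \<le> (\<integral>\<^sup>+\<xi>. ennreal ((norm (fourier (\<lambda>y. gauss_factor (z, 0) y * g (y - x)) \<xi>))\<^sup>2) \<partial>lborel)"
proof -
  note [measurable] = gauss_smooth_measurable[OF g]
  obtain M where M: "0 \<le> M" "\<And>x. norm (g x) \<le> M" using gauss_smooth_bounded[OF g e] by blast
  let ?I = "\<integral>\<^sup>+y. ennreal ((exp (- pi * (norm y + 1)\<^sup>2) * norm (g y))\<^sup>2) \<partial>lborel"
  have "?I \<noteq> 0"
  proof
    assume "?I = 0"
    then have "AE y in lborel. ennreal ((exp (- pi * (norm y + 1)\<^sup>2) * norm (g y))\<^sup>2) = 0"
      by (subst (asm) nn_integral_0_iff_AE) auto
    then have "AE y in lborel. ennreal ((norm (g y))\<^sup>2) = 0" by eventually_elim simp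
    then have "(\<integral>\<^sup>+x. ennreal ((norm (g x))\<^sup>2) \<partial>lborel) = 0" by (subst nn_integral_0_iff_AE) auto
    with nz show False by simp
  qed
  \<comment> \<open>a positive real at most \<open>?I\<close>, also in case \<open>?I\<close> is infinite\<close>
  define \<kappa> where "\<kappa> = (if ?I = \<infinity> then 1 else enn2real ?I)"
  have \<kappa>: "0 < \<kappa>" "ennreal \<kappa> \<le> ?I"
    using \<open>?I \<noteq> 0\<close> by (auto simp: \<kappa>_def enn2real_positive_iff less_top zero_less_iff_neq_zero)
  have "ennreal \<kappa> \<le> (\<integral>\<^sup>+\<xi>. ennreal ((norm (fourier (\<lambda>y. gauss_factor (z, 0) y * g (y - x)) \<xi>))\<^sup>2) \<partial>lborel)"
    if z: "0 < Re z" "Re z \<le> 1" and x: "norm x \<le> 1" for z x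
  proof -
    let ?f = "\<lambda>y. gauss_factor (z, 0) y * g (y - x)"
    have le: "norm (?f y) \<le> M * norm (gauss_factor (z, 0) y)" for y
      unfolding norm_mult using mult_right_mono[OF M(2)[of "y - x"] norm_ge_zero[of "gauss_factor (z, 0) y"]]
      by (simp only: mult.commute)
    have fi: "integrable lborel ?f"
      by (rule Bochner_Integration.integrable_bound[of _ "\<lambda>y. M * norm (gauss_factor (z, 0) y)"])
        (use gauss_factor_integrable[OF z(1)] le M(1) in auto)
    have fc: "isCont ?f y" for y
    proof -
      have "isCont (gauss_factor (z, 0)) y"
        by (rule gauss_smooth_isCont[OF gauss_factor_gauss_smooth[OF z(1)]])
      moreover have "isCont (\<lambda>y. g (y - x)) y"
        by (intro continuous_at_compose[of _ "\<lambda>y. y - x" g, unfolded o_def] gauss_smooth_isCont[OF g] continuous_intros)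
      ultimately show ?thesis by (rule isCont_mult)
    qed
    have fM: "norm (?f y) \<le> M" for y
    proof -
      have "0 \<le> pi * Re z * (norm y)\<^sup>2" using z by simp
      then have "norm (gauss_factor (z, 0) y) \<le> 1" unfolding norm_gauss_factor0 by simp
      then have "M * norm (gauss_factor (z, 0) y) \<le> M * 1" using M(1) by (intro mult_left_mono) auto
      with le[of y] show ?thesis by simp
    qed
    have "ennreal \<kappa> \<le> ?I" by (rule \<kappa>(2))
    also have "\<dots> \<le> (\<integral>\<^sup>+y. ennreal ((norm (?f (x + 1 *\<^sub>R y)))\<^sup>2) \<partial>lborel)"
    proof (intro nn_integral_mono ennreal_leI power_mono)
      fix y
      have "(norm (x + y))\<^sup>2 \<le> (norm y + 1)\<^sup>2"
        using norm_triangle_ineq[of x y] x by (intro power_mono) auto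
      then have "Re z * (norm (x + y))\<^sup>2 \<le> 1 * (norm y + 1)\<^sup>2" using z by (intro mult_mono) auto
      then have "pi * (Re z * (norm (x + y))\<^sup>2) \<le> pi * (1 * (norm y + 1)\<^sup>2)" by (intro mult_left_mono) auto
      then have "exp (- pi * (norm y + 1)\<^sup>2) \<le> norm (gauss_factor (z, 0) (x + y))"
        unfolding norm_gauss_factor0 by (simp add: mult.assoc)
      then show "exp (- pi * (norm y + 1)\<^sup>2) * norm (g y) \<le> norm (?f (x + 1 *\<^sub>R y))"
        unfolding norm_mult by (simp add: mult_right_mono)
    qed auto
    also have "\<dots> = (\<integral>\<^sup>+y. ennreal ((norm (?f y))\<^sup>2) \<partial>lborel)"
      by (subst nn_integral_lborel_affine[where F = "\<lambda>y. ennreal ((norm (?f y))\<^sup>2)"]) auto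
    also have "\<dots> \<le> (\<integral>\<^sup>+\<xi>. ennreal ((norm (fourier ?f \<xi>))\<^sup>2) \<partial>lborel)"
      by (rule plancherel_le[OF fi fc fM])
    finally show ?thesis .
  qed
  with \<kappa>(1) show ?thesis by blast
qed

text \<open>A strongly chirped Gaussian of unit width has small supremum in frequency but fixed energy; for
  \<open>p \<le> 2\<close> this bounds its \<open>L\<^sup>p\<close> norm in frequency from below.\<close>

lemma amalgam_norm_chirp_ge:
  fixes g :: "'a::euclidean_space \<Rightarrow> complex"
  assumes e: "0 < e" and g: "g \<in> gauss_smooth e"
    and nz: "(\<integral>\<^sup>+x. ennreal ((norm (g x))\<^sup>2) \<partial>lborel) \<noteq> 0"
    and p: "1 \<le> p" "p \<le> 2" and q: "1 \<le> q" and a0: "0 < a0"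
  shows "\<exists>K>0. \<forall>z A. a0 \<le> Re z \<longrightarrow> Re z \<le> 1 \<longrightarrow> A \<noteq> 0 \<longrightarrow> Im z \<noteq> 0 \<longrightarrow>
    ennreal (norm A * (K * \<bar>Im z\<bar> powr (real DIM('a) / 2 * (2 * enn2real (1 / p) - 1))))
      \<le> amalgam_norm g p q (\<lambda>x. A * gauss_factor (z, 0) x)"
proof -
  note [measurable] = gauss_smooth_measurable[OF g]
  have "0 < a0 / 2" using a0 by simp
  from windowed_gaussian_bounds[OF e g this] obtain B C where B: "0 < B" "B \<le> a0 / 2" and C: "0 < C"
    and sup0: "\<forall>z x \<xi>. B < Re z \<longrightarrow> norm (fourier (\<lambda>y. gauss_factor (z, 0) y * g (y - x)) \<xi>)
       \<le> norm (z - of_real B) powr - (real DIM('a) / 2) * (C * exp (- (pi * B / 2) * (norm x)\<^sup>2))"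
    by (elim exE conjE) (rule that)
  note sup = sup0[rule_format]
  obtain \<kappa> where \<kappa>: "0 < \<kappa>" and L2: "\<forall>z x. 0 < Re z \<longrightarrow> Re z \<le> 1 \<longrightarrow> norm x \<le> 1 \<longrightarrow>
    ennreal \<kappa> \<le> (\<integral>\<^sup>+\<xi>. ennreal ((norm (fourier (\<lambda>y. gauss_factor (z, 0) y * g (y - x)) \<xi>))\<^sup>2) \<partial>lborel)"
    using windowed_gaussian_L2[OF e g nz] by (elim exE conjE) (rule that)
  let ?h = "real DIM('a) / 2"
  define v where "v = enn2real (1 / p)"
  have "p \<noteq> \<infinity>" using p(2) by (auto simp: top_unique)
  then have v: "0 \<le> 2 * v - 1"
  proof -
    note pf = recip_exponent[OF p(1) \<open>p \<noteq> \<infinity>\<close>]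
    have "enn2real p \<le> 2" using enn2real_mono[OF p(2)] by simp
    then show ?thesis unfolding v_def pf(2) using pf(1) by (simp add: field_simps)
  qed
  define m where "m = measure lborel (cball 0 1 :: 'a set) powr enn2real (1 / q)"
  have m: "0 < m" 
  proof -
    have "0 < measure lborel (cball 0 1 :: 'a set)" by (simp add: content_cball)
    then show ?thesis unfolding m_def by (metis powr_gt_zero less_irrefl)
  qed
  let ?K = "\<kappa> powr v * C powr (1 - 2 * v) * m"
  have K: "0 < ?K" using \<kappa> C m by simp
  have "ennreal (norm A * (?K * \<bar>Im z\<bar> powr (?h * (2 * v - 1)))) \<le> amalgam_norm g p q (\<lambda>x. A * gauss_factor (z, 0) x)"
    if z: "a0 \<le> Re z" "Re z \<le> 1" and A: "A \<noteq> 0" and Im: "Im z \<noteq> 0" for z A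
  proof -
    have zB: "B < Re z" "0 < Re z" using z a0 B by auto
    let ?S = "\<bar>Im z\<bar> powr - ?h * C"
    let ?c = "\<kappa> powr v * ?S powr (1 - 2 * v)"
    have S: "0 < ?S" "0 < ?c" using Im C \<kappa> by auto
    have inner: "ennreal (norm A * ?c) \<le> FL_norm p (\<lambda>y. A * gauss_factor (z, 0) y * g (y - x))" if x: "norm x \<le> 1" for x
    proof -
      let ?F = "fourier (\<lambda>y. gauss_factor (z, 0) y * g (y - x))"
      have [measurable]: "?F \<in> borel_measurable borel" by (intro fourier_measurable) measurable
      have FS: "norm (?F \<xi>) \<le> ?S" for \<xi>
      proof -
        have "norm (?F \<xi>) \<le> norm (z - of_real B) powr - ?h * (C * exp (- (pi * B / 2) * (norm x)\<^sup>2))"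
          by (rule sup[OF zB(1)])
        also have "\<dots> \<le> \<bar>Im z\<bar> powr - ?h * C"
        proof (intro mult_mono)
          have "\<bar>Im z\<bar> \<le> norm (z - of_real B)" using abs_Im_le_cmod[of "z - of_real B"] by simp
          then show "norm (z - of_real B) powr - ?h \<le> \<bar>Im z\<bar> powr - ?h" using Im by (intro powr_mono2') auto
          show "C * exp (- (pi * B / 2) * (norm x)\<^sup>2) \<le> C" using C B by (intro mult_left_le) auto
        qed (use C in auto)
        finally show ?thesis .
      qed
      have "ennreal ?c \<le> FL_norm p (\<lambda>y. gauss_factor (z, 0) y * g (y - x))"
        unfolding FL_norm_def v_def
        by (rule Lp_norm_ge_L2[OF p _ _ FS S(1)]) (use L2 zB z x \<kappa> in auto)
      then have "ennreal (norm A) * ennreal ?c \<le> ennreal (norm A) * FL_norm p (\<lambda>y. gauss_factor (z, 0) y * g (y - x))"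
        by (rule mult_left_mono) simp
      also have "\<dots> = FL_norm p (\<lambda>y. A * (gauss_factor (z, 0) y * g (y - x)))"
        by (rule FL_norm_cmult[OF _ p(1) A, symmetric]) measurable
      finally show ?thesis unfolding mult.assoc by (simp only: ennreal_mult'[OF norm_ge_zero] mult.assoc)
    qed
    have "0 < norm A * ?c" using A S by simp
    from Lp_norm_ge_cball[OF q this inner]
    have "ennreal (norm A * ?c * m) \<le> amalgam_norm g p q (\<lambda>x. A * gauss_factor (z, 0) x)"
      unfolding amalgam_norm_def m_def .
    also have "norm A * ?c * m = norm A * (?K * \<bar>Im z\<bar> powr (?h * (2 * v - 1)))"
    proof -
      have "- ?h * (1 - 2 * v) = ?h * (2 * v - 1)" by (simp only: minus_mult_commute minus_diff_eq)
      then have "?S powr (1 - 2 * v) = \<bar>Im z\<bar> powr (?h * (2 * v - 1)) * C powr (1 - 2 * v)"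
        unfolding powr_mult powr_powr by (simp only:)
      then show ?thesis by (simp only: mult_ac)
    qed
    finally show ?thesis .
  qed
  with K show ?thesis unfolding v_def by blast
qed

lemma powr_exponent_le:
  fixes a b c C :: real
  assumes c: "0 < c" and d: "0 < d" and le: "\<And>t. 0 < t \<Longrightarrow> t < d \<Longrightarrow> c * t powr a \<le> C * t powr b"
  shows "b \<le> a"
proof (rule ccontr)
  assume "\<not> b \<le> a"
  have id0: "((\<lambda>t. t) \<longlongrightarrow> 0) (at_right (0::real))" by (rule tendsto_ident_at)
  have "((\<lambda>t. C * t powr (b - a)) \<longlongrightarrow> C * 0 powr (b - a)) (at_right (0::real))"
  proof (intro tendsto_mult tendsto_const tendsto_powr'[OF id0 tendsto_const] disjI2 conjI)
    show "\<forall>\<^sub>F t in at_right (0::real). 0 \<le> t" using eventually_at_right_less[of "0::real"] by (auto elim: eventually_mono)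
  qed (use \<open>\<not> b \<le> a\<close> in simp)
  moreover have "\<forall>\<^sub>F t in at_right 0. c \<le> C * t powr (b - a)"
    using eventually_at_right_real[OF d]
  proof eventually_elim
    case (elim t)
    then have "c * t powr a \<le> (C * t powr (b - a)) * t powr a" using le[of t] by (simp add: powr_add[symmetric] mult.assoc)
    then show ?case using elim by (subst (asm) mult_le_cancel_right_pos) auto
  qed
  ultimately have "c \<le> C * 0 powr (b - a)"
    by (intro tendsto_lowerbound[of _ _ "at_right (0::real)"]) (auto simp: trivial_limit_at_right_real)
  with c show False by simp
qed

text \<open>The Gaussian of width \<open>t\<close> has width of order one at time \<open>t\<close>: its frequencies, of order \<open>1 / t\<close>, are then
  spread out in space.\<close>

lemma small_time_exponent:
  fixes g :: "'a::euclidean_space \<Rightarrow> complex"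
  assumes e: "0 < e" and g: "g \<in> gauss_smooth e"
    and nz: "(\<integral>\<^sup>+x. ennreal ((norm (g x))\<^sup>2) \<partial>lborel) \<noteq> 0"
    and r: "1 \<le> r" and C: "0 < C" and \<delta>: "0 < \<delta>"
    and est: "\<forall>t\<in>{0<..<\<delta>}. \<forall>u0\<in>schwartz. amalgam_norm g (conj_exponent r) r (schrodinger t u0)
      \<le> ennreal (C * t powr \<alpha>) * amalgam_norm g r (conj_exponent r) u0"
  shows "\<alpha> \<le> - 2 * real DIM('a) * (1 / 2 - enn2real (1 / r))"
proof -
  have r2: "2 \<le> r"
    by (rule fixed_time_exponent[OF e g nz r, of "C * (\<delta> / 2) powr \<alpha>" "\<delta> / 2"]) (use est C \<delta> in auto)
  define u where "u = enn2real (1 / r)"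
  note cr = conj_exponent_recip[OF r, folded u_def]
  have u: "0 \<le> u" "u \<le> 1 / 2" using r2 two_le_exponent_iff[OF r] recip_exponent_bounds[OF r] by (auto simp: u_def)
  have cr2: "conj_exponent r \<le> 2" "conj_exponent r \<noteq> \<infinity>"
  proof -
    have "conj_exponent r = 1 / ennreal (1 - u)"
      unfolding conj_exponent_def using u by (subst ennreal_recip[OF r]) (simp add: ennreal_minus u_def flip: ennreal_1)
    also have "\<dots> = ennreal (1 / (1 - u))" using u by (simp add: divide_ennreal flip: ennreal_1)
    finally have eq: "conj_exponent r = ennreal (1 / (1 - u))" .
    have "1 / (1 - u) \<le> 2" using u by (simp add: field_simps)
    then have "ennreal (1 / (1 - u)) \<le> ennreal 2" by (rule ennreal_leI)
    then show "conj_exponent r \<le> 2" unfolding eq by simp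
    show "conj_exponent r \<noteq> \<infinity>" unfolding eq by simp
  qed
  let ?d = "real DIM('a)"
  define w where "w = (4 * pi)\<^sup>2"
  have w: "0 < w" by (simp add: w_def)
  obtain K1 where K1: "0 < K1" and up: "\<forall>l\<ge>2. amalgam_norm g r (conj_exponent r) (gauss_factor (of_real l, 0))
    \<le> ennreal (K1 * l powr - (?d / 2 * (1 - u)))"
    using amalgam_norm_narrow_gaussian_le[OF e g r cr(1) cr2(2), folded u_def] by blast
  have a0: "0 < 1 / (1 + w)" using w by simp
  obtain K2 where K2: "0 < K2" and low: "\<forall>z A. 1 / (1 + w) \<le> Re z \<longrightarrow> Re z \<le> 1 \<longrightarrow> A \<noteq> 0 \<longrightarrow> Im z \<noteq> 0 \<longrightarrow>
    ennreal (norm A * (K2 * \<bar>Im z\<bar> powr (?d / 2 * (2 * (1 - u) - 1))))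
      \<le> amalgam_norm g (conj_exponent r) r (\<lambda>x. A * gauss_factor (z, 0) x)"
    using amalgam_norm_chirp_ge[OF e g nz cr(1) cr2(1) r a0, unfolded cr(2)] by blast
  let ?b = "?d / 2 * (2 * (1 - u) - 1)"
  have b: "0 \<le> ?b" using u by (intro mult_nonneg_nonneg) auto
  define c where "c = (1 + w) powr - (?d / 4) * (K2 * (4 * pi / (1 + w)) powr ?b)"
  have c: "0 < c" using w K2 by (simp add: c_def)
  have "\<alpha> + ?d * (1 - u) \<le> ?d * u"
  proof (rule powr_exponent_le[OF c, of "min \<delta> (1 / 2)" _ "C * K1"])
    show "0 < min \<delta> (1 / 2)" using \<delta> by simp
    fix t :: real assume t0: "0 < t" and "t < min \<delta> (1 / 2)"
    then have t: "0 < t" "t < \<delta>" "t < 1 / 2" by auto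
    \<comment> \<open>for this \<open>l\<close> the parameter of the solution has \<open>Re z\<close> of order one and \<open>Im z\<close> of order \<open>1 / t\<close>\<close>
    define l where "l = 1 / t\<^sup>2"
    have t2: "t\<^sup>2 \<le> 1 / 2" "t\<^sup>2 \<le> 1"
      using t power_mono[of t "1 / 2" 2] by (auto simp: power2_eq_square)
    have l: "0 < l" "2 \<le> l" using t t2 by (auto simp: l_def field_simps)
    have tl: "(4 * pi * t * l)\<^sup>2 = w / t\<^sup>2" using t by (simp add: l_def w_def power2_eq_square field_simps)
    have W: "1 + (4 * pi * t * l)\<^sup>2 = (t\<^sup>2 + w) / t\<^sup>2" unfolding tl using t by (simp add: add_divide_distrib)
    let ?z = "evolved_param t l"
    have tw: "0 < t\<^sup>2 + w" "t\<^sup>2 + w \<le> 1 + w" using t w t2 by (auto intro: add_pos_pos)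
    have Re: "Re ?z = 1 / (t\<^sup>2 + w)" unfolding evolved_param(2)[OF l(1)] W using t by (simp add: l_def)
    have Im: "\<bar>Im ?z\<bar> = 4 * pi / (t * (t\<^sup>2 + w))"
    proof -
      have "Im ?z = - (4 * pi / (t * (t\<^sup>2 + w)))"
        unfolding evolved_param(3)[OF l(1)] W using t tw by (simp add: l_def power2_eq_square)
      then show ?thesis using t tw by simp
    qed
    have w1: "1 \<le> w"
    proof -
      have "1 \<le> 4 * pi" using pi_gt3 by simp
      then have "1\<^sup>2 \<le> (4 * pi)\<^sup>2" by (intro power_mono) auto
      then show ?thesis by (simp add: w_def)
    qed
    have Reb: "1 / (1 + w) \<le> Re ?z" "Re ?z \<le> 1"
    proof -
      have "1 \<le> t\<^sup>2 + w" using w1 zero_le_power2[of t] by linarith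
      then show "1 / (1 + w) \<le> Re ?z" "Re ?z \<le> 1"
        unfolding Re using tw by (auto simp: frac_le divide_le_eq_1_pos)
    qed
    have Imb: "(4 * pi / (1 + w)) / t \<le> \<bar>Im ?z\<bar>"
    proof -
      have "4 * pi / ((1 + w) * t) \<le> 4 * pi / ((t\<^sup>2 + w) * t)" using t tw by (intro divide_left_mono mult_right_mono) auto
      then show ?thesis unfolding Im by (simp add: mult.commute)
    qed
    have Im0: "Im ?z \<noteq> 0" using Im t tw by auto
    obtain A where A: "schrodinger t (gauss_factor (of_real l, 0) :: 'a \<Rightarrow> complex) = (\<lambda>x. A * gauss_factor (?z, 0) x)"
      "norm A = (1 + (4 * pi * t * l)\<^sup>2) powr - (?d / 4)"
      by (rule schrodinger_gaussian_norm[OF l(1)])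
    have nA: "norm A = (t\<^sup>2 + w) powr - (?d / 4) * t powr (?d / 2)"
    proof -
      have "(t powr 2) powr - (?d / 4) = t powr - (?d / 2)" unfolding powr_powr by simp
      then have "(t\<^sup>2) powr - (?d / 4) = t powr - (?d / 2)" using t by simp
      then show ?thesis
        unfolding A(2) W powr_divide by (simp only: powr_minus[of t] divide_inverse inverse_inverse_eq)
    qed
    have nAge: "(1 + w) powr - (?d / 4) * t powr (?d / 2) \<le> norm A"
      unfolding nA using tw by (intro mult_right_mono powr_mono2') auto
    have "0 < norm A" unfolding nA using tw t by (intro mult_pos_pos) auto
    then have A0: "A \<noteq> 0" by simp
    have "c * t powr (?d * u) = ((1 + w) powr - (?d / 4) * t powr (?d / 2)) * (K2 * ((4 * pi / (1 + w)) / t) powr ?b)"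
    proof -
      have "t powr (?d * u) = t powr (?d / 2) / t powr ?b"
        unfolding powr_diff[symmetric] by (rule arg_cong[where f = "\<lambda>x. t powr x"]) (simp add: field_simps)
      then show ?thesis unfolding c_def powr_divide[of "4 * pi / (1 + w)" t]
        by (simp only: times_divide_eq_left times_divide_eq_right mult_ac)
    qed
    also have "\<dots> \<le> norm A * (K2 * \<bar>Im ?z\<bar> powr ?b)"
      using t w K2 by (intro mult_mono nAge mult_left_mono powr_mono2 b Imb) auto
    finally have "ennreal (c * t powr (?d * u)) \<le> ennreal (norm A * (K2 * \<bar>Im ?z\<bar> powr ?b))" by (rule ennreal_leI)
    also have "\<dots> \<le> amalgam_norm g (conj_exponent r) r (\<lambda>x. A * gauss_factor (?z, 0) x)"
      using low Reb A0 Im0 by blast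
    also have "\<dots> \<le> ennreal (C * t powr \<alpha>) * amalgam_norm g r (conj_exponent r) (gauss_factor (of_real l, 0))"
      unfolding A(1)[symmetric] using est t gaussian_schwartz[OF l(1)] by auto
    also have "\<dots> \<le> ennreal (C * t powr \<alpha>) * ennreal (K1 * l powr - (?d / 2 * (1 - u)))"
      using up l by (intro mult_left_mono) auto
    also have "\<dots> = ennreal ((C * t powr \<alpha>) * (K1 * l powr - (?d / 2 * (1 - u))))"
      using C by (intro ennreal_mult'[symmetric]) simp
    also have "(C * t powr \<alpha>) * (K1 * l powr - (?d / 2 * (1 - u))) = C * K1 * t powr (\<alpha> + ?d * (1 - u))"
    proof -
      have lt: "l = t powr - 2" using t by (simp add: l_def powr_minus_divide)
      have "l powr - (?d / 2 * (1 - u)) = t powr (?d * (1 - u))" unfolding lt powr_powr by simp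
      then show ?thesis unfolding powr_add by (simp only: mult_ac)
    qed
    finally show "c * t powr (?d * u) \<le> C * K1 * t powr (\<alpha> + ?d * (1 - u))"
      using C K1 by (subst (asm) ennreal_le_iff) auto
  qed
  then show ?thesis unfolding u_def[symmetric] by (simp add: algebra_simps)
qed

theorem proposition5p1:
  fixes g :: "real ^ 'd \<Rightarrow> complex"
  assumes "admissible_window g"
  shows
    "(\<forall>(t0::real) (r::ennreal) (C::real).
        1 \<le> r \<longrightarrow> C > 0 \<longrightarrow>
        (\<forall>u0 \<in> schwartz.
          amalgam_norm g (conj_exponent r) r (schrodinger t0 u0)
            \<le> ennreal C * amalgam_norm g r (conj_exponent r) u0) \<longrightarrow>
        r \<ge> 2)
     \<and>
     (\<forall>(\<alpha>::real) (C::real) (\<delta>::real) (r::ennreal).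
        C > 0 \<longrightarrow> \<delta> > 0 \<longrightarrow> 1 \<le> r \<longrightarrow>
        (\<forall>t \<in> {0<..<\<delta>}. \<forall>u0 \<in> schwartz.
          amalgam_norm g (conj_exponent r) r (schrodinger t u0)
            \<le> ennreal (C * t powr \<alpha>) * amalgam_norm g r (conj_exponent r) u0) \<longrightarrow>
        \<alpha> \<le> - 2 * real CARD('d) * (1 / 2 - enn2real (1 / r)))
     \<and>
     (\<forall>r::ennreal. 1 \<le> r \<longrightarrow>
        (\<exists>c::real. c > 0 \<and>
          ((\<lambda>t::real.
              amalgam_norm g (conj_exponent r) r
                (schrodinger t (\<lambda>x. of_real (exp (- pi * (norm x)\<^sup>2))))
              / ennreal (c * t powr (- real CARD('d) * (1 / 2 - enn2real (1 / r)))))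
            \<longlongrightarrow> 1) at_top))"
proof -
  obtain e where e: "0 < e" and g: "g \<in> gauss_smooth e"
    using admissible_window_gauss_smooth[OF assms] .
  have nz: "(\<integral>\<^sup>+x. ennreal ((norm (g x))\<^sup>2) \<partial>lborel) \<noteq> 0"
  proof
    assume "(\<integral>\<^sup>+x. ennreal ((norm (g x))\<^sup>2) \<partial>lborel) = 0"
    then have "Lp_norm 2 (\<lambda>x. ennreal (norm (g x))) = 0"
      by (simp add: Lp_norm_def ennreal_powr_ennreal powr_numeral ennreal_powr_def)
    with assms show False by (simp add: admissible_window_def)
  qed
  have unit: "(\<lambda>x. of_real (exp (- pi * (norm x)\<^sup>2))) = (gauss_factor (of_real 1, 0) :: real ^ 'd \<Rightarrow> complex)"
    unfolding gauss_factor_of_real by simp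
  have dim: "DIM(real ^ 'd) = CARD('d)" by simp
  show ?thesis
    using fixed_time_exponent[OF e g nz] small_time_exponent[OF e g nz, unfolded dim]
      gaussian_large_time[OF e g nz, unfolded dim] unfolding unit by blast
qed

end
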